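(* Let $A$ be a differential graded algebra over a field $k$, with a fixed $A_\infty$-structure on $H_*(A)$ and $A_\infty$-quasi-isomorphism $f\colon H_*(A)\to A$. For $1\le n\le\infty$, the assignments $$X\mapsto B_n(X,H_*(A),A),\qquad (X\xrightarrow{g}Y)\mapsto B_n(g)$$ define a functor from (minimal) $A_{n+1}$-modules over $H_*(A)$ to differential graded $A$-modules.
   Context: Conventions. $k$ is a field; complexes are homological, $\mathbb Z$-graded, possibly unbounded. $C[n]_i=C_{i+n}$, with differential $(-1)^n d$ if $C$ is a complex. Koszul signs: $(f\otimes g)(x\otimes y)=(-1)^{|g||x|}f(x)\otimes g(y)$, so $(f\otimes g)\circ(h\otimes j)=(-1)^{|g||h|}(f\circ h)\otimes(g\circ j)$. Differential graded algebras and modules are unital. $\lfloor x\rfloor$ is the greatest integer $\le x$. $A_\infty$-algebras. An $A_\infty$-algebra structure on a graded $k$-module $R$ consists of maps $m_i\colon R^{\otimes i}\to R[i-2]$, $i\ge1$, with $\sum_{r+s+t=m}(-1)^{r+st}m_{r+t+1}(1^{\otimes r}\otimes m_s\otimes 1^{\otimes t})=0$ for all $m\geq 1$. A DGA is an $A_\infty$-algebra with $m_1=d$, $m_2$ the product, $m_i=0$ for $i\ge3$. A morphism $f\colon R\to A$ of $A_\infty$-algebras consists of maps $f_i\colon R^{\otimes i}\to A[i-1]$ with $\sum_{r+s+t=m}(-1)^{r+st}f_{r+t+1}(1^{\otimes r}\otimes m_s\otimes 1^{\otimes t})=\sum_{i_1+\dots+i_u=m}(-1)^v m_u(f_{i_1}\otimes\dots\otimes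 f_{i_u})$ for all $m$, where $v=(u-1)(i_1-1)+(u-2)(i_2-1)+\dots+(i_{u-1}-1)$; it is a quasi-isomorphism if $f_1$ is. By a theorem of Kadeishvili, $H_*(A)$ has an $A_\infty$-structure with $m_1=0$ and $m_2$ the induced product, together with an $A_\infty$-quasi-isomorphism $f\colon H_*(A)\to A$; such a choice is fixed. With $d,\mu$ the differential and product of $A$, put $m_1^A=d$ and $m_l^A=(-1)^l\mu\circ(f_{l-1}\otimes1)\colon H_*(A)^{\otimes(l-1)}\otimes A\to A[l-2]$ for $l\ge2$. $A_l$-modules ($l\le\infty$). A minimal right $A_l$-module $X$ over $R=H_*(A)$ is a graded $k$-module with maps $m_i^X\colon X\otimes R^{\otimes(i-1)}\to X[i-2]$, $1\le i\le l$ ($i<\infty$), $m_1^X=0$, such that for each finite $m\le l$, $\sum_{r+s+t=m}(-1)^{r+st}m^X_{r+t+1}(1^{\otimes r}\otimes m_s\otimes1^{\otimes t})=0$, where $m_s$ means $m_s^X$ if $r=0$ and $m_s^R$ otherwise. Throughout, $m_2^X$ makes $X$ an ordinary (associative, unital) graded right $H_*(A)$-module. A morphism $g\colon X\to Y$ of $A_l$-modules consists of maps $g_i\colon X\otimes R^{\otimes(i-1)}\to Y[i-1]$, $1\le i\le l$, such that for each $m\le l$, $\sum_{r+s+t=m}(-1)^{r+st}g_{r+t+1}(1^{\otimes r}\otimes m_s\otimes 1^{\otimes t})=\sum_{i+j=m}(-1)^{(i+1)j}m^Y_{j+1}(g_i\otimes1^{\otimes j})$. Composition is $(f\circ g)_m=\sum_{r+s=m}(-1)^{(r-1)s}f_{s+1}(g_r\otimes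 1^{\otimes s})$ and the identity is $(\mathrm{id},0,0,\dots)$. Bar construction. For an $A_{n+1}$-module $X$ let $R_i=X\otimes H_*(A)^{\otimes i}\otimes A$ (a free DG right $A$-module). For $1\le l\le i+1$ let $M_{i,l}\colon R_i\to R_{i-l+1}[l-2]$ be $M_{i,l}=\sum_{a=0}^{i+2-l}(-1)^{a(l-1)}1^{\otimes a}\otimes m_l\otimes1^{\otimes(i-l-a+2)}$, where $m_l$ is $m_l^X$ in the first term ($a=0$), $m_l^A$ in the last term ($a=i+2-l$), and $m_l^{H_*(A)}$ otherwise. Then $B_n(X,H_*(A),A)=\bigoplus_{l=0}^nR_l[-l]$, with differential given on the summand $R_l$ by $\sum_{j=1}^{l+1}(-1)^{l+\lfloor (j-1)/2\rfloor}M_{l,j}$. For a morphism $g$ of $A_{n+1}$-modules, $B_n(g)$ is the upper triangular matrix with entries $B_n(g)_{i,j}=(-1)^{\lfloor (j-i+1)/2\rfloor}g_{j-i+1}\otimes1^{\otimes i}$, $1\le i\le j\le n+1$, mapping the summand on $X\otimes H_*(A)^{\otimes(j-1)}\otimes A$ to the summand on $Y\otimes H_*(A)^{\otimes(i-1)}\otimes A$. *)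

theory Defs
  imports Complex_Main "HOL-Library.Function_Algebras" "HOL-Library.Extended_Nat"
begin

section \<open>Graded vector spaces\<close>

text \<open>
  A \<open>\<int>\<close>-graded vector space is a family \<open>hcomp V d\<close> (\<open>d\<close> an integer) of subspaces of one ambient
  vector space; no independence of the subspaces is required, so this is just a family of vector
  spaces. Homogeneous elements are therefore carried around together with their degree, as pairs
  \<open>(d, v)\<close> with \<open>v \<in> hcomp V d\<close>. A (multi)linear map of graded vector spaces is a function of such
  pairs which is (multi)linear for every fixed choice of the degrees; its values are untagged, their
  degree being determined by the degree of the map.
\<close>

record ('k, 'v) gmod =
  smul :: "'k \<Rightarrow> 'v \<Rightarrow> 'v"
  hcomp :: "int \<Rightarrow> 'v set"

definition gmodule :: "('k::field, 'v::ab_group_add, 'z) gmod_scheme \<Rightarrow> bool" where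
  "gmodule V \<longleftrightarrow> vector_space (smul V) \<and> (\<forall>d. module.subspace (smul V) (hcomp V d))"

definition hel :: "('k, 'v, 'z) gmod_scheme \<Rightarrow> (int \<times> 'v) set" where
  "hel V = {w. snd w \<in> hcomp V (fst w)}"

text \<open>\<open>ksgn e v\<close> is \<open>(-1)\<^sup>e v\<close>.\<close>

definition ksgn :: "int \<Rightarrow> 'v::ab_group_add \<Rightarrow> 'v" where
  "ksgn e v = (if even e then v else - v)"

text \<open>Total degree of a word \<open>x\<^sub>1 \<otimes> \<dots> \<otimes> x\<^sub>m\<close> of homogeneous elements.\<close>

definition dl :: "(int \<times> 'v) list \<Rightarrow> int" where
  "dl ws = sum_list (map fst ws)"

definition hlin :: "('k::field, 'v::ab_group_add, 'z) gmod_scheme \<Rightarrow> ('k \<Rightarrow> 'w \<Rightarrow> 'w) \<Rightarrow>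
    (int \<times> 'v \<Rightarrow> 'w::ab_group_add) \<Rightarrow> bool" where
  "hlin V s F \<longleftrightarrow> (\<forall>d. \<forall>x\<in>hcomp V d.
      (\<forall>y\<in>hcomp V d. F (d, x + y) = F (d, x) + F (d, y)) \<and>
      (\<forall>c. F (d, smul V c x) = s c (F (d, x))))"

text \<open>
  A family of maps \<open>R\<^sup>\<otimes>\<^sup>i \<rightarrow> W\<close>, one for each \<open>i\<close>, is a single function \<open>F\<close> on words, the member of
  the family with index \<open>i\<close> being its restriction to words of length \<open>i\<close>. The following predicate
  says that these maps are multilinear for \<open>i < l\<close>.
\<close>

definition mlin :: "enat \<Rightarrow> ('k::field, 'r::ab_group_add, 'z) gmod_scheme \<Rightarrow> ('k \<Rightarrow> 'w \<Rightarrow> 'w) \<Rightarrow>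
    ((int \<times> 'r) list \<Rightarrow> 'w::ab_group_add) \<Rightarrow> bool" where
  "mlin l R s F \<longleftrightarrow> (\<forall>us vs. set us \<subseteq> hel R \<longrightarrow> set vs \<subseteq> hel R \<longrightarrow>
      enat (length us + 1 + length vs) < l \<longrightarrow> hlin R s (\<lambda>h. F (us @ h # vs)))"

text \<open>The same for maps \<open>X \<otimes> R\<^sup>\<otimes>\<^sup>i \<rightarrow> W\<close>, \<open>i < l\<close>.\<close>

definition mlinX :: "enat \<Rightarrow> ('k::field, 'x::ab_group_add, 'z1) gmod_scheme \<Rightarrow>
    ('k, 'r::ab_group_add, 'z2) gmod_scheme \<Rightarrow> ('k \<Rightarrow> 'w \<Rightarrow> 'w) \<Rightarrow>
    (int \<times> 'x \<Rightarrow> (int \<times> 'r) list \<Rightarrow> 'w::ab_group_add) \<Rightarrow> bool" where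
  "mlinX l X R s F \<longleftrightarrow>
     (\<forall>hs. set hs \<subseteq> hel R \<longrightarrow> enat (length hs) < l \<longrightarrow> hlin X s (\<lambda>x. F x hs)) \<and>
     (\<forall>x\<in>hel X. mlin l R s (F x))"


section \<open>Differential graded algebras and modules\<close>

record ('k, 'a) dga = "('k, 'a) gmod" +
  dif :: "int \<times> 'a \<Rightarrow> 'a"
  mul :: "int \<times> 'a \<Rightarrow> int \<times> 'a \<Rightarrow> 'a"
  unt :: 'a

definition dg_algebra :: "('k::field, 'a::ab_group_add) dga \<Rightarrow> bool" where
  "dg_algebra A \<longleftrightarrow> gmodule A \<and>
     hlin A (smul A) (dif A) \<and>
     (\<forall>p. \<forall>a\<in>hcomp A p. dif A (p, a) \<in> hcomp A (p - 1) \<and> dif A (p - 1, dif A (p, a)) = 0) \<and>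
     (\<forall>u\<in>hel A. hlin A (smul A) (mul A u) \<and> hlin A (smul A) (\<lambda>v. mul A v u)) \<and>
     unt A \<in> hcomp A 0 \<and>
     (\<forall>p. \<forall>a\<in>hcomp A p. mul A (p, a) (0, unt A) = a \<and> mul A (0, unt A) (p, a) = a) \<and>
     (\<forall>p q. \<forall>a\<in>hcomp A p. \<forall>b\<in>hcomp A q.
        mul A (p, a) (q, b) \<in> hcomp A (p + q) \<and>
        dif A (p + q, mul A (p, a) (q, b)) =
          mul A (p - 1, dif A (p, a)) (q, b) + ksgn p (mul A (p, a) (q - 1, dif A (q, b)))) \<and>
     (\<forall>p q r. \<forall>a\<in>hcomp A p. \<forall>b\<in>hcomp A q. \<forall>c\<in>hcomp A r.
        mul A (p + q, mul A (p, a) (q, b)) (r, c) = mul A (p, a) (q + r, mul A (q, b) (r, c)))"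

record ('k, 'm, 'a) dgm = "('k, 'm) gmod" +
  mdif :: "int \<times> 'm \<Rightarrow> 'm"
  act :: "int \<times> 'm \<Rightarrow> int \<times> 'a \<Rightarrow> 'm"

definition dg_module :: "('k::field, 'a::ab_group_add) dga \<Rightarrow>
    ('k, 'm::ab_group_add, 'a) dgm \<Rightarrow> bool" where
  "dg_module A M \<longleftrightarrow> gmodule M \<and>
     hlin M (smul M) (mdif M) \<and>
     (\<forall>p. \<forall>x\<in>hcomp M p. mdif M (p, x) \<in> hcomp M (p - 1) \<and> mdif M (p - 1, mdif M (p, x)) = 0) \<and>
     (\<forall>x\<in>hel M. hlin A (smul M) (act M x)) \<and>
     (\<forall>a\<in>hel A. hlin M (smul M) (\<lambda>x. act M x a)) \<and>
     (\<forall>p. \<forall>x\<in>hcomp M p. act M (p, x) (0, unt A) = x) \<and>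
     (\<forall>p q. \<forall>x\<in>hcomp M p. \<forall>a\<in>hcomp A q.
        act M (p, x) (q, a) \<in> hcomp M (p + q) \<and>
        mdif M (p + q, act M (p, x) (q, a)) =
          act M (p - 1, mdif M (p, x)) (q, a) + ksgn p (act M (p, x) (q - 1, dif A (q, a)))) \<and>
     (\<forall>p q r. \<forall>x\<in>hcomp M p. \<forall>a\<in>hcomp A q. \<forall>b\<in>hcomp A r.
        act M (p + q, act M (p, x) (q, a)) (r, b) = act M (p, x) (q + r, mul A (q, a) (r, b)))"

definition dgm_morphism :: "('k::field, 'a::ab_group_add) dga \<Rightarrow> ('k, 'm::ab_group_add, 'a) dgm \<Rightarrow>
    ('k, 'n::ab_group_add, 'a) dgm \<Rightarrow> (int \<times> 'm \<Rightarrow> 'n) \<Rightarrow> bool" where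
  "dgm_morphism A M N \<phi> \<longleftrightarrow> hlin M (smul N) \<phi> \<and>
     (\<forall>p. \<forall>x\<in>hcomp M p. \<phi> (p, x) \<in> hcomp N p \<and>
        mdif N (p, \<phi> (p, x)) = \<phi> (p - 1, mdif M (p, x)) \<and>
        (\<forall>q. \<forall>a\<in>hcomp A q. act N (p, \<phi> (p, x)) (q, a) = \<phi> (p + q, act M (p, x) (q, a))))"


section \<open>\<open>A\<^sub>\<infinity>\<close>-algebras\<close>

text \<open>\<open>mm R\<close> restricted to words of length \<open>i \<ge> 1\<close> is \<open>m\<^sub>i\<close>; its value on the empty word is irrelevant.\<close>

record ('k, 'r) ainf = "('k, 'r) gmod" +
  mm :: "(int \<times> 'r) list \<Rightarrow> 'r"

text \<open>The triples \<open>(r, s, t)\<close> indexing the \<open>A\<^sub>\<infinity>\<close>-relations (there is no \<open>m\<^sub>0\<close>).\<close>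

definition splits :: "nat \<Rightarrow> (nat \<times> nat \<times> nat) set" where
  "splits m = {(r, s, t). r + s + t = m \<and> 1 \<le> s}"

text \<open>
  The word \<open>(1\<^sup>\<otimes>\<^sup>r \<otimes> m\<^sub>s \<otimes> 1\<^sup>\<otimes>\<^sup>t)(ws)\<close> without its Koszul sign, which is
  \<open>(-1)\<close> to the power \<open>(s - 2)(|w\<^sub>1| + \<dots> + |w\<^sub>r|)\<close>.
\<close>

definition insR :: "('k, 'r) ainf \<Rightarrow> nat \<Rightarrow> nat \<Rightarrow> (int \<times> 'r) list \<Rightarrow> (int \<times> 'r) list" where
  "insR R r s ws = take r ws @
     (dl (take s (drop r ws)) + int s - 2, mm R (take s (drop r ws))) # drop (r + s) ws"

definition appR :: "('k, 'r) ainf \<Rightarrow> ((int \<times> 'r) list \<Rightarrow> 'w::ab_group_add) \<Rightarrow>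
    nat \<Rightarrow> nat \<Rightarrow> (int \<times> 'r) list \<Rightarrow> 'w" where
  "appR R G r s ws = ksgn ((int s - 2) * dl (take r ws)) (G (insR R r s ws))"

definition ainf_algebra :: "('k::field, 'r::ab_group_add) ainf \<Rightarrow> bool" where
  "ainf_algebra R \<longleftrightarrow> gmodule R \<and> mlin \<infinity> R (smul R) (mm R) \<and>
     (\<forall>ws. ws \<noteq> [] \<longrightarrow> set ws \<subseteq> hel R \<longrightarrow>
        mm R ws \<in> hcomp R (dl ws + int (length ws) - 2) \<and>
        (\<Sum>(r, s, t)\<in>splits (length ws). ksgn (int (r + s * t)) (appR R (mm R) r s ws)) = 0)"

text \<open>A differential graded algebra as an \<open>A\<^sub>\<infinity>\<close>-algebra.\<close>

fun dga_mm :: "('k, 'a::ab_group_add) dga \<Rightarrow> (int \<times> 'a) list \<Rightarrow> 'a" where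
  "dga_mm A [a] = dif A a"
| "dga_mm A [a, b] = mul A a b"
| "dga_mm A _ = 0"

definition ainf_of :: "('k, 'a::ab_group_add) dga \<Rightarrow> ('k, 'a) ainf" where
  "ainf_of A = \<lparr>smul = smul A, hcomp = hcomp A, mm = dga_mm A\<rparr>"

text \<open>
  For a composition \<open>is = (i\<^sub>1, \<dots>, i\<^sub>u)\<close> of the length of \<open>ws\<close>, \<open>blocks f is ws\<close> is the word
  \<open>(f\<^bsub>i\<^sub>1\<^esub> \<otimes> \<dots> \<otimes> f\<^bsub>i\<^sub>u\<^esub>)(ws)\<close> up to its Koszul sign, whose exponent is \<open>kblocks is ws\<close>;
  \<open>vblocks is\<close> is the exponent \<open>(u - 1)(i\<^sub>1 - 1) + (u - 2)(i\<^sub>2 - 1) + \<dots>\<close>.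
\<close>

definition comps :: "nat \<Rightarrow> nat list set" where
  "comps m = {is. sum_list is = m \<and> 0 \<notin> set is}"

fun blocks :: "((int \<times> 'r) list \<Rightarrow> 's) \<Rightarrow> nat list \<Rightarrow> (int \<times> 'r) list \<Rightarrow> (int \<times> 's) list" where
  "blocks f [] ws = []"
| "blocks f (i # is) ws =
     (dl (take i ws) + int i - 1, f (take i ws)) # blocks f is (drop i ws)"

fun kblocks :: "nat list \<Rightarrow> (int \<times> 'r) list \<Rightarrow> int" where
  "kblocks [] ws = 0"
| "kblocks (i # is) ws = (\<Sum>j\<leftarrow>is. int j - 1) * dl (take i ws) + kblocks is (drop i ws)"

fun vblocks :: "nat list \<Rightarrow> int" where
  "vblocks [] = 0"
| "vblocks (i # is) = int (length is) * (int i - 1) + vblocks is"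

definition ainf_morphism :: "('k::field, 'r::ab_group_add) ainf \<Rightarrow> ('k, 's::ab_group_add) ainf \<Rightarrow>
    ((int \<times> 'r) list \<Rightarrow> 's) \<Rightarrow> bool" where
  "ainf_morphism R S f \<longleftrightarrow> mlin \<infinity> R (smul S) f \<and>
     (\<forall>ws. ws \<noteq> [] \<longrightarrow> set ws \<subseteq> hel R \<longrightarrow>
        f ws \<in> hcomp S (dl ws + int (length ws) - 1) \<and>
        (\<Sum>(r, s, t)\<in>splits (length ws). ksgn (int (r + s * t)) (appR R f r s ws)) =
        (\<Sum>is\<in>comps (length ws). ksgn (vblocks is + kblocks is ws) (mm S (blocks f is ws))))"

text \<open>Cycles, boundaries and homology of the complex \<open>(R, m\<^sub>1)\<close>.\<close>

definition cyc :: "('k, 'r::ab_group_add) ainf \<Rightarrow> int \<Rightarrow> 'r set" where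
  "cyc R d = {z \<in> hcomp R d. mm R [(d, z)] = 0}"

definition bnd :: "('k, 'r) ainf \<Rightarrow> int \<Rightarrow> 'r set" where
  "bnd R d = (\<lambda>y. mm R [(d + 1, y)]) ` hcomp R (d + 1)"

definition hclass :: "('k, 'r::ab_group_add) ainf \<Rightarrow> int \<Rightarrow> 'r \<Rightarrow> 'r set" where
  "hclass R d z = (\<lambda>b. z + b) ` bnd R d"

definition homology :: "('k, 'r::ab_group_add) ainf \<Rightarrow> int \<Rightarrow> 'r set set" where
  "homology R d = hclass R d ` cyc R d"

definition ainf_quasi_iso :: "('k::field, 'r::ab_group_add) ainf \<Rightarrow> ('k, 's::ab_group_add) ainf \<Rightarrow>
    ((int \<times> 'r) list \<Rightarrow> 's) \<Rightarrow> bool" where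
  "ainf_quasi_iso R S f \<longleftrightarrow> ainf_morphism R S f \<and>
     (\<forall>d. \<exists>\<phi>. bij_betw \<phi> (homology R d) (homology S d) \<and>
        (\<forall>z\<in>cyc R d. \<phi> (hclass R d z) = hclass S d (f [(d, z)])))"

text \<open>
  \<open>H\<close> is \<open>H\<^sub>*(A)\<close> with an \<open>A\<^sub>\<infinity>\<close>-structure such that \<open>m\<^sub>1 = 0\<close> and \<open>m\<^sub>2\<close> is the induced product.
  The quotient of cycles by boundaries is presented by its projection: \<open>cls (d, _)\<close> is a linear
  surjection from the cycles of degree \<open>d\<close> onto \<open>hcomp H d\<close> whose kernel is the boundaries.
\<close>

definition homology_ainf :: "('k::field, 'a::ab_group_add) dga \<Rightarrow> ('k, 'h::ab_group_add) ainf \<Rightarrow>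
    (int \<times> 'a \<Rightarrow> 'h) \<Rightarrow> bool" where
  "homology_ainf A H cls \<longleftrightarrow> ainf_algebra H \<and>
     (\<forall>d. (\<lambda>z. cls (d, z)) ` cyc (ainf_of A) d = hcomp H d \<and>
        (\<forall>z\<in>cyc (ainf_of A) d.
           (\<forall>w\<in>cyc (ainf_of A) d. cls (d, z + w) = cls (d, z) + cls (d, w)) \<and>
           (\<forall>c. cls (d, smul A c z) = smul H c (cls (d, z))) \<and>
           (cls (d, z) = 0 \<longleftrightarrow> z \<in> bnd (ainf_of A) d))) \<and>
     (\<forall>d. \<forall>x\<in>hcomp H d. mm H [(d, x)] = 0) \<and>
     (\<forall>p q. \<forall>z\<in>cyc (ainf_of A) p. \<forall>w\<in>cyc (ainf_of A) q.
        mm H [(p, cls (p, z)), (q, cls (q, w))] = cls (p + q, mul A (p, z) (q, w)))"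


section \<open>Minimal \<open>A\<^sub>l\<close>-modules\<close>

text \<open>\<open>mX X x hs\<close> is \<open>m\<^sub>i (x \<otimes> hs)\<close> where \<open>i = length hs + 1\<close>.\<close>

record ('k, 'x, 'h) amod = "('k, 'x) gmod" +
  mX :: "int \<times> 'x \<Rightarrow> (int \<times> 'h) list \<Rightarrow> 'x"

text \<open>
  \<open>G \<circ> (1\<^sup>\<otimes>\<^sup>r \<otimes> m\<^sub>s \<otimes> 1\<^sup>\<otimes>\<^sup>t)\<close> evaluated at \<open>x \<otimes> hs\<close>, with its Koszul sign; \<open>m\<^sub>s\<close> is \<open>m\<^sub>s\<^sup>X\<close> if \<open>r = 0\<close>
  and \<open>m\<^sub>s\<^sup>R\<close> otherwise.
\<close>

definition appX :: "('k, 'h) ainf \<Rightarrow> ('k, 'x, 'h) amod \<Rightarrow>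
    (int \<times> 'x \<Rightarrow> (int \<times> 'h) list \<Rightarrow> 'w::ab_group_add) \<Rightarrow>
    nat \<Rightarrow> nat \<Rightarrow> int \<times> 'x \<Rightarrow> (int \<times> 'h) list \<Rightarrow> 'w" where
  "appX H X G r s x hs =
     (if r = 0
      then G (fst x + dl (take (s - 1) hs) + int s - 2, mX X x (take (s - 1) hs)) (drop (s - 1) hs)
      else ksgn ((int s - 2) * (fst x + dl (take (r - 1) hs))) (G x (insR H (r - 1) s hs)))"

text \<open>
  \<open>e\<close> is the unit of the graded algebra \<open>H\<close>. Associativity of \<open>m\<^sub>2\<close> is a consequence of the relations
  when \<open>l \<ge> 3\<close>, but not when \<open>l = 2\<close>.
\<close>

definition amodule :: "enat \<Rightarrow> ('k::field, 'h::ab_group_add) ainf \<Rightarrow> 'h \<Rightarrow>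
    ('k, 'x::ab_group_add, 'h) amod \<Rightarrow> bool" where
  "amodule l H e X \<longleftrightarrow> gmodule X \<and> mlinX l X H (smul X) (mX X) \<and>
     (\<forall>x\<in>hel X. mX X x [] = 0) \<and>
     (\<forall>x\<in>hel X. \<forall>hs. set hs \<subseteq> hel H \<longrightarrow> enat (length hs) < l \<longrightarrow>
        mX X x hs \<in> hcomp X (fst x + dl hs + int (length hs) - 1) \<and>
        (\<Sum>(r, s, t)\<in>splits (length hs + 1). ksgn (int (r + s * t)) (appX H X (mX X) r s x hs)) = 0) \<and>
     (\<forall>x\<in>hel X. mX X x [(0, e)] = snd x) \<and>
     (\<forall>x\<in>hel X. \<forall>g\<in>hel H. \<forall>h\<in>hel H.
        mX X (fst x + fst g, mX X x [g]) [h] = mX X x [(fst g + fst h, mm H [g, h])])"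

text \<open>\<open>g x hs\<close> is \<open>g\<^sub>i (x \<otimes> hs)\<close> where \<open>i = length hs + 1\<close>.\<close>

definition amod_morphism :: "enat \<Rightarrow> ('k::field, 'h::ab_group_add) ainf \<Rightarrow>
    ('k, 'x::ab_group_add, 'h) amod \<Rightarrow> ('k, 'y::ab_group_add, 'h) amod \<Rightarrow>
    (int \<times> 'x \<Rightarrow> (int \<times> 'h) list \<Rightarrow> 'y) \<Rightarrow> bool" where
  "amod_morphism l H X Y g \<longleftrightarrow> mlinX l X H (smul Y) g \<and>
     (\<forall>x\<in>hel X. \<forall>hs. set hs \<subseteq> hel H \<longrightarrow> enat (length hs) < l \<longrightarrow>
        g x hs \<in> hcomp Y (fst x + dl hs + int (length hs)) \<and>
        (\<Sum>(r, s, t)\<in>splits (length hs + 1). ksgn (int (r + s * t)) (appX H X g r s x hs)) =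
        (\<Sum>(i, j)\<in>{(i, j). i + j = length hs + 1 \<and> 1 \<le> i}. ksgn (int ((i + 1) * j))
           (mX Y (fst x + dl (take (i - 1) hs) + int i - 1, g x (take (i - 1) hs)) (drop (i - 1) hs))))"

definition amod_comp :: "enat \<Rightarrow> (int \<times> 'y \<Rightarrow> (int \<times> 'h) list \<Rightarrow> 'z::ab_group_add) \<Rightarrow>
    (int \<times> 'x \<Rightarrow> (int \<times> 'h) list \<Rightarrow> 'y) \<Rightarrow> int \<times> 'x \<Rightarrow> (int \<times> 'h) list \<Rightarrow> 'z" where
  "amod_comp l f g x hs =
     (if enat (length hs) < l then
        (\<Sum>(r, s)\<in>{(r, s). r + s = length hs + 1 \<and> 1 \<le> r}. ksgn ((int r - 1) * int s)
           (f (fst x + dl (take (r - 1) hs) + int r - 1, g x (take (r - 1) hs)) (drop (r - 1) hs)))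
      else 0)"

definition amod_id :: "('k, 'h) ainf \<Rightarrow> ('k, 'x::ab_group_add, 'h) amod \<Rightarrow>
    int \<times> 'x \<Rightarrow> (int \<times> 'h) list \<Rightarrow> 'x" where
  "amod_id H X x hs = (if x \<in> hel X \<and> hs = [] then snd x else 0)"


section \<open>Categories and functors\<close>

record ('o, 'm) cat =
  Obj :: "'o set"
  Hom :: "'o \<Rightarrow> 'o \<Rightarrow> 'm set"
  Idm :: "'o \<Rightarrow> 'm"
  Cmp :: "'m \<Rightarrow> 'm \<Rightarrow> 'm"

definition is_category :: "('o, 'm) cat \<Rightarrow> bool" where
  "is_category C \<longleftrightarrow>
     (\<forall>X\<in>Obj C. Idm C X \<in> Hom C X X) \<and>
     (\<forall>X\<in>Obj C. \<forall>Y\<in>Obj C. \<forall>g\<in>Hom C X Y. Cmp C g (Idm C X) = g \<and> Cmp C (Idm C Y) g = g) \<and>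
     (\<forall>X\<in>Obj C. \<forall>Y\<in>Obj C. \<forall>Z\<in>Obj C. \<forall>g\<in>Hom C X Y. \<forall>f\<in>Hom C Y Z. Cmp C f g \<in> Hom C X Z) \<and>
     (\<forall>W\<in>Obj C. \<forall>X\<in>Obj C. \<forall>Y\<in>Obj C. \<forall>Z\<in>Obj C. \<forall>h\<in>Hom C W X. \<forall>g\<in>Hom C X Y. \<forall>f\<in>Hom C Y Z.
        Cmp C f (Cmp C g h) = Cmp C (Cmp C f g) h)"

definition is_functor :: "('o, 'm) cat \<Rightarrow> ('p, 'n) cat \<Rightarrow> ('o \<Rightarrow> 'p) \<Rightarrow> ('o \<Rightarrow> 'o \<Rightarrow> 'm \<Rightarrow> 'n) \<Rightarrow> bool"
  where
  "is_functor C D Fo Fm \<longleftrightarrow> is_category C \<and> is_category D \<and>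
     (\<forall>X\<in>Obj C. Fo X \<in> Obj D) \<and>
     (\<forall>X\<in>Obj C. \<forall>Y\<in>Obj C. \<forall>g\<in>Hom C X Y. Fm X Y g \<in> Hom D (Fo X) (Fo Y)) \<and>
     (\<forall>X\<in>Obj C. Fm X X (Idm C X) = Idm D (Fo X)) \<and>
     (\<forall>X\<in>Obj C. \<forall>Y\<in>Obj C. \<forall>Z\<in>Obj C. \<forall>g\<in>Hom C X Y. \<forall>f\<in>Hom C Y Z.
        Fm X Z (Cmp C f g) = Cmp D (Fm Y Z f) (Fm X Y g))"

text \<open>
  Morphisms are normalized to be \<open>0\<close> outside the arguments on which they are meant to be defined, so
  that equality of morphisms is equality of functions.
\<close>

definition amod_cat :: "enat \<Rightarrow> ('k::field, 'h::ab_group_add) ainf \<Rightarrow> 'h \<Rightarrow>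
    (('k, 'x::ab_group_add, 'h) amod, int \<times> 'x \<Rightarrow> (int \<times> 'h) list \<Rightarrow> 'x) cat" where
  "amod_cat l H e =
    \<lparr>Obj = {X. amodule l H e X},
     Hom = (\<lambda>X Y. {g. amod_morphism l H X Y g \<and>
        (\<forall>x hs. \<not> (x \<in> hel X \<and> set hs \<subseteq> hel H \<and> enat (length hs) < l) \<longrightarrow> g x hs = 0)}),
     Idm = amod_id H,
     Cmp = amod_comp l\<rparr>"

definition dgm_cat :: "('k::field, 'a::ab_group_add) dga \<Rightarrow>
    (('k, 'm::ab_group_add, 'a) dgm, int \<times> 'm \<Rightarrow> 'm) cat" where
  "dgm_cat A =
    \<lparr>Obj = {M. dg_module A M},
     Hom = (\<lambda>M N. {\<phi>. dgm_morphism A M N \<phi> \<and> (\<forall>x. x \<notin> hel M \<longrightarrow> \<phi> x = 0)}),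
     Idm = (\<lambda>M x. if x \<in> hel M then snd x else 0),
     Cmp = (\<lambda>\<phi> \<psi> x. \<phi> (fst x, \<psi> x))\<rparr>"


section \<open>The tensor products \<open>X \<otimes> H\<^sup>\<otimes>\<^sup>i \<otimes> A\<close>\<close>

type_synonym ('x, 'h, 'a) word = "(int \<times> 'x) \<times> (int \<times> 'h) list \<times> (int \<times> 'a)"

type_synonym ('k, 'x, 'h, 'a) tensor = "(('x, 'h, 'a) word \<Rightarrow> 'k) \<Rightarrow> 'k"

definition hwords :: "('k, 'x, 'z1) gmod_scheme \<Rightarrow> ('k, 'h, 'z2) gmod_scheme \<Rightarrow>
    ('k, 'a, 'z3) gmod_scheme \<Rightarrow> ('x, 'h, 'a) word set" where
  "hwords X H A = {(x, hs, a). x \<in> hel X \<and> set hs \<subseteq> hel H \<and> a \<in> hel A}"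

definition wlen :: "('x, 'h, 'a) word \<Rightarrow> nat" where
  "wlen w = length (fst (snd w))"

definition wdeg :: "('x, 'h, 'a) word \<Rightarrow> int" where
  "wdeg = (\<lambda>(x, hs, a). fst x + dl hs + fst a)"

definition mlin3 :: "('k::field, 'x::ab_group_add, 'z1) gmod_scheme \<Rightarrow>
    ('k, 'h::ab_group_add, 'z2) gmod_scheme \<Rightarrow> ('k, 'a::ab_group_add, 'z3) gmod_scheme \<Rightarrow>
    ('k \<Rightarrow> 'w \<Rightarrow> 'w) \<Rightarrow> (('x, 'h, 'a) word \<Rightarrow> 'w::ab_group_add) \<Rightarrow> bool" where
  "mlin3 X H A s F \<longleftrightarrow>
     (\<forall>a\<in>hel A. mlinX \<infinity> X H s (\<lambda>x hs. F (x, hs, a))) \<and>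
     (\<forall>x\<in>hel X. \<forall>hs. set hs \<subseteq> hel H \<longrightarrow> hlin A s (\<lambda>a. F (x, hs, a)))"

text \<open>
  Tensors are modelled inside a dual space: the pure tensor \<open>x \<otimes> h\<^sub>1 \<otimes> \<dots> \<otimes> h\<^sub>i \<otimes> a\<close> is evaluation of
  multilinear forms at the word \<open>(x, [h\<^sub>1, \<dots>, h\<^sub>i], a)\<close>, and the tensor product is the span of the
  pure tensors. Over a field this has the universal property of the tensor product, see
  \<open>tensor_universal\<close> below. Since a multilinear form may be chosen independently for each
  number \<open>i\<close> and each tuple of degrees, the tensor products of the homogeneous components belonging to
  different \<open>i\<close> or different tuples of degrees are independent.
\<close>

definition pure_tensor :: "('k::field, 'x::ab_group_add, 'z1) gmod_scheme \<Rightarrow>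
    ('k, 'h::ab_group_add, 'z2) gmod_scheme \<Rightarrow> ('k, 'a::ab_group_add, 'z3) gmod_scheme \<Rightarrow>
    ('x, 'h, 'a) word \<Rightarrow> ('k, 'x, 'h, 'a) tensor" where
  "pure_tensor X H A w = (\<lambda>\<psi>. if mlin3 X H A (*) \<psi> then \<psi> w else 0)"

definition tscale :: "'k::field \<Rightarrow> ('k, 'x, 'h, 'a) tensor \<Rightarrow> ('k, 'x, 'h, 'a) tensor" where
  "tscale c t = (\<lambda>\<psi>. c * t \<psi>)"

text \<open>The part of degree \<open>e\<close> of \<open>R\<^sub>i = X \<otimes> H\<^sup>\<otimes>\<^sup>i \<otimes> A\<close>.\<close>

definition tens :: "('k::field, 'x::ab_group_add, 'z1) gmod_scheme \<Rightarrow>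
    ('k, 'h::ab_group_add, 'z2) gmod_scheme \<Rightarrow> ('k, 'a::ab_group_add, 'z3) gmod_scheme \<Rightarrow>
    nat \<Rightarrow> int \<Rightarrow> ('k, 'x, 'h, 'a) tensor set" where
  "tens X H A i e =
     module.span tscale (pure_tensor X H A ` {w \<in> hwords X H A. wlen w = i \<and> wdeg w = e})"

text \<open>
  The linear extension to \<open>X \<otimes> H\<^sup>\<otimes>\<^sup>i \<otimes> A\<close> of a tensor-valued map \<open>F\<close> given on the words of length \<open>i\<close>
  and multilinear there. In this model it is transposition; see \<open>tlift_pure\<close>.
\<close>

definition tlift :: "nat \<Rightarrow> (('x, 'h, 'a) word \<Rightarrow> ('k::field, 'y, 'g, 'b) tensor) \<Rightarrow>
    ('k, 'x, 'h, 'a) tensor \<Rightarrow> ('k, 'y, 'g, 'b) tensor" where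
  "tlift i F t = (\<lambda>\<psi>. t (\<lambda>w. if wlen w = i then F w \<psi> else 0))"


section \<open>The bar construction\<close>

text \<open>\<open>mA A f hs a\<close> is \<open>m\<^sub>l\<^sup>A (hs \<otimes> a)\<close> where \<open>l = length hs + 1\<close>.\<close>

definition mA :: "('k, 'a::ab_group_add) dga \<Rightarrow> ((int \<times> 'h) list \<Rightarrow> 'a) \<Rightarrow>
    (int \<times> 'h) list \<Rightarrow> int \<times> 'a \<Rightarrow> 'a" where
  "mA A f hs a =
     (if hs = [] then dif A a
      else ksgn (int (length hs + 1)) (mul A (dl hs + int (length hs) - 1, f hs) a))"

text \<open>The value of \<open>1\<^sup>\<otimes>\<^sup>r \<otimes> m\<^sub>l \<otimes> 1\<^sup>\<otimes>\<^sup>(\<^sup>i\<^sup>-\<^sup>l\<^sup>-\<^sup>r\<^sup>+\<^sup>2\<^sup>)\<close> on a word of \<open>R\<^sub>i\<close>, as a tensor in \<open>R\<^bsub>i-l+1\<^esub>\<close>.\<close>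

definition bar_term :: "('k::field, 'h::ab_group_add) ainf \<Rightarrow> ('k, 'a::ab_group_add) dga \<Rightarrow>
    ((int \<times> 'h) list \<Rightarrow> 'a) \<Rightarrow> ('k, 'x::ab_group_add, 'h) amod \<Rightarrow> nat \<Rightarrow> nat \<Rightarrow>
    ('x, 'h, 'a) word \<Rightarrow> ('k, 'x, 'h, 'a) tensor" where
  "bar_term H A f X l r = (\<lambda>(x, hs, a).
     if r + l < length hs + 2
     then appX H X (\<lambda>x' hs'. pure_tensor X H A (x', hs', a)) r l x hs
     else ksgn ((int l - 2) * (fst x + dl (take (r - 1) hs)))
       (pure_tensor X H A (x, take (r - 1) hs,
          (dl (drop (r - 1) hs) + fst a + int l - 2, mA A f (drop (r - 1) hs) a))))"

text \<open>\<open>M\<^bsub>i,l\<^esub> : R\<^sub>i \<rightarrow> R\<^bsub>i-l+1\<^esub>[l-2]\<close>\<close>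

definition bar_M :: "('k::field, 'h::ab_group_add) ainf \<Rightarrow> ('k, 'a::ab_group_add) dga \<Rightarrow>
    ((int \<times> 'h) list \<Rightarrow> 'a) \<Rightarrow> ('k, 'x::ab_group_add, 'h) amod \<Rightarrow> nat \<Rightarrow> nat \<Rightarrow>
    ('k, 'x, 'h, 'a) tensor \<Rightarrow> ('k, 'x, 'h, 'a) tensor" where
  "bar_M H A f X i l =
     tlift i (\<lambda>w. \<Sum>r = 0..i + 2 - l. ksgn (int (r * (l - 1))) (bar_term H A f X l r w))"

text \<open>
  Elements of \<open>\<Oplus>\<^sub>l R\<^sub>l[-l]\<close> are finitely supported sequences \<open>u\<close> with \<open>u l \<in> R\<^sub>l[-l]\<close>. In the
  differential, the component \<open>p\<close> of the image receives from \<open>u l\<close> the term with \<open>j = l - p + 1\<close>.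
\<close>

definition bar_dif :: "('k::field, 'h::ab_group_add) ainf \<Rightarrow> ('k, 'a::ab_group_add) dga \<Rightarrow>
    ((int \<times> 'h) list \<Rightarrow> 'a) \<Rightarrow> ('k, 'x::ab_group_add, 'h) amod \<Rightarrow>
    (nat \<Rightarrow> ('k, 'x, 'h, 'a) tensor) \<Rightarrow> nat \<Rightarrow> ('k, 'x, 'h, 'a) tensor" where
  "bar_dif H A f X u p = (\<Sum>l\<in>{l. p \<le> l \<and> u l \<noteq> 0}.
     let j = l - p + 1 in ksgn (int (l + (j - 1) div 2)) (bar_M H A f X l j (u l)))"

definition bar_act :: "('k::field, 'h::ab_group_add) ainf \<Rightarrow> ('k, 'a::ab_group_add) dga \<Rightarrow>
    ('k, 'x::ab_group_add, 'h) amod \<Rightarrow> (nat \<Rightarrow> ('k, 'x, 'h, 'a) tensor) \<Rightarrow> int \<times> 'a \<Rightarrow>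
    nat \<Rightarrow> ('k, 'x, 'h, 'a) tensor" where
  "bar_act H A X u b l = tlift l (\<lambda>(x, hs, a).
     pure_tensor X H A (x, hs, (fst a + fst b, mul A a b))) (u l)"

definition bar :: "enat \<Rightarrow> ('k::field, 'h::ab_group_add) ainf \<Rightarrow> ('k, 'a::ab_group_add) dga \<Rightarrow>
    ((int \<times> 'h) list \<Rightarrow> 'a) \<Rightarrow> ('k, 'x::ab_group_add, 'h) amod \<Rightarrow>
    ('k, nat \<Rightarrow> ('k, 'x, 'h, 'a) tensor, 'a) dgm" where
  "bar n H A f X =
    \<lparr>smul = (\<lambda>c u l. tscale c (u l)),
     hcomp = (\<lambda>e. {u. finite {l. u l \<noteq> 0} \<and> (\<forall>l. u l \<noteq> 0 \<longrightarrow> enat l \<le> n) \<and>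
        (\<forall>l. u l \<in> tens X H A l (e - int l))}),
     mdif = (\<lambda>u. bar_dif H A f X (snd u)),
     act = (\<lambda>u b. bar_act H A X (snd u) b)\<rparr>"

text \<open>
  \<open>g\<^bsub>k+1\<^esub> \<otimes> 1\<^sup>\<otimes>\<^sup>(\<^sup>q\<^sup>-\<^sup>k\<^sup>+\<^sup>1\<^sup>) : R\<^sub>q(X) \<rightarrow> R\<^bsub>q-k\<^esub>(Y)\<close>
\<close>

definition bar_g :: "('k::field, 'h::ab_group_add) ainf \<Rightarrow> ('k, 'a::ab_group_add) dga \<Rightarrow>
    ('k, 'y::ab_group_add, 'h) amod \<Rightarrow> (int \<times> 'x \<Rightarrow> (int \<times> 'h) list \<Rightarrow> 'y) \<Rightarrow> nat \<Rightarrow> nat \<Rightarrow>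
    ('k, 'x, 'h, 'a) tensor \<Rightarrow> ('k, 'y, 'h, 'a) tensor" where
  "bar_g H A Y g q k = tlift q (\<lambda>(x, hs, a).
     pure_tensor Y H A ((fst x + dl (take k hs) + int k, g x (take k hs)), drop k hs, a))"

text \<open>
  Rows and columns of the matrix are numbered from 0 here: the entry \<open>(i, j)\<close> of the matrix with indices
  from 1 to \<open>n + 1\<close> is the one with \<open>p = i - 1\<close> and \<open>q = j - 1\<close>.
\<close>

definition bar_mor :: "enat \<Rightarrow> ('k::field, 'h::ab_group_add) ainf \<Rightarrow> ('k, 'a::ab_group_add) dga \<Rightarrow>
    ((int \<times> 'h) list \<Rightarrow> 'a) \<Rightarrow> ('k, 'x::ab_group_add, 'h) amod \<Rightarrow>
    ('k, 'y::ab_group_add, 'h) amod \<Rightarrow> (int \<times> 'x \<Rightarrow> (int \<times> 'h) list \<Rightarrow> 'y) \<Rightarrow>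
    int \<times> (nat \<Rightarrow> ('k, 'x, 'h, 'a) tensor) \<Rightarrow> nat \<Rightarrow> ('k, 'y, 'h, 'a) tensor" where
  "bar_mor n H A f X Y g u =
     (if u \<in> hel (bar n H A f X)
      then (\<lambda>p. \<Sum>q\<in>{q. p \<le> q \<and> snd u q \<noteq> 0}.
              ksgn (int ((q - p + 1) div 2)) (bar_g H A Y g q (q - p) (snd u q)))
      else 0)"


section \<open>Adequacy of the model of tensor products\<close>

lemma vector_space_tscale: "vector_space (tscale :: 'k::field \<Rightarrow> _)"
  by unfold_locales (auto simp: tscale_def fun_eq_iff algebra_simps)

lemma mlin3_compose:
  assumes F: "mlin3 X H A s F"
    and T: "\<And>x y. T (x + y) = T x + T y" "\<And>c x. T (s c x) = s' c (T x)"
  shows "mlin3 X H A s' (\<lambda>w. T (F w))"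
  using F unfolding mlin3_def mlinX_def mlin_def hlin_def by (auto simp: T)

lemma sum_tscale_apply: "(\<Sum>w\<in>W. tscale (c w) (G w)) \<psi> = (\<Sum>w\<in>W. c w * G w \<psi>)"
  by (induction W rule: infinite_finite_induct) (auto simp: tscale_def)

text \<open>
  Any multilinear map \<open>F\<close> into any vector space respects all linear relations between pure tensors, and
  so extends uniquely to a linear map on their span. Moreover \<open>pure_tensor\<close> is itself multilinear.
\<close>

lemma tensor_universal:
  fixes s :: "'k::field \<Rightarrow> 'w::ab_group_add \<Rightarrow> 'w"
  assumes s: "vector_space s" and F: "mlin3 X H A s F"
    and W: "finite W" and rel: "(\<Sum>w\<in>W. tscale (c w) (pure_tensor X H A w)) = 0"
  shows "(\<Sum>w\<in>W. s (c w) (F w)) = 0"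
proof (rule ccontr)
  interpret vector_space s by fact
  interpret P: vector_space_pair s "(*) :: 'k \<Rightarrow> 'k \<Rightarrow> 'k"
    by unfold_locales (auto simp: algebra_simps)
  let ?v = "\<Sum>w\<in>W. s (c w) (F w)"
  assume "?v \<noteq> 0"
  then have "independent {?v}" by (simp add: independent_insert)
  then obtain T where T: "Vector_Spaces.linear s (*) T" and Tv: "T ?v = 1"
    using P.linear_independent_extend[of "{?v}" "\<lambda>_. 1"] by auto
  interpret T: Vector_Spaces.linear s "(*)" T by (fact T)
  have "mlin3 X H A (*) (\<lambda>w. T (F w))"
    using F by (rule mlin3_compose) (simp_all add: T.add T.scale)
  then have "(\<Sum>w\<in>W. c w * T (F w)) = 0"
    using fun_cong[OF rel, of "\<lambda>w. T (F w)"] by (simp add: sum_tscale_apply pure_tensor_def)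
  then have "T ?v = 0" by (simp add: T.sum T.scale)
  with Tv show False by simp
qed

lemma mlin3_pure_tensor: "mlin3 X H A tscale (pure_tensor X H A)"
  by (auto simp: mlin3_def mlinX_def mlin_def hlin_def pure_tensor_def tscale_def fun_eq_iff)

lemma tlift_pure:
  assumes "mlin3 X H A tscale (\<lambda>w. if wlen w = i then F w else 0)" and "wlen w = i"
  shows "tlift i F (pure_tensor X H A w) = F w"
proof
  fix \<psi>
  have "mlin3 X H A (*) (\<lambda>w. (if wlen w = i then F w else 0) \<psi>)"
    using assms(1) by (rule mlin3_compose) (simp_all add: tscale_def)
  then have "mlin3 X H A (*) (\<lambda>w. if wlen w = i then F w \<psi> else 0)"
    by (simp add: if_distrib[of "\<lambda>f. f \<psi>"] cong: if_cong)
  then show "tlift i F (pure_tensor X H A w) \<psi> = F w \<psi>"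
    using assms(2) by (simp add: tlift_def pure_tensor_def)
qed

lemma tlift_linear:
  "tlift i F (t + t') = tlift i F t + tlift i F t'" "tlift i F (tscale c t) = tscale c (tlift i F t)"
  by (auto simp: tlift_def tscale_def fun_eq_iff)

end

theory Submission
  imports Defs "HOL-Library.Z2"
begin

text \<open>
  After a change of signs in each \<open>R\<^sub>l\<close>, the bar differential on a word is the signed sum of all ways to
  apply one operation to a contiguous subword, and \<open>B\<^sub>n(g)\<close> is the signed sum of all ways to apply \<open>g\<close>
  to an initial subword. In the square of the differential the pairs of disjoint operations cancel, and
  the nested pairs add up to the structure relations of \<open>X\<close>, of \<open>H\<close>, and of \<open>A\<close> as an
  \<open>A\<^sub>\<infinity>\<close>-module over \<open>H\<close> by means of \<open>f\<close>. In the same way \<open>B\<^sub>n(g)\<close> commutes with the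
  differentials because \<open>g\<close> satisfies the relations of a morphism. All words involved have at most \<open>n\<close>
  letters from \<open>H\<close>, so only the relations of an \<open>A\<^bsub>n+1\<^esub>\<close>-module are used. These identities hold for
  arbitrary multilinear functions of words in place of pure tensors, and so they also show that
  \<open>A\<^bsub>n+1\<^esub>\<close>-modules form a category.
\<close>

section \<open>Sums over the splittings of a word\<close>

text \<open>A tensor here lives in a dual space, so a linear extension can be evaluated on a pure
  tensor only after the corresponding function of words is known to be multilinear. This is why
  functions \<open>\<phi>\<close> of words are primary and tensors enter late, through the one
  family \<open>bar_word\<close>. Operators act on \<open>\<phi>\<close> by precomposition, which
  reverses composites. The link back is that an additive map on the values of \<open>\<phi>\<close>
  commutes with these operators: if the differential \<open>D\<close> sends the word function
  \<open>W\<close> to \<open>E W\<close>, then D (E W) = E (D W) = E (E W), so the square of a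
  matrix with floors in its signs becomes the square of \<open>E\<close>. Splittings are recursive
  sums over lists and not sums over index triples, because reordering a double sum then is
  coassociativity of deconcatenation, a list induction. After the rescaling every sign is (-1) to a
  polynomial in lengths and degrees, which is what makes a mechanical parity check possible.\<close>

abbreviation len :: "'b list \<Rightarrow> int" where
  "len ws \<equiv> int (length ws)"

text \<open>Deconcatenation followed by \<open>F\<close>, both parts possibly empty: the shape of
  all terms in which an operation takes an initial or a final subword.\<close>

fun cut2 :: "('b list \<Rightarrow> 'b list \<Rightarrow> 'w::ab_group_add) \<Rightarrow> 'b list \<Rightarrow> 'w" where
  "cut2 F [] = F [] []"
| "cut2 F (h # hs) = F [] (h # hs) + cut2 (\<lambda>u v. F (h # u) v) hs"

text \<open>The middle piece is the block on which an operation of \<open>H\<close> acts; empty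
  blocks give 0 because there is no \<open>m\<^sub>0\<close>.\<close>

definition cut3 :: "('b list \<Rightarrow> 'b list \<Rightarrow> 'b list \<Rightarrow> 'w::ab_group_add) \<Rightarrow> 'b list \<Rightarrow> 'w" where
  "cut3 G = cut2 (\<lambda>u. cut2 (\<lambda>m v. if m = [] then 0 else G u m v))"

lemma cut2_cong: "(\<And>u v. u @ v = w \<Longrightarrow> F u v = G u v) \<Longrightarrow> cut2 F w = cut2 G w"
proof (induction w arbitrary: F G)
  case (Cons h w)
  have "cut2 (\<lambda>u. F (h # u)) w = cut2 (\<lambda>u. G (h # u)) w"
    by (rule Cons.IH) (simp add: Cons.prems)
  then show ?case by (simp add: Cons.prems)
qed simp

lemma cut2_add: "cut2 (\<lambda>u v. F u v + G u v) w = cut2 F w + cut2 G w"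
  by (induction w arbitrary: F G) (auto simp: algebra_simps)

lemma cut2_zero: "cut2 (\<lambda>u v. 0) w = 0"
  by (induction w) auto

lemma cut2_minus: "cut2 (\<lambda>u v. - F u v) w = - cut2 F w"
  by (induction w arbitrary: F) auto

lemma cut2_ksgn: "ksgn e (cut2 F w) = cut2 (\<lambda>u v. ksgn e (F u v)) w"
  by (simp add: ksgn_def cut2_minus)

lemma cut2_if: "(if P then 0 else cut2 F w) = cut2 (\<lambda>u v. if P then 0 else F u v) w"
  by (simp add: cut2_zero)

lemma cut2_if2: "(if P then cut2 F w else 0) = cut2 (\<lambda>u v. if P then F u v else 0) w"
  by (simp add: cut2_zero)

text \<open>Coassociativity of deconcatenation: cutting the prefix again gives the same triples as
  cutting the suffix again. The exchanges of nested sums rest on it.\<close>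

lemma cut2_assoc:
  "cut2 (\<lambda>u v. cut2 (\<lambda>a b. G u a b v) u) w = cut2 (\<lambda>a c. cut2 (\<lambda>b v. G (a @ b) a b v) c) w"
  by (induction w arbitrary: G) (auto simp: cut2_add algebra_simps)

text \<open>A cut falls before or after the marked letter \<open>z\<close>. In the uses
  \<open>z\<close> is the output of an operation, or the letter that varies in a proof of
  linearity.\<close>

lemma cut2_append_Cons:
  "cut2 F (u @ z # v) = cut2 (\<lambda>a b. F a (b @ z # v)) u + cut2 (\<lambda>a b. F (u @ z # a) b) v"
  by (induction u arbitrary: F) (auto simp: algebra_simps)

lemma cut2_eq_sum: "cut2 F w = (\<Sum>i\<le>length w. F (take i w) (drop i w))"
  by (induction w arbitrary: F) (auto simp: sum.atMost_Suc_shift simp del: sum.atMost_Suc)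

section \<open>Signs and the parity of their exponents\<close>

lemma ksgn_simps [simp]:
  "ksgn e (v + w) = ksgn e v + ksgn e w" "ksgn e (- v) = - ksgn e v" "ksgn e 0 = 0"
  "ksgn e (ksgn e' v) = ksgn (e + e') v" "ksgn 0 v = v"
  by (auto simp: ksgn_def)

lemma ksgn_cong: "even e \<longleftrightarrow> even e' \<Longrightarrow> v = w \<Longrightarrow> ksgn e v = ksgn e' w"
  by (simp add: ksgn_def)

lemma dl_simps [simp]: "dl [] = 0" "dl (z # v) = fst z + dl v" "dl (u @ v) = dl u + dl v"
  by (auto simp: dl_def)

lemma parityI: "(of_int e :: bit) = of_int e' \<Longrightarrow> even e \<longleftrightarrow> even e'"
  by (metis even_of_int_iff)

text \<open>
  Signs are compared by expanding their exponents as polynomials over the field with two elements,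
  where simplification with these rules decides equality.
\<close>

lemma bit_ring:
  "x + x = 0" "x + (x + y) = y" "x * x = x" "x * (x * y) = x * y" "x - y = x + y" "- x = x" for x y :: bit
  by (cases x; cases y; simp)+

lemmas parity_simps = length_append list.size dl_simps fst_conv of_nat_add of_nat_Suc of_nat_0 of_nat_1 of_nat_diff plus_nat.add_0 One_nat_def
  of_int_add of_int_mult of_int_diff of_int_minus of_int_0 of_int_1 of_int_numeral bit_numeral_even bit_numeral_odd
  distrib_left distrib_right add.assoc add.commute add.left_commute mult.assoc mult.commute mult.left_commute
  bit_ring add_0_left add_0_right mult_zero_left mult_zero_right mult_1_left mult_1_right

lemma ksgn_parity: "(of_int e :: bit) = of_int e' \<Longrightarrow> ksgn e v = ksgn e' v"
  by (rule ksgn_cong[OF parityI refl])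

lemma ksgn_parity2: "(of_int (e + e') :: bit) = 1 \<Longrightarrow> ksgn e v + ksgn e' v = 0"
  using parityI[of "e + e'" 1] by (auto simp: ksgn_def)

lemma ksgn_if: "ksgn e (if P then v else w) = (if P then ksgn e v else ksgn e w)"
  by simp

text \<open>Linearity is available only on one component \<open>hcomp V d\<close> with the degree
  tag fixed, so additivity is relative to a subgroup \<open>S\<close> and each use must supply
  membership. Since closure of \<open>S\<close> is part of the notion, one fact serves both to move
  a map through a sum and to locate the sum.\<close>

definition hom_on :: "'v::ab_group_add set \<Rightarrow> ('v \<Rightarrow> 'w::ab_group_add) \<Rightarrow> bool" where
  "hom_on S T \<longleftrightarrow> 0 \<in> S \<and> (\<forall>x\<in>S. - x \<in> S \<and> (\<forall>y\<in>S. x + y \<in> S \<and> T (x + y) = T x + T y))"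

lemma hom_on_zero: "hom_on S T \<Longrightarrow> T 0 = 0"
  unfolding hom_on_def by (metis add.right_neutral add_left_cancel)

lemma hom_on_add: "hom_on S T \<Longrightarrow> x \<in> S \<Longrightarrow> y \<in> S \<Longrightarrow> T (x + y) = T x + T y"
  by (simp add: hom_on_def)

lemma hom_on_minus: "hom_on S T \<Longrightarrow> x \<in> S \<Longrightarrow> T (- x) = - T x"
  using hom_on_zero[of S T] hom_on_add[of S T x "- x"]
  by (auto simp: hom_on_def eq_neg_iff_add_eq_0 add.commute)

lemma hom_on_ksgn: "hom_on S T \<Longrightarrow> x \<in> S \<Longrightarrow> T (ksgn e x) = ksgn e (T x)"
  by (simp add: ksgn_def hom_on_minus)

lemma hom_on_closed:
  "hom_on S T \<Longrightarrow> 0 \<in> S" "hom_on S T \<Longrightarrow> x \<in> S \<Longrightarrow> - x \<in> S" "hom_on S T \<Longrightarrow> x \<in> S \<Longrightarrow> ksgn e x \<in> S"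
  "hom_on S T \<Longrightarrow> x \<in> S \<Longrightarrow> y \<in> S \<Longrightarrow> x + y \<in> S"
  by (auto simp: hom_on_def ksgn_def)

lemma hom_on_cut2_closed:
  assumes "hom_on S T"
  shows "(\<And>u v. u @ v = w \<Longrightarrow> F u v \<in> S) \<Longrightarrow> cut2 F w \<in> S"
proof (induction w arbitrary: F)
  case (Cons h w)
  have "cut2 (\<lambda>u. F (h # u)) w \<in> S"
    by (rule Cons.IH) (simp_all add: Cons.prems)
  then show ?case by (simp add: Cons.prems hom_on_closed[OF assms])
qed simp

lemma hom_on_cut2:
  assumes "hom_on S T"
  shows "(\<And>u v. u @ v = w \<Longrightarrow> F u v \<in> S) \<Longrightarrow> T (cut2 F w) = cut2 (\<lambda>u v. T (F u v)) w"
proof (induction w arbitrary: F)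
  case (Cons h w)
  have "T (cut2 (\<lambda>u. F (h # u)) w) = cut2 (\<lambda>u v. T (F (h # u) v)) w"
    by (rule Cons.IH) (simp_all add: Cons.prems)
  moreover have "cut2 (\<lambda>u. F (h # u)) w \<in> S"
    by (rule hom_on_cut2_closed[OF assms]) (simp_all add: Cons.prems)
  ultimately show ?case by (simp add: Cons.prems hom_on_add[OF assms])
qed simp

lemma hom_on_hlin:
  assumes "gmodule V" "hlin V s F"
  shows "hom_on (hcomp V d) (\<lambda>x. F (d, x))"
proof -
  interpret vector_space "smul V" using assms(1) by (simp add: gmodule_def)
  have "subspace (hcomp V d)" using assms(1) by (simp add: gmodule_def)
  then show ?thesis using assms(2)
    by (auto simp: hom_on_def hlin_def subspace_0 subspace_neg subspace_add)
qed

text \<open>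
  A map is treated through its transpose: operators act on families \<open>\<phi>\<close> of multilinear functions of
  words. For \<open>\<delta> = 0\<close> this is precomposition with a morphism, and composition of morphisms is the
  case where \<open>\<phi>\<close> is itself a morphism; for \<open>\<delta> = -1\<close> and \<open>g = mX X\<close> it is the part of the bar
  differential that involves \<open>X\<close>.
\<close>

definition pull :: "int \<Rightarrow> (int \<times> 'x \<Rightarrow> (int \<times> 'h) list \<Rightarrow> 'y) \<Rightarrow>
    (int \<times> 'y \<Rightarrow> (int \<times> 'h) list \<Rightarrow> 'w::ab_group_add) \<Rightarrow> int \<times> 'x \<Rightarrow> (int \<times> 'h) list \<Rightarrow> 'w" where
  "pull \<delta> g \<phi> x = cut2 (\<lambda>u v. ksgn ((len u + \<delta>) * len v) (\<phi> (fst x + dl u + len u + \<delta>, g x u) v))"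

definition hz :: "('k, 'h) ainf \<Rightarrow> (int \<times> 'h) list \<Rightarrow> int \<times> 'h" where
  "hz H m = (dl m + len m - 2, mm H m)"

definition dH :: "('k, 'h) ainf \<Rightarrow> (int \<times> 'x \<Rightarrow> (int \<times> 'h) list \<Rightarrow> 'w::ab_group_add) \<Rightarrow>
    int \<times> 'x \<Rightarrow> (int \<times> 'h) list \<Rightarrow> 'w" where
  "dH H \<phi> x = cut3 (\<lambda>u m v. ksgn (len u + 1 + len m * len v + len m * (fst x + dl u))
     (\<phi> x (u @ hz H m # v)))"

definition dX :: "('k, 'h) ainf \<Rightarrow> ('k, 'x, 'h) amod \<Rightarrow>
    (int \<times> 'x \<Rightarrow> (int \<times> 'h) list \<Rightarrow> 'w::ab_group_add) \<Rightarrow> int \<times> 'x \<Rightarrow> (int \<times> 'h) list \<Rightarrow> 'w" where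
  "dX H X \<phi> x hs = pull (- 1) (mX X) \<phi> x hs + dH H \<phi> x hs"

definition dA :: "('k, 'a::ab_group_add) dga \<Rightarrow> ((int \<times> 'h) list \<Rightarrow> 'a) \<Rightarrow>
    (int \<times> 'x \<Rightarrow> (int \<times> 'h) list \<Rightarrow> int \<times> 'a \<Rightarrow> 'w::ab_group_add) \<Rightarrow>
    int \<times> 'x \<Rightarrow> (int \<times> 'h) list \<Rightarrow> int \<times> 'a \<Rightarrow> 'w" where
  "dA A f \<phi> x hs a = cut2 (\<lambda>u v. ksgn ((len v + 1) * (fst x + dl u) + len u + len v)
     (\<phi> x u (dl v + len v + fst a - 1, mA A f v a))) hs"

lemmas cut_normal = cut2_ksgn cut2_if cut2_if2 cut2_assoc cut2_append_Cons cut2_add[symmetric] ksgn_if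


text \<open>Both sides are sums over \<open>u @ a @ b = hs\<close>: \<open>g\<close> takes
  \<open>u\<close>, then \<open>f\<close> takes \<open>a\<close>, and \<open>b\<close> is left for
  \<open>\<phi>\<close>. The sign exponents agree already as integers, so composition in this form
  is strictly associative. The second assumption puts the values of \<open>f\<close> into the
  component on which \<open>\<phi>\<close> is additive.\<close>

lemma pull_pull:
  assumes "\<And>u v d. u @ v = hs \<Longrightarrow> hom_on (S d) (\<lambda>y. \<phi> (d, y) v)"
    and "\<And>u a b. u @ a @ b = hs \<Longrightarrow>
      f (fst x + dl u + len u + \<delta>, g x u) a \<in> S (fst x + dl u + len u + dl a + len a + \<delta> + \<delta>')"
  shows "pull \<delta> g (pull \<delta>' f \<phi>) x hs = pull (\<delta> + \<delta>') (pull \<delta> g f) \<phi> x hs"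
proof -
  have *: "\<phi> (d, pull \<delta> g f x p) b = cut2 (\<lambda>u a. ksgn ((len u + \<delta>) * len a)
      (\<phi> (d, f (fst x + dl u + len u + \<delta>, g x u) a) b)) p"
    if pb: "p @ b = hs" and d: "d = fst x + dl p + len p + (\<delta> + \<delta>')" for p b d
  proof -
    have ad: "hom_on (S d) (\<lambda>y. \<phi> (d, y) b)" using assms(1) pb by blast
    have 1: "f (fst x + dl u + len u + \<delta>, g x u) a \<in> S d" if ua: "u @ a = p" for u a
    proof -
      have "d = fst x + dl u + len u + dl a + len a + \<delta> + \<delta>'"
        unfolding d ua[symmetric] by simp
      then show ?thesis using assms(2)[of u a b] pb ua by auto
    qed
    have "\<phi> (d, pull \<delta> g f x p) b = cut2 (\<lambda>u a. \<phi> (d, ksgn ((len u + \<delta>) * len a)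
      (f (fst x + dl u + len u + \<delta>, g x u) a)) b) p"
      unfolding pull_def by (rule hom_on_cut2[OF ad]) (simp add: hom_on_closed[OF ad] 1)
    also have "\<dots> = cut2 (\<lambda>u a. ksgn ((len u + \<delta>) * len a)
      (\<phi> (d, f (fst x + dl u + len u + \<delta>, g x u) a) b)) p"
      by (rule cut2_cong) (simp add: hom_on_ksgn[OF ad] 1)
    finally show ?thesis .
  qed
  have "pull (\<delta> + \<delta>') (pull \<delta> g f) \<phi> x hs =
    cut2 (\<lambda>p b. cut2 (\<lambda>u a. ksgn ((len p + (\<delta> + \<delta>')) * len b + (len u + \<delta>) * len a)
      (\<phi> (fst x + dl p + len p + (\<delta> + \<delta>'), f (fst x + dl u + len u + \<delta>, g x u) a) b)) p) hs"
    unfolding pull_def[of "\<delta> + \<delta>'"] by (rule cut2_cong) (simp add: * cut2_ksgn)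
  also have "\<dots> = pull \<delta> g (pull \<delta>' f \<phi>) x hs"
    unfolding pull_def cut_normal ksgn_simps
    apply (rule cut2_cong)+
    apply (rule ksgn_cong)
    apply (auto simp: algebra_simps)
    done
  finally show ?thesis ..
qed

section \<open>Operations on a block inside a word, and how two of them interact\<close>

lemma cut3_cong:
  "(\<And>u m v. u @ m @ v = w \<Longrightarrow> m \<noteq> [] \<Longrightarrow> F u m v = G u m v) \<Longrightarrow> cut3 F w = cut3 G w"
  unfolding cut3_def by (intro cut2_cong) auto

lemma cut3_add: "cut3 (\<lambda>u m v. F u m v + G u m v) w = cut3 F w + cut3 G w"
  unfolding cut3_def cut2_add[symmetric] by (intro cut2_cong) auto

lemma cut3_zero: "cut3 (\<lambda>u m v. 0) w = 0"
  unfolding cut3_def by (rule trans[OF cut2_cong cut2_zero]) (simp add: cut2_zero)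

lemma cut3_ksgn: "ksgn e (cut3 F w) = cut3 (\<lambda>u m v. ksgn e (F u m v)) w"
  unfolding cut3_def cut2_ksgn by (intro cut2_cong) auto

lemma hom_on_cut3_closed:
  assumes "hom_on S T" and "\<And>u m v. u @ m @ v = w \<Longrightarrow> m \<noteq> [] \<Longrightarrow> F u m v \<in> S"
  shows "cut3 F w \<in> S"
  unfolding cut3_def using assms(2)
  by (intro hom_on_cut2_closed[OF assms(1)]) (auto simp: hom_on_closed[OF assms(1)])

lemma hom_on_cut3:
  assumes "hom_on S T" and "\<And>u m v. u @ m @ v = w \<Longrightarrow> m \<noteq> [] \<Longrightarrow> F u m v \<in> S"
  shows "T (cut3 F w) = cut3 (\<lambda>u m v. T (F u m v)) w"
proof -
  have "T (cut3 F w) = cut2 (\<lambda>u c. T (cut2 (\<lambda>m v. if m = [] then 0 else F u m v) c)) w"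
    unfolding cut3_def using assms(2)
    by (intro hom_on_cut2[OF assms(1)] hom_on_cut2_closed[OF assms(1)])
      (auto simp: hom_on_closed[OF assms(1)])
  also have "\<dots> = cut3 (\<lambda>u m v. T (F u m v)) w"
    unfolding cut3_def
  proof (rule cut2_cong)
    fix u c assume uc: "u @ c = w"
    have "T (cut2 (\<lambda>m v. if m = [] then 0 else F u m v) c) =
        cut2 (\<lambda>m v. T (if m = [] then 0 else F u m v)) c"
      using assms(2) uc by (intro hom_on_cut2[OF assms(1)]) (auto simp: hom_on_closed[OF assms(1)])
    also have "\<dots> = cut2 (\<lambda>m v. if m = [] then 0 else T (F u m v)) c"
      by (rule cut2_cong) (simp add: hom_on_zero[OF assms(1)])
    finally show "T (cut2 (\<lambda>m v. if m = [] then 0 else F u m v) c) = \<dots>" .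
  qed
  finally show ?thesis .
qed

lemma cut2_swap: "cut2 (\<lambda>a b. cut2 (\<lambda>c d. G a b c d) v) u = cut2 (\<lambda>c d. cut2 (\<lambda>a b. G a b c d) u) v"
proof (induction u arbitrary: G)
  case (Cons h u)
  show ?case
    by (simp add: cut2_add Cons.IH[of "\<lambda>a. G (h # a)"])
qed simp

text \<open>The left context of a block may be cut before the block is chosen; this separates off
  the letters taken by another operation on the left.\<close>

lemma cut3_outer_left:
  "cut3 (\<lambda>u m v. cut2 (\<lambda>a b. G a b m v) u) w = cut2 (\<lambda>a. cut3 (\<lambda>b m v. G a b m v)) w"
proof -
  have "cut3 (\<lambda>u m v. cut2 (\<lambda>a b. G a b m v) u) w =
     cut2 (\<lambda>u c. cut2 (\<lambda>a b. cut2 (\<lambda>m v. if m = [] then 0 else G a b m v) c) u) w"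
    unfolding cut3_def cut2_if by (subst cut2_swap) simp
  then show ?thesis unfolding cut3_def cut2_assoc .
qed

lemma cut3_outer_right:
  "cut3 (\<lambda>u m v. cut2 (\<lambda>a b. G u m a b) v) w = cut2 (\<lambda>p b. cut3 (\<lambda>u m a. G u m a b) p) w"
  unfolding cut3_def cut2_if cut2_assoc ..

text \<open>Two disjoint blocks can be chosen in either order; this pairs up the terms that cancel
  in the square of \<open>dH\<close>.\<close>

lemma cut3_outer_cut3:
  "cut3 (\<lambda>u m v. cut3 (\<lambda>a n b. G a n b m v) u) w = cut3 (\<lambda>a n c. cut3 (\<lambda>b m v. G a n b m v) c) w"
proof -
  have "cut3 (\<lambda>u m v. cut3 (\<lambda>a n b. G a n b m v) u) w =
      cut2 (\<lambda>a. cut3 (\<lambda>b m v. cut2 (\<lambda>n c. if n = [] then 0 else G a n c m v) b)) w"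
    unfolding cut3_def[of "\<lambda>a n b. G a n b _ _"] by (rule cut3_outer_left)
  also have "\<dots> = cut2 (\<lambda>a. cut2 (\<lambda>n. cut3 (\<lambda>c m v. if n = [] then 0 else G a n c m v))) w"
    by (rule cut2_cong, rule cut3_outer_left)
  also have "\<dots> = cut2 (\<lambda>a. cut2 (\<lambda>n c. if n = [] then 0 else cut3 (\<lambda>b m v. G a n b m v) c)) w"
    by (intro cut2_cong) (auto simp: cut3_zero)
  also have "\<dots> = cut3 (\<lambda>a n c. cut3 (\<lambda>b m v. G a n b m v) c) w"
    by (rule fun_cong[OF cut3_def, symmetric])
  finally show ?thesis .
qed

text \<open>The block lies left of the marked letter, contains it, or lies right of it. A block
  containing the letter is never empty, so the guard vanishes from the middle sum.\<close>

lemma cut3_append_Cons: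
  "cut3 G (u @ z # v) = cut3 (\<lambda>a n b. G a n (b @ z # v)) u +
     cut2 (\<lambda>a b. cut2 (\<lambda>c d. G a (b @ z # c) d) v) u + cut3 (\<lambda>a n b. G (u @ z # a) n b) v"
proof -
  have "cut3 G (u @ z # v) =
    cut2 (\<lambda>a b. cut2 (\<lambda>n c. if n = [] then 0 else G a n c) (b @ z # v)) u +
    cut3 (\<lambda>a n b. G (u @ z # a) n b) v"
    unfolding cut3_def by (rule cut2_append_Cons)
  also have "cut2 (\<lambda>a b. cut2 (\<lambda>n c. if n = [] then 0 else G a n c) (b @ z # v)) u =
    cut3 (\<lambda>a n b. G a n (b @ z # v)) u +  cut2 (\<lambda>a b. cut2 (\<lambda>c d. G a (b @ z # c) d) v) u"
    unfolding cut3_def cut2_append_Cons cut2_add[symmetric] by simp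
  finally show ?thesis .
qed

text \<open>A graded Leibniz rule. The output of an operation of \<open>H\<close> is a single
  letter, so the cut made by \<open>pull\<close> puts it either among the inputs of \<open>g\<close>
  or among the letters left for \<open>\<phi>\<close>.\<close>

lemma dH_pull:
  assumes "\<And>u v d. u @ v = hs \<Longrightarrow> hom_on (S d) (\<lambda>y. \<phi> (d, y) v)"
    and "\<And>u m a b. u @ m @ a @ b = hs \<Longrightarrow> m \<noteq> [] \<Longrightarrow>
      g x (u @ hz H m # a) \<in> S (fst x + dl (u @ m @ a) + len (u @ m @ a) + \<delta> - 1)"
  shows "dH H (pull \<delta> g \<phi>) x hs = pull (\<delta> - 1) (dH H g) \<phi> x hs + ksgn \<delta> (pull \<delta> g (dH H \<phi>) x hs)"
proof -
  let ?E = "\<lambda>u m v. len u + 1 + len m * len v + len m * (fst x + dl u)"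
  have *: "\<phi> (d, dH H g x p) b = cut3 (\<lambda>u m a. ksgn (?E u m a) (\<phi> (d, g x (u @ hz H m # a)) b)) p"
    if pb: "p @ b = hs" and d: "d = fst x + dl p + len p + (\<delta> - 1)" for p b d
  proof -
    have ad: "hom_on (S d) (\<lambda>y. \<phi> (d, y) b)" using assms(1) pb by blast
    have 1: "g x (u @ hz H m # a) \<in> S d" if uma: "u @ m @ a = p" and m: "m \<noteq> []" for u m a
    proof -
      have "d = fst x + dl (u @ m @ a) + len (u @ m @ a) + \<delta> - 1"
        unfolding d uma by simp
      then show ?thesis using assms(2)[of u m a b] pb uma m by auto
    qed
    have "\<phi> (d, dH H g x p) b = cut3 (\<lambda>u m a. \<phi> (d, ksgn (?E u m a) (g x (u @ hz H m # a))) b) p"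
      unfolding dH_def by (rule hom_on_cut3[OF ad]) (simp add: hom_on_closed[OF ad] 1)
    also have "\<dots> = cut3 (\<lambda>u m a. ksgn (?E u m a) (\<phi> (d, g x (u @ hz H m # a)) b)) p"
      by (rule cut3_cong) (simp add: hom_on_ksgn[OF ad] 1)
    finally show ?thesis .
  qed
  \<comment> \<open>\<open>?A\<close>: the new letter is left for \<open>\<phi>\<close>.
    \<open>?B\<close>: it is taken by \<open>g\<close>.\<close>
  let ?A = "\<lambda>u m v a b. ksgn (?E u m v + (len a + \<delta>) * (len b + 1 + len v))
     (\<phi> (fst x + dl a + len a + \<delta>, g x a) (b @ hz H m # v))"
  let ?B = "\<lambda>u m v a b. ksgn (?E u m v + (len u + 1 + len a + \<delta>) * len b)
     (\<phi> (fst x + dl u + dl m + len m - 2 + dl a + (len u + 1 + len a) + \<delta>, g x (u @ hz H m # a)) b)"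
  have "dH H (pull \<delta> g \<phi>) x hs = cut3 (\<lambda>u m v. cut2 (?A u m v) u + cut2 (?B u m v) v) hs"
    unfolding dH_def[of H "pull _ _ _"] pull_def cut2_append_Cons ksgn_simps cut2_ksgn
    by (rule cut3_cong, rule arg_cong2[where f = "(+)"])
      (simp_all add: hz_def algebra_simps)
  also have "\<dots> = cut3 (\<lambda>u m v. cut2 (\<lambda>a b. ?A (a @ b) m v a b) u) hs + cut3 (\<lambda>u m v. cut2 (\<lambda>a b. ?B u m (a @ b) a b) v) hs"
    unfolding cut3_add by (intro arg_cong2[where f = "(+)"] cut3_cong cut2_cong) auto
  also have "\<dots> = cut2 (\<lambda>a. cut3 (\<lambda>b m v. ?A (a @ b) m v a b)) hs +
     cut2 (\<lambda>p b. cut3 (\<lambda>u m a. ?B u m (a @ b) a b) p) hs"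
    unfolding cut3_outer_left cut3_outer_right ..
  also have "cut2 (\<lambda>a. cut3 (\<lambda>b m v. ?A (a @ b) m v a b)) hs = ksgn \<delta> (pull \<delta> g (dH H \<phi>) x hs)"
    unfolding pull_def dH_def cut2_ksgn cut3_ksgn ksgn_simps
    by (intro cut2_cong cut3_cong ksgn_cong) auto
  also have "cut2 (\<lambda>p b. cut3 (\<lambda>u m a. ?B u m (a @ b) a b) p) hs = pull (\<delta> - 1) (dH H g) \<phi> x hs"
    unfolding pull_def
    apply (rule cut2_cong, subst *, assumption, simp)
    unfolding cut3_ksgn ksgn_simps
    apply (intro cut3_cong ksgn_cong)
     apply auto[1]
    apply (auto simp: algebra_simps)
    done
  finally show ?thesis by (simp add: add.commute)
qed

text \<open>The second operation acts left of the output of the first (\<open>?A\<close>), on a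
  block containing it (\<open>?B\<close>), or right of it (\<open>?C\<close>). Exchanging the two
  blocks turns \<open>?A\<close> into \<open>?C\<close> with the opposite sign, and for a fixed
  outer block \<open>p\<close> the terms \<open>?B\<close> add up to the relation
  \<open>rel\<close>.\<close>

lemma dH_dH:
  assumes rel: "\<And>p. set p \<subseteq> hel H \<Longrightarrow> p \<noteq> [] \<Longrightarrow>
      cut3 (\<lambda>b m c. ksgn (len b + len m * len c + len m * dl b) (mm H (b @ hz H m # c))) p = 0"
    and hz: "\<And>m. set m \<subseteq> hel H \<Longrightarrow> m \<noteq> [] \<Longrightarrow> hz H m \<in> hel H"
    and hs: "set hs \<subseteq> hel H"
    and \<phi>: "\<And>u m v d. u @ m @ v = hs \<Longrightarrow> m \<noteq> [] \<Longrightarrow> hom_on (hcomp H d) (\<lambda>y. \<phi> x (u @ (d, y) # v))"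
  shows "dH H (dH H \<phi>) x hs = 0"
proof -
  let ?c = "fst x"
  let ?E = "\<lambda>u m v. len u + 1 + len m * len v + len m * (?c + dl u)"
  let ?A = "\<lambda>a n b m v. ksgn (?E (a @ n @ b) m v + ?E a n (b @ hz H m # v)) (\<phi> x (a @ hz H n # b @ hz H m # v))"
  let ?B = "\<lambda>a b m c d. ksgn (?E (a @ b) m (c @ d) + ?E a (b @ hz H m # c) d) (\<phi> x (a @ hz H (b @ hz H m # c) # d))"
  let ?C = "\<lambda>u m a n b. ksgn (?E u m (a @ n @ b) + ?E (u @ hz H m # a) n b) (\<phi> x (u @ hz H m # a @ hz H n # b))"
  have "dH H (dH H \<phi>) x hs = cut3 (\<lambda>u m v. cut3 (\<lambda>a n b. ?A a n b m v) u +
      cut2 (\<lambda>a b. cut2 (\<lambda>c d. ?B a b m c d) v) u + cut3 (\<lambda>a n b. ?C u m a n b) v) hs"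
    unfolding dH_def cut3_append_Cons cut3_ksgn cut2_ksgn ksgn_simps
    by (intro cut3_cong arg_cong2[where f = "(+)"] cut2_cong) auto
  also have "\<dots> = cut3 (\<lambda>u m v. cut3 (\<lambda>a n b. ?A a n b m v) u) hs +
      cut3 (\<lambda>u m v. cut2 (\<lambda>a b. cut2 (\<lambda>c d. ?B a b m c d) v) u) hs +
      cut3 (\<lambda>u m v. cut3 (\<lambda>a n b. ?C u m a n b) v) hs"
    unfolding cut3_add ..
  also have "cut3 (\<lambda>u m v. cut3 (\<lambda>a n b. ?A a n b m v) u) hs =
      cut3 (\<lambda>u m v. cut3 (\<lambda>a n b. ?A u m a n b) v) hs"
    by (rule cut3_outer_cut3)
  also have "\<dots> = cut3 (\<lambda>u m v. ksgn 1 (cut3 (\<lambda>a n b. ?C u m a n b) v)) hs"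
    unfolding cut3_ksgn ksgn_simps
    by (intro cut3_cong ksgn_cong parityI) (simp_all (no_asm) only: parity_simps hz_def append_assoc append_Cons append_Nil)
  also have "cut3 (\<lambda>u m v. cut2 (\<lambda>a b. cut2 (\<lambda>c d. ?B a b m c d) v) u) hs =
      cut2 (\<lambda>a q. cut2 (\<lambda>p d. cut3 (\<lambda>b m c. ?B a b m c d) p) q) hs"
    unfolding cut3_outer_left cut3_outer_right ..
  also have "\<dots> = cut2 (\<lambda>a q. cut2 (\<lambda>p d. 0) q) hs"
  proof (intro cut2_cong)
    fix a q p d assume "a @ q = hs" "p @ d = q"
    then have apd: "a @ p @ d = hs" by simp
    show "cut3 (\<lambda>b m c. ?B a b m c d) p = 0"
    proof (cases "p = []")
      case True
      then show ?thesis by (simp add: cut3_def)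
    next
      case False
      \<comment> \<open>Each operation lowers degree plus length by one, and the single letter that
        remains accounts for a further 1 in the length.\<close>
      let ?d = "dl p + len p - 3"
      \<comment> \<open>The part of the sign that depends only on the outer block and its
        surroundings; \<open>?r\<close> is the sign of the structure relation.\<close>
      let ?e = "(len p + 1) * (len d + ?c + dl a)"
      let ?r = "\<lambda>b m c. len b + len m * len c + len m * dl b"
      have ad: "hom_on (hcomp H ?d) (\<lambda>y. \<phi> x (a @ (?d, y) # d))"
        using \<phi> apd False by blast
      have mem: "mm H (b @ hz H m # c) \<in> hcomp H ?d" if "b @ m @ c = p" "m \<noteq> []" for b m c
      proof -
        have "hz H m \<in> hel H" using that apd hs by (intro hz) auto
        then have "hz H (b @ hz H m # c) \<in> hel H" using that apd hs by (intro hz) auto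
        then show ?thesis using that by (auto simp: hel_def hz_def algebra_simps)
      qed
      have "cut3 (\<lambda>b m c. ?B a b m c d) p =
          cut3 (\<lambda>b m c. ksgn ?e (\<phi> x (a @ (?d, ksgn (?r b m c) (mm H (b @ hz H m # c))) # d))) p"
      proof (rule cut3_cong)
        fix b m c assume bmc: "b @ m @ c = p" "m \<noteq> []"
        have "hz H (b @ hz H m # c) = (?d, mm H (b @ hz H m # c))"
          using bmc by (auto simp: hz_def)
        then show "?B a b m c d = ksgn ?e (\<phi> x (a @ (?d, ksgn (?r b m c) (mm H (b @ hz H m # c))) # d))"
          unfolding hom_on_ksgn[OF ad mem[OF bmc]] ksgn_simps
          unfolding bmc(1)[symmetric]
          by (intro ksgn_cong parityI) (simp_all only: parity_simps hz_def)
      qed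
      also have "\<dots> = ksgn ?e (cut3 (\<lambda>b m c. \<phi> x (a @ (?d, ksgn (?r b m c) (mm H (b @ hz H m # c))) # d)) p)"
        unfolding cut3_ksgn ..
      also have "cut3 (\<lambda>b m c. \<phi> x (a @ (?d, ksgn (?r b m c) (mm H (b @ hz H m # c))) # d)) p =
          \<phi> x (a @ (?d, cut3 (\<lambda>b m c. ksgn (?r b m c) (mm H (b @ hz H m # c))) p) # d)"
        by (rule hom_on_cut3[OF ad, symmetric]) (simp add: hom_on_closed[OF ad] mem)
      also have "\<dots> = 0"
        using rel[of p] False apd hs hom_on_zero[OF ad] by auto
      finally show ?thesis by simp
    qed
  qed
  also have "\<dots> = 0" by (rule trans[OF cut2_cong cut2_zero]) (simp add: cut2_zero)
  finally show ?thesis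
    by (simp add: cut3_add[symmetric]) (rule trans[OF cut3_cong cut3_zero], simp add: ksgn_def)
qed

text \<open>
  The three summands come from \<open>(dX + dA)\<^sup>2 = dX\<^sup>2 + \<dots>\<close>; the terms in which the two operations do
  not overlap cancel in pairs, and the others add up to the \<open>A\<^sub>\<infinity>\<close>-relation of \<open>A\<close> as a module over \<open>H\<close>.
\<close>

lemma dX_dA:
  fixes H :: "('k::field, 'h::ab_group_add) ainf" and A :: "('k, 'a::ab_group_add) dga"
    and \<phi> :: "int \<times> 'x \<Rightarrow> (int \<times> 'h) list \<Rightarrow> int \<times> 'a \<Rightarrow> 'w::ab_group_add"
  assumes rel: "\<And>q. set q \<subseteq> hel H \<Longrightarrow>
      cut3 (\<lambda>b m v. ksgn (len m * len v + len m * dl b + len v) (mA A f (b @ hz H m # v) a)) q +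
      cut2 (\<lambda>v w. ksgn ((len w + 1) * dl v + len w)
        (mA A f v (dl w + len w + fst a - 1, mA A f w a))) q = 0"
    and mA: "\<And>v a. set v \<subseteq> hel H \<Longrightarrow> a \<in> hel A \<Longrightarrow> mA A f v a \<in> hcomp A (dl v + len v + fst a - 1)"
    and hz: "\<And>m. set m \<subseteq> hel H \<Longrightarrow> m \<noteq> [] \<Longrightarrow> hz H m \<in> hel H"
    and hs: "set hs \<subseteq> hel H" and a: "a \<in> hel A"
    and \<phi>: "\<And>u v d. u @ v = hs \<Longrightarrow> hom_on (hcomp A d) (\<lambda>y. \<phi> x u (d, y))"
  shows "dX H X (\<lambda>x hs. dA A f \<phi> x hs a) x hs +
    dA A f (\<lambda>x hs a. dX H X (\<lambda>x hs. \<phi> x hs a) x hs) x hs a + dA A f (dA A f \<phi>) x hs a = 0"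
proof -
  let ?S = "\<lambda>x u v. (len v + 1) * (fst x + dl u) + len u + len v"
  let ?E = "\<lambda>u m v. len u + 1 + len m * len v + len m * (fst x + dl u)"
  let ?y = "\<lambda>u. (fst x + dl u + len u - 1, mX X x u)"
  let ?b = "\<lambda>w. (dl w + len w + fst a - 1, mA A f w a)"
  let ?L = "\<lambda>u v w. \<phi> x u (dl v + len v + fst (?b w) - 1, mA A f v (?b w))"
  let ?AA = "dA A f (dA A f \<phi>) x hs a"
  let ?HA = "dH H (\<lambda>x hs. dA A f \<phi> x hs a) x hs"
  let ?AH = "dA A f (\<lambda>x hs a. dH H (\<lambda>x hs. \<phi> x hs a) x hs) x hs a"
  let ?XA = "pull (- 1) (mX X) (\<lambda>x hs. dA A f \<phi> x hs a) x hs"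
  let ?AX = "dA A f (\<lambda>x hs a. pull (- 1) (mX X) (\<lambda>x hs. \<phi> x hs a) x hs) x hs a"
  \<comment> \<open>\<open>mX X\<close> takes a prefix and \<open>mA\<close> a suffix, so these two
    never meet and the two orders of applying them cancel.\<close>
  have "?XA +
      ?AX =
    cut2 (\<lambda>u q. cut2 (\<lambda>v w. ksgn ((len u - 1) * len q + ?S (?y u) v w) (\<phi> (?y u) v (?b w)) +
      ksgn (?S x (u @ v) w + (len u - 1) * len v) (\<phi> (?y u) v (?b w))) q) hs"
    unfolding pull_def dA_def cut2_ksgn ksgn_simps cut2_assoc cut2_add[symmetric]
    by (intro cut2_cong) (simp add: algebra_simps)
  also have "\<dots> = cut2 (\<lambda>u q. cut2 (\<lambda>v w. 0) q) hs"
  proof (intro cut2_cong ksgn_parity2)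
    fix u q v w :: "(int \<times> 'h) list" assume "v @ w = q"
    show "(of_int ((len u - 1) * len q + ?S (?y u) v w + (?S x (u @ v) w + (len u - 1) * len v)) :: bit) = 1"
      unfolding \<open>v @ w = q\<close>[symmetric] by (simp only: parity_simps)
  qed
  finally have X: "?XA =
      - ?AX"
    by (simp add: eq_neg_iff_add_eq_0 cut2_zero trans[OF cut2_cong cut2_zero])
  \<comment> \<open>\<open>?F\<close>: the output of the operation of \<open>H\<close> is taken by
    \<open>mA\<close>, and the two are nested. \<open>?G\<close>: it remains a letter of
    \<open>\<phi>\<close>, and the two are disjoint.\<close>
  let ?F = "\<lambda>u b m v. ksgn (?E (u @ b) m v + ?S x u (b @ hz H m # v))
    (\<phi> x u (dl (b @ m @ v) + len (b @ m @ v) + fst a - 2, mA A f (b @ hz H m # v) a))"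
  let ?G = "\<lambda>u m b c. ksgn (?E u m (b @ c) + ?S x (u @ hz H m # b) c) (\<phi> x (u @ hz H m # b) (?b c))"
  have "?HA =
    cut3 (\<lambda>u m v. cut2 (\<lambda>p b. ?F p b m v) u + cut2 (\<lambda>b c. ?G u m b c) v) hs"
    unfolding dA_def dH_def cut2_append_Cons ksgn_simps cut2_ksgn
    by (intro cut3_cong arg_cong2[where f = "(+)"] cut2_cong ksgn_cong) (auto simp: hz_def algebra_simps)
  also have "\<dots> = cut2 (\<lambda>u. cut3 (\<lambda>b m v. ?F u b m v)) hs + cut2 (\<lambda>p c. cut3 (\<lambda>u m b. ?G u m b c) p) hs"
    unfolding cut3_add cut3_outer_left cut3_outer_right ..
  also have "cut2 (\<lambda>p c. cut3 (\<lambda>u m b. ?G u m b c) p) hs =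
     cut2 (\<lambda>p c. ksgn 1 (ksgn (?S x p c) (dH H (\<lambda>x hs. \<phi> x hs (?b c)) x p))) hs"
    unfolding dH_def cut3_ksgn ksgn_simps
  proof (intro cut2_cong cut3_cong ksgn_parity)
    fix p c u m b :: "(int \<times> 'h) list" assume umb: "u @ m @ b = p"
    show "(of_int (?E u m (b @ c) + ?S x (u @ hz H m # b) c) :: bit) = of_int (1 + (?S x p c + ?E u m b))"
      unfolding umb[symmetric] by (simp only: parity_simps hz_def)
  qed
  also have "\<dots> = - ?AH"
    unfolding dA_def cut2_minus[symmetric] by (intro cut2_cong) (simp add: ksgn_def)
  finally have H: "?HA =
    cut2 (\<lambda>u. cut3 (\<lambda>b m v. ?F u b m v)) hs - ?AH"
    by simp
  have "?AA = cut2 (\<lambda>p w. cut2 (\<lambda>u v. ksgn (?S x p w + ?S x u v)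
     (?L u v w)) p) hs"
    unfolding dA_def cut2_ksgn ksgn_simps ..
  also have "\<dots> = cut2 (\<lambda>u. cut2 (\<lambda>v w. ksgn (?S x (u @ v) w + ?S x u v)
     (?L u v w))) hs"
    by (rule cut2_assoc)
  finally have AA: "?AA = \<dots>" .
  have "cut2 (\<lambda>u. cut3 (\<lambda>b m v. ?F u b m v)) hs + ?AA = cut2 (\<lambda>u q. 0) hs"
    unfolding AA cut2_add[symmetric]
  proof (rule cut2_cong)
    fix u q :: "(int \<times> 'h) list" assume uq: "u @ q = hs"
    \<comment> \<open>Two operations, each lowering the total degree of the tail by one.\<close>
    define d where "d = dl q + len q + fst a - 2"
    have ad: "hom_on (hcomp A d) (\<lambda>y. \<phi> x u (d, y))" by (rule \<phi>[OF uq])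
    have qH: "set q \<subseteq> hel H" using uq hs by auto
    have mem1: "mA A f (b @ hz H m # v) a \<in> hcomp A d" if "b @ m @ v = q" "m \<noteq> []" for b m v
    proof -
      have "mA A f (b @ hz H m # v) a \<in> hcomp A (dl (b @ hz H m # v) + len (b @ hz H m # v) + fst a - 1)"
        using that qH hz[of m] by (intro mA a) auto
      also have "dl (b @ hz H m # v) + len (b @ hz H m # v) + fst a - 1 = d"
        unfolding d_def that(1)[symmetric] by (simp add: hz_def)
      finally show ?thesis .
    qed
    have mem2: "mA A f v (?b w) \<in> hcomp A d" if "v @ w = q" for v w
    proof -
      have "?b w \<in> hel A" using that qH mA[OF _ a, of w] by (auto simp: hel_def)
      then have "mA A f v (?b w) \<in> hcomp A (dl v + len v + fst (?b w) - 1)"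
        using that qH by (intro mA) auto
      also have "dl v + len v + fst (?b w) - 1 = d"
        unfolding d_def that(1)[symmetric] by simp
      finally show ?thesis .
    qed
    \<comment> \<open>The sign common to all nested terms on the tail \<open>q\<close>; what is left
      are the signs in the assumption \<open>rel\<close>.\<close>
    let ?e = "len q * (fst x + dl u)"
    let ?r1 = "\<lambda>b m v. ksgn (len m * len v + len m * dl b + len v) (mA A f (b @ hz H m # v) a)"
    let ?r2 = "\<lambda>v w. ksgn ((len w + 1) * dl v + len w) (mA A f v (?b w))"
    have "cut3 (\<lambda>b m v. ?F u b m v) q = ksgn ?e (cut3 (\<lambda>b m v. \<phi> x u (d, ?r1 b m v)) q)"
      unfolding cut3_ksgn
    proof (rule cut3_cong)
      fix b m v :: "(int \<times> 'h) list" assume bmv: "b @ m @ v = q" "m \<noteq> []"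
      show "?F u b m v = ksgn ?e (\<phi> x u (d, ?r1 b m v))"
        unfolding hom_on_ksgn[OF ad mem1[OF bmv]] ksgn_simps
        unfolding d_def bmv(1)[symmetric]
        by (intro ksgn_parity) (simp only: parity_simps)
    qed
    moreover have "cut2 (\<lambda>v w. ksgn (?S x (u @ v) w + ?S x u v)
       (?L u v w)) q =
       ksgn ?e (cut2 (\<lambda>v w. \<phi> x u (d, ?r2 v w)) q)"
      unfolding cut2_ksgn
    proof (rule cut2_cong)
      fix v w :: "(int \<times> 'h) list" assume vw: "v @ w = q"
      have "dl v + len v + fst (?b w) - 1 = d"
        unfolding d_def vw[symmetric] by simp
      then show "ksgn (?S x (u @ v) w + ?S x u v)
         (?L u v w) = ksgn ?e (\<phi> x u (d, ?r2 v w))"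
        unfolding hom_on_ksgn[OF ad mem2[OF vw]] ksgn_simps
        unfolding vw[symmetric] by (simp del: fst_conv) (intro ksgn_parity, simp only: parity_simps)
    qed
    moreover have "cut3 (\<lambda>b m v. \<phi> x u (d, ?r1 b m v)) q = \<phi> x u (d, cut3 ?r1 q)"
      by (rule hom_on_cut3[OF ad, symmetric]) (simp add: hom_on_closed[OF ad] mem1)
    moreover have "cut2 (\<lambda>v w. \<phi> x u (d, ?r2 v w)) q = \<phi> x u (d, cut2 ?r2 q)"
      by (rule hom_on_cut2[OF ad, symmetric]) (simp add: hom_on_closed[OF ad] mem2)
    moreover have "\<phi> x u (d, cut3 ?r1 q) + \<phi> x u (d, cut2 ?r2 q) = \<phi> x u (d, cut3 ?r1 q + cut2 ?r2 q)"
      by (rule hom_on_add[OF ad, symmetric])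
        (auto intro!: hom_on_cut2_closed[OF ad] hom_on_cut3_closed[OF ad] hom_on_closed(3)[OF ad] mem1 mem2)
    moreover have "\<dots> = 0"
      using rel[OF qH] hom_on_zero[OF ad] by simp
    ultimately show "cut3 (\<lambda>b m v. ?F u b m v) q + cut2 (\<lambda>v w. ksgn (?S x (u @ v) w + ?S x u v)
       (?L u v w)) q = 0"
      by (simp add: ksgn_simps(1)[symmetric] del: ksgn_simps(1))
  qed
  then have "cut2 (\<lambda>u. cut3 (\<lambda>b m v. ?F u b m v)) hs + ?AA = 0"
    by (simp add: cut2_zero)
  moreover have "dA A f (\<lambda>x hs a. dX H X (\<lambda>x hs. \<phi> x hs a) x hs) x hs a =
     ?AX +
     ?AH"
    unfolding dA_def dX_def ksgn_simps cut2_add ..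
  ultimately show ?thesis unfolding dX_def[of H X "\<lambda>x hs. dA A f \<phi> x hs a"] X H
    by (simp add: algebra_simps)
qed

section \<open>The structure relations\<close>

lemma sum_splits:
  "(\<Sum>(r, s, t)\<in>splits N. F r s t) = (\<Sum>i\<le>N. \<Sum>j\<in>{1..N - i}. F i j (N - i - j))"
proof -
  have "(\<Sum>i\<le>N. \<Sum>j\<in>{1..N - i}. F i j (N - i - j)) =
      (\<Sum>(i, j)\<in>Sigma {..N} (\<lambda>i. {1..N - i}). F i j (N - i - j))"
    by (rule sum.Sigma) auto
  also have "\<dots> = (\<Sum>(r, s, t)\<in>splits N. F r s t)"
    by (rule sum.reindex_bij_witness[where i = "\<lambda>(r, s, t). (r, s)" and j = "\<lambda>(i, j). (i, j, N - i - j)"])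
      (auto simp: splits_def)
  finally show ?thesis ..
qed

text \<open>A splitting of a fixed word is determined by its three lengths, and the guard of
  \<open>cut3\<close> against an empty block is the condition \<open>1 \<le> s\<close> of
  \<open>splits\<close>.\<close>

lemma cut3_eq_splits:
  "cut3 (\<lambda>u m v. F (length u) (length m) (length v)) w = (\<Sum>(r, s, t)\<in>splits (length w). F r s t)"
proof -
  have "cut3 (\<lambda>u m v. F (length u) (length m) (length v)) w =
     (\<Sum>i\<le>length w. \<Sum>j\<le>length w - i. if j = 0 then 0 else F i j (length w - i - j))"
    unfolding cut3_def cut2_eq_sum by (intro sum.cong) (auto simp: min_def add.commute)
  also have "\<dots> = (\<Sum>i\<le>length w. \<Sum>j\<in>{1..length w - i}. F i j (length w - i - j))"
    by (intro sum.cong[OF refl] sum.mono_neutral_cong_right) auto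
  finally show ?thesis unfolding sum_splits .
qed

text \<open>Modulo 2 the Koszul exponent \<open>(s - 2) * dl u\<close> is
  \<open>len m * dl u\<close>, so the 2 in the degree of \<open>m\<^sub>s\<close> leaves no trace in
  the sign.\<close>

lemma splits_appR:
  "(\<Sum>(r, s, t)\<in>splits (length ws). ksgn (int (r + s * t)) (appR H G r s ws)) =
   cut3 (\<lambda>u m v. ksgn (len u + len m * len v + len m * dl u) (G (u @ hz H m # v))) ws"
proof -
  have "(\<Sum>(r, s, t)\<in>splits (length ws). ksgn (int (r + s * t)) (appR H G r s ws)) =
    cut3 (\<lambda>u m v. ksgn (int (length u + length m * length v)) (appR H G (length u) (length m) ws)) ws"
    by (rule cut3_eq_splits[of "\<lambda>r s t. ksgn (int (r + s * t)) (appR H G r s ws)" ws, symmetric])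
  also have "\<dots> = cut3 (\<lambda>u m v. ksgn (len u + len m * len v + len m * dl u) (G (u @ hz H m # v))) ws"
  proof (rule cut3_cong)
    fix u m v assume "u @ m @ v = ws"
    then have "take (length u) ws = u" "take (length m) (drop (length u) ws) = m"
      "drop (length u + length m) ws = v"
      by auto
    then show "ksgn (int (length u + length m * length v)) (appR H G (length u) (length m) ws) =
        ksgn (len u + len m * len v + len m * dl u) (G (u @ hz H m # v))"
      unfolding appR_def insR_def hz_def ksgn_simps
      by (intro ksgn_cong) simp_all
  qed
  finally show ?thesis .
qed

lemma ainf_relation:
  assumes "ainf_algebra H" "set p \<subseteq> hel H" "p \<noteq> []"
  shows "cut3 (\<lambda>b m c. ksgn (len b + len m * len c + len m * dl b) (mm H (b @ hz H m # c))) p = 0"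
  using assms unfolding splits_appR[symmetric] ainf_algebra_def by auto

lemma ainf_hz:
  assumes "ainf_algebra H" "set m \<subseteq> hel H" "m \<noteq> []"
  shows "hz H m \<in> hel H"
  using assms unfolding ainf_algebra_def hz_def hel_def by auto

text \<open>A nonempty block is replaced by one letter, so no word grows. This is why relations
  truncated at a given arity remain applicable after an operation.\<close>

lemma insert_hz:
  assumes "ainf_algebra H" "u @ m @ v = hs" "m \<noteq> []" "set hs \<subseteq> hel H"
  shows "set (u @ hz H m # v) \<subseteq> hel H" "length (u @ hz H m # v) \<le> length hs"
  using assms ainf_hz[OF assms(1), of m] by (auto simp: Suc_le_eq)

text \<open>Position 0 is the module element: \<open>r = 0\<close> are the operations of the module,
  \<open>r > 0\<close> those of the algebra, with positions among the letters shifted by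
  one.\<close>

lemma sum_splits_Suc:
  "(\<Sum>(r, s, t)\<in>splits (Suc N). F r s t) =
   (\<Sum>s\<le>N. F 0 (Suc s) (N - s)) + (\<Sum>(r, s, t)\<in>splits N. F (Suc r) s t)"
proof -
  have "(\<Sum>j\<in>{1..Suc N}. F 0 j (Suc N - j)) = (\<Sum>s\<le>N. F 0 (Suc s) (N - s))"
    by (rule sum.reindex_bij_witness[where i = Suc and j = "\<lambda>j. j - 1"]) auto
  then show ?thesis unfolding sum_splits sum.atMost_Suc_shift by simp
qed

text \<open>One formula serves twice: for \<open>G = mX X\<close> the sum is the module relation,
  and for a morphism \<open>G\<close> it is the left-hand side of the morphism relation. Both become
  statements about \<open>dX\<close>.\<close>

lemma splits_appX:
  "(\<Sum>(r, s, t)\<in>splits (length hs + 1). ksgn (int (r + s * t)) (appX H X G r s x hs)) = dX H X G x hs"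
proof -
  let ?F = "\<lambda>r s t. ksgn (int (r + s * t)) (appX H X G r s x hs)"
  have "(\<Sum>s\<le>length hs. ?F 0 (Suc s) (length hs - s)) = pull (- 1) (mX X) G x hs"
  proof -
    have "(\<Sum>s\<le>length hs. ?F 0 (Suc s) (length hs - s)) =
        cut2 (\<lambda>u v. ?F 0 (Suc (length u)) (length v)) hs"
      unfolding cut2_eq_sum by (intro sum.cong) (auto simp: min_def)
    also have "\<dots> = pull (- 1) (mX X) G x hs"
      unfolding pull_def
    proof (rule cut2_cong)
      fix u v assume "u @ v = hs"
      then show "?F 0 (Suc (length u)) (length v) =
          ksgn ((len u + - 1) * len v) (G (fst x + dl u + len u + - 1, mX X x u) v)"
        unfolding appX_def by (intro ksgn_cong) (auto simp: algebra_simps)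
    qed
    finally show ?thesis .
  qed
  moreover have "(\<Sum>(r, s, t)\<in>splits (length hs). ?F (Suc r) s t) = dH H G x hs"
  proof -
    have "(\<Sum>(r, s, t)\<in>splits (length hs). ?F (Suc r) s t) =
      cut3 (\<lambda>u m v. ?F (Suc (length u)) (length m) (length v)) hs"
      by (rule cut3_eq_splits[of "\<lambda>r s t. ?F (Suc r) s t", symmetric])
    also have "\<dots> = dH H G x hs"
      unfolding dH_def
    proof (rule cut3_cong)
      fix u m v assume "u @ m @ v = hs"
      then have "take (length u) hs = u" "take (length m) (drop (length u) hs) = m"
        "drop (length u + length m) hs = v"
        by auto
      then show "?F (Suc (length u)) (length m) (length v) =
          ksgn (len u + 1 + len m * len v + len m * (fst x + dl u)) (G x (u @ hz H m # v))"
        unfolding appX_def insR_def hz_def ksgn_simps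
        by simp (intro ksgn_parity, simp only: parity_simps)
    qed
    finally show ?thesis .
  qed
  ultimately show ?thesis
    unfolding dX_def Suc_eq_plus1[symmetric] sum_splits_Suc[of ?F] by (simp only:)
qed

lemma sum_pairs:
  "(\<Sum>(i, j)\<in>{(i, j). i + j = length hs + 1 \<and> 1 \<le> i}. F i j) =
    cut2 (\<lambda>u v. F (Suc (length u)) (length v)) hs"
  unfolding cut2_eq_sum
  by (rule sum.reindex_bij_witness[where j = "\<lambda>(i, j). i - 1" and i = "\<lambda>i. (Suc i, length hs - i)"])
    (auto simp: min_def intro!: arg_cong2[where f = F])

text \<open>The arguments of \<open>pull\<close> appear in the opposite order, in accordance with
  transposition.\<close>

lemma amod_comp_eq:
  "amod_comp l f g x hs = (if enat (length hs) < l then pull 0 g f x hs else 0)"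
proof -
  have "(\<Sum>(r, s)\<in>{(r, s). r + s = length hs + 1 \<and> 1 \<le> r}. ksgn ((int r - 1) * int s)
      (f (fst x + dl (take (r - 1) hs) + int r - 1, g x (take (r - 1) hs)) (drop (r - 1) hs))) =
    pull 0 g f x hs"
    unfolding sum_pairs pull_def by (rule cut2_cong) (auto simp: algebra_simps)
  then show ?thesis by (simp add: amod_comp_def)
qed

lemma amodule_alt:
  "amodule l H e X \<longleftrightarrow> gmodule X \<and> mlinX l X H (smul X) (mX X) \<and>
     (\<forall>x\<in>hel X. mX X x [] = 0) \<and>
     (\<forall>x\<in>hel X. \<forall>hs. set hs \<subseteq> hel H \<longrightarrow> enat (length hs) < l \<longrightarrow>
        mX X x hs \<in> hcomp X (fst x + dl hs + len hs - 1) \<and> dX H X (mX X) x hs = 0) \<and>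
     (\<forall>x\<in>hel X. mX X x [(0, e)] = snd x) \<and>
     (\<forall>x\<in>hel X. \<forall>g\<in>hel H. \<forall>h\<in>hel H.
        mX X (fst x + fst g, mX X x [g]) [h] = mX X x [(fst g + fst h, mm H [g, h])])"
  unfolding amodule_def splits_appX ..

lemma amod_morphism_alt:
  "amod_morphism l H X Y g \<longleftrightarrow> mlinX l X H (smul Y) g \<and>
     (\<forall>x\<in>hel X. \<forall>hs. set hs \<subseteq> hel H \<longrightarrow> enat (length hs) < l \<longrightarrow>
        g x hs \<in> hcomp Y (fst x + dl hs + len hs) \<and> dX H X g x hs = pull 0 g (mX Y) x hs)"
proof -
  have "(\<Sum>(i, j)\<in>{(i, j). i + j = length hs + 1 \<and> 1 \<le> i}. ksgn (int ((i + 1) * j))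
           (mX Y (fst x + dl (take (i - 1) hs) + int i - 1, g x (take (i - 1) hs)) (drop (i - 1) hs))) =
    pull 0 g (mX Y) x hs" for x hs
    unfolding sum_pairs pull_def
  proof (rule cut2_cong)
    fix u v assume "u @ v = hs"
    \<comment> \<open>With \<open>i = length u + 1\<close> the exponent \<open>(i + 1) * j\<close>
      has the parity of \<open>len u * len v\<close>.\<close>
    then show "ksgn (int ((Suc (length u) + 1) * length v)) (mX Y (fst x + dl (take (Suc (length u) - 1) hs) +
        int (Suc (length u)) - 1, g x (take (Suc (length u) - 1) hs)) (drop (Suc (length u) - 1) hs)) =
      ksgn ((len u + 0) * len v) (mX Y (fst x + dl u + len u + 0, g x u) v)"
      by (intro ksgn_cong) (auto simp: algebra_simps)
  qed
  then show ?thesis unfolding amod_morphism_def splits_appX by simp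
qed

section \<open>The morphism relation of \<open>f\<close> and the operations
  \<open>mA\<close>\<close>

lemma finite_comps: "finite (comps N)"
proof (rule finite_subset)
  show "comps N \<subseteq> {is. set is \<subseteq> {..N} \<and> length is \<le> N}"
  proof
    fix "is" assume "is \<in> comps N"
    then have "sum_list is = N" "0 \<notin> set is" by (auto simp: comps_def)
    moreover have "length is \<le> sum_list is" if "0 \<notin> set is"
      using that by (induction "is") auto
    ultimately show "is \<in> {is. set is \<subseteq> {..N} \<and> length is \<le> N}"
      using member_le_sum_list[of _ "is"] by auto
  qed
  show "finite {is. set is \<subseteq> {..N} \<and> length is \<le> N}"
    by (rule finite_lists_length_le) simp
qed

text \<open>The two splittings with an empty part are distinct for a nonempty word; on
  \<open>[]\<close> they coincide.\<close>

lemma cut2_ends: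
  fixes F :: "'b list \<Rightarrow> 'b list \<Rightarrow> 'c::ab_group_add"
  assumes "w \<noteq> []"
  shows "cut2 F w = F [] w + F w [] + cut2 (\<lambda>u v. if u = [] \<or> v = [] then 0 else F u v) w"
proof -
  have 1: "cut2 F w = F w [] + cut2 (\<lambda>u v. if v = [] then 0 else F u v) w"
    for F :: "'b list \<Rightarrow> 'b list \<Rightarrow> 'c::ab_group_add" and w
  proof (induction w arbitrary: F)
    case (Cons h w)
    show ?case using Cons.IH[of "\<lambda>u. F (h # u)"] by (simp add: algebra_simps)
  qed simp
  have 2: "cut2 (\<lambda>u v. if v = [] then 0 else F u v) w = F [] w + cut2 (\<lambda>u v. if u = [] \<or> v = [] then 0 else F u v) w"
    using assms by (cases w) auto
  show ?thesis using 1[of F w] 2 by (simp add: algebra_simps)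
qed

text \<open>A differential graded algebra has no operations of arity 3 or more, so only compositions
  with one or two parts contribute: the differential of \<open>f ws\<close> and the products of two
  values of \<open>f\<close>.\<close>

lemma sum_comps:
  assumes "ws \<noteq> []"
  shows "(\<Sum>is\<in>comps (length ws). ksgn (vblocks is + kblocks is ws) (mm (ainf_of A) (blocks f is ws))) =
    dif A (dl ws + len ws - 1, f ws) + cut2 (\<lambda>u v. if u = [] \<or> v = [] then 0 else
      ksgn (len u - 1 + (len v - 1) * dl u) (mul A (dl u + len u - 1, f u) (dl v + len v - 1, f v))) ws"
proof -
  let ?N = "length ws"
  let ?F = "\<lambda>is. ksgn (vblocks is + kblocks is ws) (mm (ainf_of A) (blocks f is ws))"
  let ?P = "(\<lambda>i. [i, ?N - i]) ` {1..<?N}"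
  have "sum ?F (comps ?N) = sum ?F (insert [?N] ?P)"
  proof (rule sum.mono_neutral_right[OF finite_comps])
    show "insert [?N] ?P \<subseteq> comps ?N" using assms by (auto simp: comps_def)
    show "\<forall>is\<in>comps ?N - insert [?N] ?P. ?F is = 0"
    proof
      fix "is" assume isc: "is \<in> comps ?N - insert [?N] ?P"
      obtain i1 i2 i3 js where "is = i1 # i2 # i3 # js"
      proof (cases "is")
        case Nil
        then show ?thesis using isc assms by (auto simp: comps_def)
      next
        case (Cons i1 js1)
        show ?thesis
        proof (cases js1)
          case Nil
          then show ?thesis using Cons isc by (auto simp: comps_def)
        next
          case (Cons i2 js2)
          show ?thesis
          proof (cases js2)
            case Nil
            then have "is = [i1, i2]" using Cons \<open>is = i1 # js1\<close> by simp
            moreover have "i1 + i2 = ?N" "i1 \<noteq> 0" "i2 \<noteq> 0"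
              using isc calculation by (auto simp: comps_def)
            ultimately have "is \<in> ?P" by (auto intro!: image_eqI[of _ _ i1])
            then show ?thesis using isc by simp
          qed (use that Cons \<open>is = i1 # js1\<close> in auto)
        qed
      qed
      then show "?F is = 0" by (simp add: ainf_of_def)
    qed
  qed
  also have "\<dots> = ?F [?N] + sum ?F ?P" by (rule sum.insert) auto
  also have "?F [?N] = dif A (dl ws + len ws - 1, f ws)"
    by (simp add: ainf_of_def)
  also have "sum ?F ?P = (\<Sum>i\<in>{1..<?N}. ?F [i, ?N - i])"
    by (subst sum.reindex) (auto intro!: inj_onI)
  also have "\<dots> = (\<Sum>i\<le>?N. if i = 0 \<or> i = ?N then 0 else ?F [i, ?N - i])"
    by (rule sum.mono_neutral_cong_left) auto
  also have "\<dots> = cut2 (\<lambda>u v. if u = [] \<or> v = [] then 0 else ?F [length u, length v]) ws"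
    unfolding cut2_eq_sum by (rule sum.cong) (auto simp: min_def)
  also have "\<dots> = cut2 (\<lambda>u v. if u = [] \<or> v = [] then 0 else
      ksgn (len u - 1 + (len v - 1) * dl u) (mul A (dl u + len u - 1, f u) (dl v + len v - 1, f v))) ws"
    by (rule cut2_cong) (auto simp: ainf_of_def)
  finally show ?thesis .
qed

lemma dg_algebraD:
  assumes "dg_algebra A"
  shows "gmodule A" "hlin A (smul A) (dif A)"
    "a \<in> hel A \<Longrightarrow> dif A a \<in> hcomp A (fst a - 1)"
    "a \<in> hel A \<Longrightarrow> dif A (fst a - 1, dif A a) = 0"
    "a \<in> hel A \<Longrightarrow> hlin A (smul A) (mul A a)"
    "a \<in> hel A \<Longrightarrow> hlin A (smul A) (\<lambda>b. mul A b a)"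
    "unt A \<in> hcomp A 0"
    "a \<in> hel A \<Longrightarrow> mul A a (0, unt A) = snd a"
    "a \<in> hel A \<Longrightarrow> b \<in> hel A \<Longrightarrow> mul A a b \<in> hcomp A (fst a + fst b)"
    "a \<in> hel A \<Longrightarrow> b \<in> hel A \<Longrightarrow> dif A (fst a + fst b, mul A a b) =
      mul A (fst a - 1, dif A a) b + ksgn (fst a) (mul A a (fst b - 1, dif A b))"
    "a \<in> hel A \<Longrightarrow> b \<in> hel A \<Longrightarrow> c \<in> hel A \<Longrightarrow>
      mul A (fst a + fst b, mul A a b) c = mul A a (fst b + fst c, mul A b c)"
  using assms unfolding dg_algebra_def hel_def by (cases a; cases b; cases c; auto)+

text \<open>
  The relation that \<open>f\<close> is a morphism, multiplied by \<open>a\<close>: the summands with two factors \<open>f\<close> become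
  the composites of two operations \<open>mA\<close>, and those with one factor use the Leibniz rule of \<open>A\<close>.
\<close>

lemma mA_relation:
  fixes H :: "('k::field, 'h::ab_group_add) ainf" and A :: "('k, 'a::ab_group_add) dga"
  assumes A: "dg_algebra A" and H: "ainf_algebra H" and f: "ainf_morphism H (ainf_of A) f"
    and q: "set q \<subseteq> hel H" and a: "a \<in> hel A"
  shows "cut3 (\<lambda>b m v. ksgn (len m * len v + len m * dl b + len v) (mA A f (b @ hz H m # v) a)) q +
      cut2 (\<lambda>v w. ksgn ((len w + 1) * dl v + len w)
        (mA A f v (dl w + len w + fst a - 1, mA A f w a))) q = 0"
proof (cases "q = []")
  case True
  \<comment> \<open>On the empty word the relation says that \<open>dif A\<close> squares to
    0.\<close>
  then show ?thesis using dg_algebraD(4)[OF A a] by (simp add: cut3_def mA_def algebra_simps)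
next
  case False
  note A = dg_algebraD[OF A]
  let ?f = "\<lambda>u. (dl u + len u - 1, f u)"
  \<comment> \<open>The degree in which the morphism relation of \<open>f\<close> on
    \<open>q\<close> takes its values.\<close>
  let ?D = "dl q + len q - 2"
  let ?S = "\<lambda>v w. (len w + 1) * dl v + len w"
  let ?G = "\<lambda>v w. ksgn (?S v w) (mA A f v (dl w + len w + fst a - 1, mA A f w a))"
  let ?M = "\<lambda>u v. ksgn (len u - 1 + (len v - 1) * dl u) (mul A (?f u) (?f v))"
  have f_mem: "?f u \<in> hel A" if "set u \<subseteq> hel H" "u \<noteq> []" for u
    using f that unfolding ainf_morphism_def hel_def ainf_of_def by auto
  have f_rel: "cut3 (\<lambda>b m v. ksgn (len b + len m * len v + len m * dl b) (f (b @ hz H m # v))) q =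
     dif A (?f q) + cut2 (\<lambda>u v. if u = [] \<or> v = [] then 0 else ?M u v) q"
  proof -
    have "(\<Sum>(r, s, t)\<in>splits (length q). ksgn (int (r + s * t)) (appR H f r s q)) =
        (\<Sum>is\<in>comps (length q). ksgn (vblocks is + kblocks is q) (mm (ainf_of A) (blocks f is q)))"
      using f q False unfolding ainf_morphism_def by blast
    then show ?thesis unfolding splits_appR sum_comps[OF False] .
  qed
  have ad: "hom_on (hcomp A ?D) (\<lambda>y. mul A (?D, y) a)"
    by (rule hom_on_hlin[OF A(1) A(6)[OF a]])
  have m1: "dif A (?f q) \<in> hcomp A ?D"
    using A(3)[OF f_mem[OF q False]] by simp
  have m2: "?M u v \<in> hcomp A ?D" if "u @ v = q" "u \<noteq> []" "v \<noteq> []" for u v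
  proof -
    have "mul A (?f u) (?f v) \<in> hcomp A (fst (?f u) + fst (?f v))"
      using that q by (intro A(9) f_mem) auto
    also have "fst (?f u) + fst (?f v) = ?D" using that by auto
    finally show ?thesis by (rule hom_on_closed[OF ad])
  qed
  have m3: "f (b @ hz H m # v) \<in> hcomp A ?D" if "b @ m @ v = q" "m \<noteq> []" for b m v
  proof -
    have "?f (b @ hz H m # v) \<in> hel A"
      using that q ainf_hz[OF H, of m] by (intro f_mem) auto
    moreover have "fst (?f (b @ hz H m # v)) = ?D" using that by (auto simp: hz_def)
    ultimately show ?thesis by (simp add: hel_def)
  qed
  have "cut3 (\<lambda>b m v. ksgn (len m * len v + len m * dl b + len v) (mA A f (b @ hz H m # v) a)) q =
      cut3 (\<lambda>b m v. mul A (?D, ksgn (len b + len m * len v + len m * dl b) (f (b @ hz H m # v))) a) q"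
  proof (rule cut3_cong)
    fix b m v :: "(int \<times> 'h) list" assume bmv: "b @ m @ v = q" "m \<noteq> []"
    have D: "dl (b @ hz H m # v) + len (b @ hz H m # v) - 1 = ?D"
      unfolding bmv(1)[symmetric] by (simp add: hz_def)
    have "mA A f (b @ hz H m # v) a = ksgn (len (b @ hz H m # v) + 1) (mul A (?D, f (b @ hz H m # v)) a)"
      unfolding mA_def D by simp
    then show "ksgn (len m * len v + len m * dl b + len v) (mA A f (b @ hz H m # v) a) =
       mul A (?D, ksgn (len b + len m * len v + len m * dl b) (f (b @ hz H m # v))) a"
      unfolding hom_on_ksgn[OF ad m3[OF bmv]]
      by (simp only: ksgn_simps) (intro ksgn_parity, simp only: parity_simps)
  qed
  also have "\<dots> = mul A (?D, cut3 (\<lambda>b m v. ksgn (len b + len m * len v + len m * dl b) (f (b @ hz H m # v))) q) a"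
    by (rule hom_on_cut3[OF ad, symmetric], rule hom_on_closed(3)[OF ad], rule m3)
  also have "\<dots> = mul A (?D, dif A (?f q)) a +
      mul A (?D, cut2 (\<lambda>u v. if u = [] \<or> v = [] then 0 else ?M u v) q) a"
    unfolding f_rel by (rule hom_on_add[OF ad m1 hom_on_cut2_closed[OF ad]])
      (simp add: m2 hom_on_closed[OF ad] del: dl_simps)
  also have "mul A (?D, cut2 (\<lambda>u v. if u = [] \<or> v = [] then 0 else ?M u v) q) a =
      cut2 (\<lambda>u v. mul A (?D, if u = [] \<or> v = [] then 0 else ?M u v) a) q"
    by (rule hom_on_cut2[OF ad]) (simp add: m2 hom_on_closed[OF ad] del: dl_simps)
  also have "\<dots> = cut2 (\<lambda>u v. ksgn 1 (if u = [] \<or> v = [] then 0 else ?G u v)) q"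
  proof (rule cut2_cong)
    fix u v :: "(int \<times> 'h) list" assume uv: "u @ v = q"
    show "mul A (?D, if u = [] \<or> v = [] then 0 else ?M u v) a =
        ksgn 1 (if u = [] \<or> v = [] then 0 else ?G u v)"
    proof (cases "u = [] \<or> v = []")
      case True
      then show ?thesis using hom_on_zero[OF ad] by auto
    next
      case ne: False
      have fu: "?f u \<in> hel A" and fv: "?f v \<in> hel A" using uv q ne by (auto intro!: f_mem)
      have D: "?D = fst (?f u) + fst (?f v)" using uv by auto
      have "mul A (?f u) (?f v) \<in> hcomp A ?D" unfolding D by (rule A(9)[OF fu fv])
      then have "mul A (?D, ?M u v) a =
          ksgn (len u - 1 + (len v - 1) * dl u) (mul A (?D, mul A (?f u) (?f v)) a)"
        by (rule hom_on_ksgn[OF ad])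
      also have "mul A (?D, mul A (?f u) (?f v)) a =
          mul A (?f u) (fst (?f v) + fst a, mul A (?f v) a)"
        unfolding D by (rule A(11)[OF fu fv a])
      finally have 1: "mul A (?D, ?M u v) a = ksgn (len u - 1 + (len v - 1) * dl u)
         (mul A (?f u) (fst (?f v) + fst a, mul A (?f v) a))" .
      have ad2: "hom_on (hcomp A (fst (?f v) + fst a)) (\<lambda>y. mul A (?f u) (fst (?f v) + fst a, y))"
        by (rule hom_on_hlin[OF A(1) A(5)[OF fu]])
      have "dl v + len v + fst a - 1 = fst (?f v) + fst a" by simp
      then have "?G u v = ksgn (?S u v + (len u + 1)) (mul A (?f u) (fst (?f v) + fst a, ksgn (len v + 1) (mul A (?f v) a)))"
        using ne by (simp add: mA_def algebra_simps)
      also have "\<dots> = ksgn (?S u v + (len u + 1) + (len v + 1)) (mul A (?f u) (fst (?f v) + fst a, mul A (?f v) a))"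
        unfolding hom_on_ksgn[OF ad2 A(9)[OF fv a]] by simp
      finally have 2: "ksgn 1 (?G u v) = ksgn (1 + (?S u v + (len u + 1) + (len v + 1)))
         (mul A (?f u) (fst (?f v) + fst a, mul A (?f v) a))"
        by simp
      show ?thesis
        unfolding 1 2 if_not_P[OF ne] by (intro ksgn_parity) (simp only: parity_simps)
    qed
  qed
  finally have R1: "cut3 (\<lambda>b m v. ksgn (len m * len v + len m * dl b + len v) (mA A f (b @ hz H m # v) a)) q =
     mul A (?D, dif A (?f q)) a - cut2 (\<lambda>u v. if u = [] \<or> v = [] then 0 else ?G u v) q"
    unfolding cut2_ksgn[symmetric] by (simp add: ksgn_def)
  have fq: "?f q \<in> hel A" by (rule f_mem[OF q False])
  have ad3: "hom_on (hcomp A (fst (?f q) + fst a)) (\<lambda>y. dif A (fst (?f q) + fst a, y))"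
    by (rule hom_on_hlin[OF A(1) A(2)])
  \<comment> \<open>The two extreme splittings: by the Leibniz rule, \<open>?G [] q\<close> removes
    the term with \<open>dif A (?f q)\<close> from \<open>R1\<close> and leaves a term with
    \<open>dif A a\<close>, which \<open>?G q []\<close> removes.\<close>
  have "?G [] q = ksgn (len q) (dif A (fst (?f q) + fst a, ksgn (len q + 1) (mul A (?f q) a)))"
    using False by (simp add: mA_def algebra_simps)
  also have "\<dots> = ksgn (len q + (len q + 1)) (dif A (fst (?f q) + fst a, mul A (?f q) a))"
    unfolding hom_on_ksgn[OF ad3 A(9)[OF fq a]] by simp
  also have "dif A (fst (?f q) + fst a, mul A (?f q) a) =
    mul A (?D, dif A (?f q)) a + ksgn (fst (?f q)) (mul A (?f q) (fst a - 1, dif A a))"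
    unfolding A(10)[OF fq a] by simp
  finally have "?G [] q = - mul A (?D, dif A (?f q)) a -
      ksgn (dl q + len q - 1) (mul A (?f q) (fst a - 1, dif A a))"
    by (simp add: ksgn_def)
  moreover have "?G q [] = ksgn (dl q + len q - 1) (mul A (?f q) (fst a - 1, dif A a))"
    using False by (simp add: mA_def) (intro ksgn_cong; simp)
  ultimately show ?thesis unfolding R1 cut2_ends[OF False, of ?G] by simp
qed

section \<open>Multilinear families and \<open>A\<^sub>l\<close>-modules\<close>

lemma hlin_zero:
  assumes "vector_space s"
  shows "hlin V s (\<lambda>x. 0)"
proof -
  interpret vector_space s by fact
  show ?thesis by (simp add: hlin_def)
qed

lemma hlin_add:
  assumes "vector_space s" "hlin V s F" "hlin V s G"
  shows "hlin V s (\<lambda>x. F x + G x)"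
proof -
  interpret vector_space s by fact
  show ?thesis using assms(2,3) by (auto simp: hlin_def scale_right_distrib algebra_simps)
qed

lemma hlin_ksgn:
  assumes "vector_space s" "hlin V s F"
  shows "hlin V s (\<lambda>x. ksgn (e (fst x)) (F x))"
proof -
  interpret vector_space s by fact
  show ?thesis using assms(2) by (auto simp: hlin_def ksgn_def)
qed

lemma hlin_cut2:
  assumes s: "vector_space s" and "\<And>u v. u @ v = w \<Longrightarrow> hlin V s (\<lambda>x. F x u v)"
  shows "hlin V s (\<lambda>x. cut2 (F x) w)"
  using assms(2)
proof (induction w arbitrary: F)
  case (Cons h w)
  show ?case unfolding cut2.simps
    by (intro hlin_add[OF s] Cons.IH Cons.prems) auto
qed simp

lemma hlin_cut3:
  assumes s: "vector_space s"
    and "\<And>u m v. u @ m @ v = w \<Longrightarrow> m \<noteq> [] \<Longrightarrow> hlin V s (\<lambda>x. F x u m v)"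
  shows "hlin V s (\<lambda>x. cut3 (F x) w)"
  unfolding cut3_def
proof (intro hlin_cut2[OF s])
  fix u c m v assume "u @ c = w" "m @ v = c"
  then show "hlin V s (\<lambda>x. if m = [] then 0 else F x u m v)"
    using assms(2)[of u m v] hlin_zero[OF s] by (cases "m = []") auto
qed

text \<open>Linearity is required for fixed degrees only, so the tag handed to \<open>F\<close> must
  be a function \<open>e\<close> of the degree of \<open>x\<close> alone.\<close>

lemma hlin_comp:
  assumes "hlin W s F" "hlin V (smul W) G" "\<And>x. x \<in> hel V \<Longrightarrow> G x \<in> hcomp W (e (fst x))"
  shows "hlin V s (\<lambda>x. F (e (fst x), G x))"
  using assms unfolding hlin_def hel_def by auto

lemma mlinXD:
  assumes "mlinX l X H s \<phi>"
  shows "set hs \<subseteq> hel H \<Longrightarrow> enat (length hs) < l \<Longrightarrow> hlin X s (\<lambda>x. \<phi> x hs)"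
    "x \<in> hel X \<Longrightarrow> set us \<subseteq> hel H \<Longrightarrow> set vs \<subseteq> hel H \<Longrightarrow> enat (length (us @ vs) + 1) < l \<Longrightarrow>
      hlin H s (\<lambda>h. \<phi> x (us @ h # vs))"
  using assms unfolding mlinX_def mlin_def by (auto simp: algebra_simps)

lemma mlinXI:
  assumes "\<And>hs. set hs \<subseteq> hel H \<Longrightarrow> enat (length hs) < l \<Longrightarrow> hlin X s (\<lambda>x. \<phi> x hs)"
    "\<And>x us vs. x \<in> hel X \<Longrightarrow> set us \<subseteq> hel H \<Longrightarrow> set vs \<subseteq> hel H \<Longrightarrow> enat (length (us @ vs) + 1) < l \<Longrightarrow>
      hlin H s (\<lambda>h. \<phi> x (us @ h # vs))"
  shows "mlinX l X H s \<phi>"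
  using assms unfolding mlinX_def mlin_def by (auto simp: algebra_simps)

lemma enat_le_less: "enat n < l \<Longrightarrow> m \<le> n \<Longrightarrow> enat m < l"
  by (meson enat_ord_simps(1) order_le_less_trans)

text \<open>A varying letter is either taken by \<open>g\<close> or left for \<open>\<phi>\<close>.
  Besides composites of morphisms this serves the linear extensions, which can be evaluated on pure
  tensors once the function of words is multilinear.\<close>

lemma mlinX_pull:
  assumes s: "vector_space s"
    and g: "mlinX l X H (smul Y) g" and \<phi>: "mlinX l Y H s \<phi>"
    and mem: "\<And>x hs. x \<in> hel X \<Longrightarrow> set hs \<subseteq> hel H \<Longrightarrow> enat (length hs) < l \<Longrightarrow>
      g x hs \<in> hcomp Y (fst x + dl hs + len hs + \<delta>)"
  shows "mlinX l X H s (pull \<delta> g \<phi>)"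
proof (rule mlinXI)
  fix hs assume hs: "set hs \<subseteq> hel H" "enat (length hs) < l"
  show "hlin X s (\<lambda>x. pull \<delta> g \<phi> x hs)" unfolding pull_def
  proof (rule hlin_cut2[OF s])
    fix u v assume uv: "u @ v = hs"
    then have u: "set u \<subseteq> hel H" "enat (length u) < l" and v: "set v \<subseteq> hel H" "enat (length v) < l"
      using hs enat_le_less[OF hs(2)] by auto
    have "hlin X s (\<lambda>x. \<phi> (fst x + dl u + len u + \<delta>, g x u) v)"
      by (rule hlin_comp[where F = "\<lambda>y. \<phi> y v" and e = "\<lambda>d. d + dl u + len u + \<delta>",
          OF mlinXD(1)[OF \<phi> v] mlinXD(1)[OF g u]]) (rule mem[OF _ u])
    then show "hlin X s (\<lambda>x. ksgn ((len u + \<delta>) * len v) (\<phi> (fst x + dl u + len u + \<delta>, g x u) v))"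
      by (rule hlin_ksgn[OF s, where e = "\<lambda>_. (len u + \<delta>) * len v"])
  qed
next
  fix x us vs assume x: "x \<in> hel X" and us: "set us \<subseteq> hel H" and vs: "set vs \<subseteq> hel H"
    and l: "enat (length (us @ vs) + 1) < l"
  note lt = enat_le_less[OF l]
  show "hlin H s (\<lambda>h. pull \<delta> g \<phi> x (us @ h # vs))"
    unfolding pull_def cut2_append_Cons
  proof (intro hlin_add[OF s] hlin_cut2[OF s])
    fix a b assume ab: "a @ b = us"
    let ?y = "(fst x + dl a + len a + \<delta>, g x a)"
    have "enat (length a) < l" using ab by (auto intro: lt)
    then have "?y \<in> hel Y" using mem[OF x, of a] ab us by (auto simp: hel_def)
    then have "hlin H s (\<lambda>h. \<phi> ?y (b @ h # vs))"
      using ab us vs by (intro mlinXD(2)[OF \<phi>]) (auto intro: lt)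
    then show "hlin H s (\<lambda>h. ksgn ((len a + \<delta>) * len (b @ h # vs)) (\<phi> ?y (b @ h # vs)))"
      by (simp, intro hlin_ksgn[OF s])
  next
    fix a b assume ab: "a @ b = vs"
    let ?e = "\<lambda>d. fst x + (dl us + (d + dl a)) + (len us + (1 + len a)) + \<delta>"
    have *: "hlin H s (\<lambda>h. \<phi> (?e (fst h), g x (us @ h # a)) b)"
    proof (rule hlin_comp[where F = "\<lambda>y. \<phi> y b" and e = ?e])
      show "hlin Y s (\<lambda>y. \<phi> y b)" using ab vs by (intro mlinXD(1)[OF \<phi>]) (auto intro: lt)
      show "hlin H (smul Y) (\<lambda>h. g x (us @ h # a))"
        using ab us vs by (intro mlinXD(2)[OF g] x) (auto intro: lt)
      show "g x (us @ h # a) \<in> hcomp Y (?e (fst h))" if "h \<in> hel H" for h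
      proof -
        have "enat (length (us @ h # a)) < l" using ab by (auto intro: lt)
        then show ?thesis
          using mem[OF x, of "us @ h # a"] that ab us vs by (auto simp: add_ac)
      qed
    qed
    show "hlin H s (\<lambda>h. ksgn ((len (us @ h # a) + \<delta>) * len b)
        (\<phi> (fst x + dl (us @ h # a) + len (us @ h # a) + \<delta>, g x (us @ h # a)) b))"
      using hlin_ksgn[OF s *, of "\<lambda>d. (len us + (1 + len a) + \<delta>) * len b"]
      by (simp add: add_ac)
  qed
qed

text \<open>Three positions of the varying letter relative to the block: inside it the linearity of
  \<open>mm H\<close> enters as well, outside it that of \<open>\<phi>\<close> alone.\<close>

lemma mlinX_dH:
  assumes s: "vector_space s" and H: "ainf_algebra H" and \<phi>: "mlinX l X H s \<phi>"
  shows "mlinX l X H s (dH H \<phi>)"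
proof (rule mlinXI)
  fix hs assume hs: "set hs \<subseteq> hel H" "enat (length hs) < l"
  show "hlin X s (\<lambda>x. dH H \<phi> x hs)" unfolding dH_def
  proof (rule hlin_cut3[OF s])
    fix u m v assume umv: "u @ m @ v = hs" and m: "m \<noteq> []"
    have "hlin X s (\<lambda>x. \<phi> x (u @ hz H m # v))"
      by (intro mlinXD(1)[OF \<phi>] enat_le_less[OF hs(2)] insert_hz[OF H umv m hs(1)])
    then show "hlin X s (\<lambda>x. ksgn (len u + 1 + len m * len v + len m * (fst x + dl u)) (\<phi> x (u @ hz H m # v)))"
      by (rule hlin_ksgn[OF s])
  qed
next
  fix x us vs assume x: "x \<in> hel X" and us: "set us \<subseteq> hel H" and vs: "set vs \<subseteq> hel H"
    and l: "enat (length (us @ vs) + 1) < l"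
  note lt = enat_le_less[OF l]
  show "hlin H s (\<lambda>h. dH H \<phi> x (us @ h # vs))"
    unfolding dH_def cut3_append_Cons
  proof (intro hlin_add[OF s] hlin_cut2[OF s] hlin_cut3[OF s])
    fix a n b assume ab: "a @ n @ b = us" and n: "n \<noteq> []"
    have "hz H n \<in> hel H" using ab us by (intro ainf_hz[OF H _ n]) auto
    moreover have "enat (length ((a @ hz H n # b) @ vs) + 1) < l"
      using ab n by (cases n) (auto intro: lt)
    ultimately have "hlin H s (\<lambda>h. \<phi> x ((a @ hz H n # b) @ h # vs))"
      using ab us vs by (intro mlinXD(2)[OF \<phi>] x) auto
    then show "hlin H s (\<lambda>h. ksgn (len a + 1 + len n * len (b @ h # vs) + len n * (fst x + dl a))
        (\<phi> x (a @ hz H n # b @ h # vs)))"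
      by (simp, intro hlin_ksgn[OF s])
  next
    fix a n b assume ab: "a @ n @ b = vs" and n: "n \<noteq> []"
    have "hz H n \<in> hel H" using ab vs by (intro ainf_hz[OF H _ n]) auto
    moreover have "enat (length (us @ a @ hz H n # b) + 1) < l"
      using ab n by (cases n) (auto intro: lt)
    ultimately have *: "hlin H s (\<lambda>h. \<phi> x (us @ h # a @ hz H n # b))"
      using ab us vs by (intro mlinXD(2)[OF \<phi>] x) auto
    show "hlin H s (\<lambda>h. ksgn (len (us @ h # a) + 1 + len n * len b + len n * (fst x + dl (us @ h # a)))
        (\<phi> x ((us @ h # a) @ hz H n # b)))"
      using hlin_ksgn[OF s *, of "\<lambda>d. len us + (1 + len a) + 1 + len n * len b + len n * (fst x + (dl us + (d + dl a)))"]
      by simp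
  next
    fix a b c d assume ab: "a @ b = us" and cd: "c @ d = vs"
    let ?e = "\<lambda>k. dl b + (k + dl c) + (len b + (1 + len c)) - 2"
    have *: "hlin H s (\<lambda>h. \<phi> x (a @ (?e (fst h), mm H (b @ h # c)) # d))"
    proof (rule hlin_comp[where F = "\<lambda>z. \<phi> x (a @ z # d)" and e = ?e])
      show "hlin H s (\<lambda>z. \<phi> x (a @ z # d))"
        using ab cd us vs by (intro mlinXD(2)[OF \<phi>] x) (auto intro: lt)
      show "hlin H (smul H) (\<lambda>h. mm H (b @ h # c))"
        using H ab cd us vs unfolding ainf_algebra_def mlin_def by auto
      show "mm H (b @ h # c) \<in> hcomp H (?e (fst h))" if "h \<in> hel H" for h
        using ainf_hz[OF H, of "b @ h # c"] that ab cd us vs by (auto simp: hel_def hz_def)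
    qed
    show "hlin H s (\<lambda>h. ksgn (len a + 1 + len (b @ h # c) * len d + len (b @ h # c) * (fst x + dl a))
        (\<phi> x (a @ hz H (b @ h # c) # d)))"
      using hlin_ksgn[OF s *, of "\<lambda>_. len a + 1 + (len b + (1 + len c)) * len d + (len b + (1 + len c)) * (fst x + dl a)"]
      by (simp add: hz_def add_ac)
  qed
qed

lemma mlinX_add:
  assumes s: "vector_space s" and "mlinX l X H s \<phi>" "mlinX l X H s \<psi>"
  shows "mlinX l X H s (\<lambda>x hs. \<phi> x hs + \<psi> x hs)"
  by (rule mlinXI; rule hlin_add[OF s]; intro mlinXD[OF assms(2)] mlinXD[OF assms(3)])

section \<open>Modules and morphisms in transposed form\<close>

lemma amoduleD:
  assumes "amodule l H e X"
  shows "gmodule X" "mlinX l X H (smul X) (mX X)"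
    "x \<in> hel X \<Longrightarrow> mX X x [] = 0"
    "x \<in> hel X \<Longrightarrow> set hs \<subseteq> hel H \<Longrightarrow> enat (length hs) < l \<Longrightarrow>
      mX X x hs \<in> hcomp X (fst x + dl hs + len hs + - 1)"
    "x \<in> hel X \<Longrightarrow> set hs \<subseteq> hel H \<Longrightarrow> enat (length hs) < l \<Longrightarrow> dX H X (mX X) x hs = 0"
  using assms unfolding amodule_alt by auto

lemma mlinX_hom_on:
  assumes "mlinX l Y H s \<phi>" "gmodule Y" "set hs \<subseteq> hel H" "enat (length hs) < l"
  shows "hom_on (hcomp Y d) (\<lambda>y. \<phi> (d, y) hs)"
  using assms by (intro hom_on_hlin) (auto intro: mlinXD)

text \<open>The common computation behind the square of the differential
  (\<open>\<delta> = - 1\<close>, \<open>g = mX X\<close>) and the compatibility of a morphism with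
  the differentials (\<open>\<delta> = 0\<close>). On the right only \<open>dH\<close> acts on
  \<open>\<phi>\<close>; for a morphism, the action of the target module is recovered from
  \<open>dX H X g\<close> by the morphism relation.\<close>

lemma dX_pull:
  assumes H: "ainf_algebra H" and X: "amodule l H e X" and Y: "gmodule Y"
    and \<phi>: "mlinX l Y H s \<phi>"
    and mem: "\<And>x hs. x \<in> hel X \<Longrightarrow> set hs \<subseteq> hel H \<Longrightarrow> enat (length hs) < l \<Longrightarrow>
      g x hs \<in> hcomp Y (fst x + dl hs + len hs + \<delta>)"
    and x: "x \<in> hel X" and hs: "set hs \<subseteq> hel H" "enat (length hs) < l"
  shows "dX H X (pull \<delta> g \<phi>) x hs = pull (\<delta> - 1) (dX H X g) \<phi> x hs + ksgn \<delta> (pull \<delta> g (dH H \<phi>) x hs)"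
proof -
  note lt = enat_le_less[OF hs(2)]
  have ad: "hom_on (hcomp Y d) (\<lambda>y. \<phi> (d, y) v)" if "u @ v = hs" for u v d
    using that hs by (intro mlinX_hom_on[OF \<phi> Y]) (auto intro: lt)
  have m1: "g (fst x + dl u + len u + - 1, mX X x u) a \<in>
      hcomp Y (fst x + dl u + len u + dl a + len a + - 1 + \<delta>)" if "u @ a @ b = hs" for u a b
  proof -
    have l: "enat (length u) < l" "enat (length a) < l" using that by (auto intro: lt)
    have "(fst x + dl u + len u + - 1, mX X x u) \<in> hel X"
      using amoduleD(4)[OF X x, of u] that hs l by (auto simp: hel_def)
    from mem[OF this, of a] show ?thesis
      using that hs l by (auto simp: algebra_simps)
  qed
  have m2: "g x (u @ hz H m # a) \<in> hcomp Y (fst x + dl (u @ m @ a) + len (u @ m @ a) + \<delta> - 1)"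
    if umab: "u @ m @ a @ b = hs" and m: "m \<noteq> []" for u m a b
  proof -
    have "(u @ m @ a) @ b = hs" using umab by simp
    then have uma: "set (u @ m @ a) \<subseteq> hel H" "enat (length (u @ m @ a)) < l"
      using hs(1) by (auto intro: lt)
    have "g x (u @ hz H m # a) \<in> hcomp Y (fst x + dl (u @ hz H m # a) + len (u @ hz H m # a) + \<delta>)"
      by (intro mem x enat_le_less[OF uma(2)] insert_hz[OF H refl m uma(1)])
    also have "fst x + dl (u @ hz H m # a) + len (u @ hz H m # a) + \<delta> =
        fst x + dl (u @ m @ a) + len (u @ m @ a) + \<delta> - 1" by (simp add: hz_def)
    finally show ?thesis .
  qed
  have "pull (\<delta> - 1) (dX H X g) \<phi> x hs =
      pull (\<delta> - 1) (pull (- 1) (mX X) g) \<phi> x hs + pull (\<delta> - 1) (dH H g) \<phi> x hs"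
    unfolding pull_def[of "\<delta> - 1"] cut2_add[symmetric]
  proof (rule cut2_cong)
    fix p b assume pb: "p @ b = hs"
    let ?d = "fst x + dl p + len p + (\<delta> - 1)"
    note ad = ad[OF pb, of ?d]
    have "pull (- 1) (mX X) g x p \<in> hcomp Y ?d" unfolding pull_def
    proof (intro hom_on_cut2_closed[OF ad] hom_on_closed(3)[OF ad])
      fix u a assume ua: "u @ a = p"
      have "fst x + dl u + len u + dl a + len a + - 1 + \<delta> = ?d" using ua by auto
      then show "g (fst x + dl u + len u + - 1, mX X x u) a \<in> hcomp Y ?d"
        using m1[of u a b] ua pb by (metis append_assoc)
    qed
    moreover have "dH H g x p \<in> hcomp Y ?d" unfolding dH_def
    proof (intro hom_on_cut3_closed[OF ad] hom_on_closed(3)[OF ad])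
      fix u m a assume ua: "u @ m @ a = p" and m: "m \<noteq> []"
      then show "g x (u @ hz H m # a) \<in> hcomp Y ?d"
        using m2[of u m a b] pb by (auto simp: add_diff_eq)
    qed
    ultimately show "ksgn ((len p + (\<delta> - 1)) * len b) (\<phi> (?d, dX H X g x p) b) =
      ksgn ((len p + (\<delta> - 1)) * len b) (\<phi> (?d, pull (- 1) (mX X) g x p) b) +
      ksgn ((len p + (\<delta> - 1)) * len b) (\<phi> (?d, dH H g x p) b)"
      unfolding dX_def using hom_on_add[OF ad] by simp
  qed
  moreover have "pull (- 1) (mX X) (pull \<delta> g \<phi>) x hs = pull (\<delta> - 1) (pull (- 1) (mX X) g) \<phi> x hs"
    using pull_pull[of hs "hcomp Y" \<phi> g x "- 1" "mX X" \<delta>, OF ad m1] by (simp add: add.commute)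
  moreover have "dH H (pull \<delta> g \<phi>) x hs = pull (\<delta> - 1) (dH H g) \<phi> x hs + ksgn \<delta> (pull \<delta> g (dH H \<phi>) x hs)"
    by (rule dH_pull[where S = "hcomp Y"]) (erule ad, erule (1) m2)
  ultimately show ?thesis unfolding dX_def[of H X "pull \<delta> g \<phi>"] by simp
qed

lemma cut2_last: "cut2 (\<lambda>u v. if v = [] then F u else 0) w = F w"
  by (induction w arbitrary: F) auto

lemma cut2_first: "cut2 (\<lambda>u v. if u = [] then F v else 0) w = F w"
  by (cases w) (simp_all add: cut2_zero)

lemma pull_add: "pull \<delta> g (\<lambda>y hs. \<phi> y hs + \<psi> y hs) x hs = pull \<delta> g \<phi> x hs + pull \<delta> g \<psi> x hs"
  unfolding pull_def cut2_add[symmetric] by simp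

lemma dH_add: "dH H (\<lambda>y hs. \<phi> y hs + \<psi> y hs) x hs = dH H \<phi> x hs + dH H \<psi> x hs"
  unfolding dH_def cut3_add[symmetric] by simp

lemma dX_add: "dX H X (\<lambda>y hs. \<phi> y hs + \<psi> y hs) x hs = dX H X \<phi> x hs + dX H X \<psi> x hs"
  unfolding dX_def pull_add dH_add by simp

lemma pull_cong:
  assumes "\<And>u v. u @ v = hs \<Longrightarrow> g x u = g' x u"
    and "\<And>u v. u @ v = hs \<Longrightarrow> \<phi> (fst x + dl u + len u + \<delta>, g' x u) v = \<phi>' (fst x + dl u + len u + \<delta>, g' x u) v"
  shows "pull \<delta> g \<phi> x hs = pull \<delta> g' \<phi>' x hs"
  unfolding pull_def using assms by (intro cut2_cong) auto

text \<open>Operations do not lengthen words, so agreement up to \<open>length hs\<close> suffices.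
  The use is for composites of morphisms, which are cut off to 0 at length \<open>l\<close>.\<close>

lemma dX_cong:
  assumes "\<And>x ws. length ws \<le> length hs \<Longrightarrow> \<phi> x ws = \<phi>' x ws"
  shows "dX H X \<phi> x hs = dX H X \<phi>' x hs"
proof -
  have "pull (- 1) (mX X) \<phi> x hs = pull (- 1) (mX X) \<phi>' x hs"
    by (rule pull_cong) (auto intro!: assms)
  moreover have "dH H \<phi> x hs = dH H \<phi>' x hs" unfolding dH_def
  proof (rule cut3_cong)
    fix u m v assume "u @ m @ v = hs" "m \<noteq> []"
    then have "length (u @ hz H m # v) \<le> length hs" by (cases m) auto
    then show "ksgn (len u + 1 + len m * len v + len m * (fst x + dl u)) (\<phi> x (u @ hz H m # v)) =
      ksgn (len u + 1 + len m * len v + len m * (fst x + dl u)) (\<phi>' x (u @ hz H m # v))"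
      using assms by simp
  qed
  ultimately show ?thesis unfolding dX_def by simp
qed

text \<open>By the module relation the first term of the Leibniz rule for
  \<open>pull (- 1) (mX X)\<close> vanishes; the second is cancelled by the module part of
  \<open>dX\<close> applied to \<open>dH H \<phi>\<close>, and the square of \<open>dH\<close>
  vanishes by the relations of \<open>H\<close>.\<close>

lemma dX_dX:
  assumes H: "ainf_algebra H" and X: "amodule l H e X" and \<phi>: "mlinX l X H s \<phi>"
    and x: "x \<in> hel X" and hs: "set hs \<subseteq> hel H" "enat (length hs) < l"
  shows "dX H X (dX H X \<phi>) x hs = 0"
proof -
  note lt = enat_le_less[OF hs(2)]
  have "pull (- 1 - 1) (dX H X (mX X)) \<phi> x hs = cut2 (\<lambda>u v. 0) hs"
    unfolding pull_def
  proof (rule cut2_cong)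
    fix u v assume uv: "u @ v = hs"
    then have l: "enat (length u) < l" "enat (length v) < l" by (auto intro: lt)
    have "hom_on (hcomp X d) (\<lambda>y. \<phi> (d, y) v)" for d
      using uv hs l by (intro mlinX_hom_on[OF \<phi> amoduleD(1)[OF X]]) auto
    then have "\<phi> (d, 0) v = 0" for d by (rule hom_on_zero)
    moreover have "dX H X (mX X) x u = 0"
      using uv hs l by (intro amoduleD(5)[OF X x]) auto
    ultimately show "ksgn ((len u + (- 1 - 1)) * len v)
        (\<phi> (fst x + dl u + len u + (- 1 - 1), dX H X (mX X) x u) v) = 0"
      by simp
  qed
  then have 1: "dX H X (pull (- 1) (mX X) \<phi>) x hs = - pull (- 1) (mX X) (dH H \<phi>) x hs"
    using dX_pull[OF H X amoduleD(1)[OF X] \<phi> amoduleD(4)[OF X] x hs]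
    by (simp add: cut2_zero ksgn_def)
  have 2: "dH H (dH H \<phi>) x hs = 0"
  proof (rule dH_dH[OF _ _ hs(1)])
    show "hom_on (hcomp H d) (\<lambda>y. \<phi> x (u @ (d, y) # v))"
      if "u @ m @ v = hs" "m \<noteq> []" for u m v d
    proof (rule hom_on_hlin)
      show "gmodule H" using H by (simp add: ainf_algebra_def)
      have "Suc (length u + length v) \<le> length hs" using that by (cases m) auto
      then show "hlin H s (\<lambda>h. \<phi> x (u @ h # v))"
        using that hs by (intro mlinXD(2)[OF \<phi> x]) (auto intro: lt)
    qed
  qed (use ainf_relation[OF H] ainf_hz[OF H] in auto)
  have "dX H X (dX H X \<phi>) x hs = dX H X (pull (- 1) (mX X) \<phi>) x hs + dX H X (dH H \<phi>) x hs"
    unfolding dX_add[symmetric] by (simp add: dX_def[abs_def])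
  also have "\<dots> = 0" unfolding 1 by (simp add: dX_def 2)
  finally show ?thesis .
qed

lemma amod_morphismD:
  assumes "amod_morphism l H X Y g"
  shows "mlinX l X H (smul Y) g"
    "x \<in> hel X \<Longrightarrow> set hs \<subseteq> hel H \<Longrightarrow> enat (length hs) < l \<Longrightarrow>
      g x hs \<in> hcomp Y (fst x + dl hs + len hs + 0)"
    "x \<in> hel X \<Longrightarrow> set hs \<subseteq> hel H \<Longrightarrow> enat (length hs) < l \<Longrightarrow> dX H X g x hs = pull 0 g (mX Y) x hs"
  using assms unfolding amod_morphism_alt by auto

text \<open>With \<open>\<delta> = 0\<close> this gives associativity of composition; with
  \<open>\<delta> = - 1\<close> and \<open>f = mX Y\<close> it moves the module operations past
  \<open>g\<close>.\<close>

lemma pull_pull_morphism: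
  assumes g: "amod_morphism l H X Y g" and Z: "gmodule Z"
    and f: "\<And>y hs. y \<in> hel Y \<Longrightarrow> set hs \<subseteq> hel H \<Longrightarrow> enat (length hs) < l \<Longrightarrow>
      f y hs \<in> hcomp Z (fst y + dl hs + len hs + \<delta>)"
    and \<phi>: "mlinX l Z H s \<phi>"
    and x: "x \<in> hel X" and hs: "set hs \<subseteq> hel H" "enat (length hs) < l"
  shows "pull 0 g (pull \<delta> f \<phi>) x hs = pull \<delta> (pull 0 g f) \<phi> x hs"
proof -
  note lt = enat_le_less[OF hs(2)]
  have "pull 0 g (pull \<delta> f \<phi>) x hs = pull (0 + \<delta>) (pull 0 g f) \<phi> x hs"
  proof (rule pull_pull[where S = "hcomp Z"])
    show "hom_on (hcomp Z d) (\<lambda>y. \<phi> (d, y) v)" if "u @ v = hs" for u v d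
      using that hs by (intro mlinX_hom_on[OF \<phi> Z]) (auto intro: lt)
  next
    fix u a b assume uab: "u @ a @ b = hs"
    then have l: "enat (length u) < l" "enat (length a) < l" by (auto intro: lt)
    have "(fst x + dl u + len u + 0, g x u) \<in> hel Y"
      using amod_morphismD(2)[OF g x, of u] uab hs l by (auto simp: hel_def)
    from f[OF this, of a]
    show "f (fst x + dl u + len u + 0, g x u) a \<in> hcomp Z (fst x + dl u + len u + dl a + len a + 0 + \<delta>)"
      using uab hs l by auto
  qed
  then show ?thesis by simp
qed

text \<open>The morphism relation replaces \<open>dX H X g\<close> by
  \<open>pull 0 g (mX Y)\<close>, and reassociating produces the module part of
  \<open>dX H Y\<close>.\<close>

lemma dX_pull_morphism:
  assumes H: "ainf_algebra H" and X: "amodule l H e X" and Y: "amodule l H e' Y"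
    and g: "amod_morphism l H X Y g" and \<phi>: "mlinX l Y H s \<phi>"
    and x: "x \<in> hel X" and hs: "set hs \<subseteq> hel H" "enat (length hs) < l"
  shows "dX H X (pull 0 g \<phi>) x hs = pull 0 g (dX H Y \<phi>) x hs"
proof -
  note lt = enat_le_less[OF hs(2)]
  have "pull (- 1) (dX H X g) \<phi> x hs = pull (- 1) (pull 0 g (mX Y)) \<phi> x hs"
    using hs by (intro pull_cong amod_morphismD(3)[OF g x]) (auto intro: lt)
  also have "\<dots> = pull 0 g (pull (- 1) (mX Y) \<phi>) x hs"
    by (rule pull_pull_morphism[OF g amoduleD(1)[OF Y] amoduleD(4)[OF Y] \<phi> x hs, symmetric])
  finally have "pull (- 1) (dX H X g) \<phi> x hs = \<dots>" .
  moreover have dX_Y: "dX H Y \<phi> = (\<lambda>y hs. pull (- 1) (mX Y) \<phi> y hs + dH H \<phi> y hs)"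
    by (simp add: dX_def fun_eq_iff)
  ultimately show ?thesis
    using dX_pull[OF H X amoduleD(1)[OF Y] \<phi> amod_morphismD(2)[OF g] x hs]
    by (simp add: dX_Y pull_add)
qed

lemma mlinX_cong:
  assumes "mlinX l X H s \<phi>" and "\<And>x hs. enat (length hs) < l \<Longrightarrow> \<phi> x hs = \<psi> x hs"
  shows "mlinX l X H s \<psi>"
proof (rule mlinXI)
  fix hs assume "set hs \<subseteq> hel H" "enat (length hs) < l"
  then show "hlin X s (\<lambda>x. \<psi> x hs)" using mlinXD(1)[OF assms(1), of hs] assms(2) by simp
next
  fix x us vs assume "x \<in> hel X" "set us \<subseteq> hel H" "set vs \<subseteq> hel H" "enat (length (us @ vs) + 1) < l"
  then show "hlin H s (\<lambda>h. \<psi> x (us @ h # vs))"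
    using mlinXD(2)[OF assms(1), of x us vs] assms(2)[symmetric] by simp
qed

lemma vector_space_smul: "gmodule V \<Longrightarrow> vector_space (smul V)"
  by (simp add: gmodule_def)

text \<open>The differential passes through \<open>g\<close>, the relation of \<open>f\<close> then
  applies to the inner family, and associativity puts \<open>mX Z\<close> behind the composite. The
  truncation at \<open>l\<close> does no harm, since all words involved are no longer than
  \<open>hs\<close>.\<close>

lemma amod_morphism_comp:
  assumes H: "ainf_algebra H" and X: "amodule l H e X" and Y: "amodule l H e Y" and Z: "amodule l H e Z"
    and g: "amod_morphism l H X Y g" and f: "amod_morphism l H Y Z f"
  shows "amod_morphism l H X Z (amod_comp l f g)"
proof -
  note gZ = amoduleD(1)[OF Z]
  have "mlinX l X H (smul Z) (pull 0 g f)"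
    by (rule mlinX_pull[OF vector_space_smul[OF gZ] amod_morphismD(1)[OF g] amod_morphismD(1)[OF f]
      amod_morphismD(2)[OF g]])
  then have 1: "mlinX l X H (smul Z) (amod_comp l f g)"
    by (rule mlinX_cong) (simp add: amod_comp_eq)
  have 2: "amod_comp l f g x hs \<in> hcomp Z (fst x + dl hs + len hs)"
    if x: "x \<in> hel X" and hs: "set hs \<subseteq> hel H" "enat (length hs) < l" for x hs
  proof -
    note lt = enat_le_less[OF hs(2)]
    \<comment> \<open>Taken for the closure properties of \<open>hcomp Z d\<close>, in which the
      summands are to be added.\<close>
    have ad: "hom_on (hcomp Z d) (\<lambda>y. mX Z (d, y) [])" for d
      using hs by (intro mlinX_hom_on[OF amoduleD(2)[OF Z] gZ]) (auto intro: lt)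
    have "pull 0 g f x hs \<in> hcomp Z (fst x + dl hs + len hs)" unfolding pull_def
    proof (intro hom_on_cut2_closed[OF ad] hom_on_closed(3)[OF ad])
      fix u a assume ua: "u @ a = hs"
      then have l: "enat (length u) < l" "enat (length a) < l" by (auto intro: lt)
      have "(fst x + dl u + len u + 0, g x u) \<in> hel Y"
        using amod_morphismD(2)[OF g x, of u] ua hs l by (auto simp: hel_def)
      from amod_morphismD(2)[OF f this, of a]
      show "f (fst x + dl u + len u + 0, g x u) a \<in> hcomp Z (fst x + dl hs + len hs)"
        using ua hs l by (auto simp: add_ac)
    qed
    then show ?thesis using hs by (simp add: amod_comp_eq)
  qed
  have 3: "dX H X (amod_comp l f g) x hs = pull 0 (amod_comp l f g) (mX Z) x hs"
    if x: "x \<in> hel X" and hs: "set hs \<subseteq> hel H" "enat (length hs) < l" for x hs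
  proof -
    note lt = enat_le_less[OF hs(2)]
    have "dX H X (amod_comp l f g) x hs = dX H X (pull 0 g f) x hs"
      by (rule dX_cong) (simp add: amod_comp_eq lt)
    also have "\<dots> = pull 0 g (dX H Y f) x hs"
      by (rule dX_pull_morphism[OF H X Y g amod_morphismD(1)[OF f] x hs])
    also have "\<dots> = pull 0 g (pull 0 f (mX Z)) x hs"
    proof (rule pull_cong)
      fix u v assume uv: "u @ v = hs"
      then have l: "enat (length u) < l" "enat (length v) < l" by (auto intro: lt)
      have "(fst x + dl u + len u + 0, g x u) \<in> hel Y"
        using amod_morphismD(2)[OF g x, of u] uv hs l by (auto simp: hel_def)
      then show "dX H Y f (fst x + dl u + len u + 0, g x u) v =
          pull 0 f (mX Z) (fst x + dl u + len u + 0, g x u) v"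
        using uv hs l by (intro amod_morphismD(3)[OF f]) auto
    qed simp
    also have "\<dots> = pull 0 (pull 0 g f) (mX Z) x hs"
      by (rule pull_pull_morphism[OF g gZ amod_morphismD(2)[OF f] amoduleD(2)[OF Z] x hs])
    also have "\<dots> = pull 0 (amod_comp l f g) (mX Z) x hs"
      by (rule pull_cong) (auto simp: amod_comp_eq intro: lt)
    finally show ?thesis .
  qed
  show ?thesis unfolding amod_morphism_alt using 1 2 3 by auto
qed

text \<open>The component without letters is the only nonzero one, so \<open>dH\<close> contributes
  nothing and each of the two pulls keeps one extreme splitting; both give
  \<open>mX X x hs\<close>.\<close>

lemma amod_id_morphism:
  assumes H: "ainf_algebra H" and X: "amodule l H e X"
  shows "amod_morphism l H X X (amod_id H X)"
proof -
  note gX = amoduleD(1)[OF X]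
  have 0: "0 \<in> hcomp X d" for d
    using hom_on_hlin[OF gX hlin_zero[OF vector_space_smul[OF gX]]] by (rule hom_on_closed(1))
  interpret vector_space "smul X" by (rule vector_space_smul[OF gX])
  have sub: "subspace (hcomp X d)" for d using gX by (simp add: gmodule_def)
  have 1: "mlinX l X H (smul X) (amod_id H X)"
    by (rule mlinXI) (auto simp: hlin_def amod_id_def hel_def subspace_add[OF sub] subspace_scale[OF sub])
  have 2: "dX H X (amod_id H X) x hs = pull 0 (amod_id H X) (mX X) x hs"
    if x: "x \<in> hel X" and hs: "set hs \<subseteq> hel H" "enat (length hs) < l" for x hs
  proof -
    note lt = enat_le_less[OF hs(2)]
    have "dH H (amod_id H X) x hs = cut3 (\<lambda>u m v. 0) hs"
      unfolding dH_def by (rule cut3_cong) (simp add: amod_id_def)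
    moreover have "pull (- 1) (mX X) (amod_id H X) x hs = cut2 (\<lambda>u v. if v = [] then mX X x u else 0) hs"
      unfolding pull_def
    proof (rule cut2_cong)
      fix u v assume uv: "u @ v = hs"
      then have l: "enat (length u) < l" by (auto intro: lt)
      show "ksgn ((len u + - 1) * len v) (amod_id H X (fst x + dl u + len u + - 1, mX X x u) v) =
         (if v = [] then mX X x u else 0)"
        using amoduleD(4)[OF X x, of u] uv hs l by (auto simp: amod_id_def hel_def)
    qed
    moreover have "pull 0 (amod_id H X) (mX X) x hs = cut2 (\<lambda>u v. if u = [] then mX X x v else 0) hs"
      unfolding pull_def
    proof (rule cut2_cong)
      fix u v assume uv: "u @ v = hs"
      then have l: "enat (length v) < l" by (auto intro: lt)
      have "hom_on (hcomp X d) (\<lambda>y. mX X (d, y) v)" for d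
        using hs uv l by (intro mlinX_hom_on[OF amoduleD(2)[OF X] gX]) auto
      note hom_on_zero[OF this]
      then show "ksgn ((len u + 0) * len v) (mX X (fst x + dl u + len u + 0, amod_id H X x u) v) =
         (if u = [] then mX X x v else 0)"
        using x by (auto simp: amod_id_def)
    qed
    ultimately show ?thesis by (simp add: dX_def cut3_zero cut2_last cut2_first)
  qed
  show ?thesis unfolding amod_morphism_alt using 1 2 0
    by (auto simp: amod_id_def hel_def)
qed

section \<open>The two categories\<close>

lemma gmodule_zero: "gmodule V \<Longrightarrow> 0 \<in> hcomp V d"
  using hom_on_hlin[OF _ hlin_zero[OF vector_space_smul]] hom_on_closed(1) by metis

text \<open>Vanishing at 0 is wanted for inadmissible letters too, because off the intended
  arguments a composite evaluates its second map at the value 0 of the first.\<close>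

lemma normalized_zero:
  assumes "amod_morphism l H X Y g" "gmodule X"
    and "\<And>x hs. \<not> (x \<in> hel X \<and> set hs \<subseteq> hel H \<and> enat (length hs) < l) \<Longrightarrow> g x hs = 0"
  shows "g (d, 0) hs = 0"
proof (cases "set hs \<subseteq> hel H \<and> enat (length hs) < l")
  case True
  then show ?thesis
    using hom_on_zero[OF mlinX_hom_on[OF amod_morphismD(1)[OF assms(1)] assms(2)]] by blast
qed (use assms(3) in auto)

text \<open>The hypothesis \<open>0 < l\<close> makes the empty word admissible, where the identity
  takes its nonzero values. The axioms are checked on admissible arguments; elsewhere both sides are
  0 by normalization.\<close>

lemma is_category_amod_cat:
  assumes H: "ainf_algebra H" and l: "0 < l"
  shows "is_category (amod_cat l H e ::
    (('k::field, 'x::ab_group_add, 'h) amod, int \<times> 'x \<Rightarrow> (int \<times> 'h::ab_group_add) list \<Rightarrow> 'x) cat)"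
proof -
  let ?C = "amod_cat l H e :: (('k, 'x, 'h) amod, int \<times> 'x \<Rightarrow> (int \<times> 'h) list \<Rightarrow> 'x) cat"
  let ?ok = "\<lambda>(X :: ('k, 'x, 'h) amod) x hs. x \<in> hel X \<and> set hs \<subseteq> hel H \<and> enat (length hs) < l"
  have obj: "amodule l H e X" if "X \<in> Obj ?C" for X using that by (simp add: amod_cat_def)
  have hom: "amod_morphism l H X Y g" "\<not> ?ok X x hs \<Longrightarrow> g x hs = 0" if "g \<in> Hom ?C X Y" for X Y g x hs
    using that unfolding amod_cat_def by (auto simp del: split_paired_All)
  have zero: "g (d, 0) hs = 0" if "X \<in> Obj ?C" "g \<in> Hom ?C X Y" for X Y g d hs
    by (rule normalized_zero[OF hom(1)[OF that(2)] amoduleD(1)[OF obj[OF that(1)]] hom(2)[OF that(2)]])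
  have comp: "amod_comp l f g \<in> Hom ?C X Z"
    if X: "X \<in> Obj ?C" and Y: "Y \<in> Obj ?C" and Z: "Z \<in> Obj ?C"
      and g: "g \<in> Hom ?C X Y" and f: "f \<in> Hom ?C Y Z" for X Y Z f g
  proof -
    have "amod_morphism l H X Z (amod_comp l f g)"
      by (rule amod_morphism_comp[OF H obj[OF X] obj[OF Y] obj[OF Z] hom(1)[OF g] hom(1)[OF f]])
    moreover have "amod_comp l f g x hs = 0" if "\<not> ?ok X x hs" for x hs
    proof (cases "enat (length hs) < l")
      case True
      \<comment> \<open>If \<open>x\<close> or the prefix \<open>u\<close> is inadmissible then
        \<open>g x u = 0\<close>, and otherwise the suffix \<open>v\<close> is inadmissible for
        \<open>f\<close>.\<close>
      have "pull 0 g f x hs = cut2 (\<lambda>u v. 0) hs" unfolding pull_def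
      proof (rule cut2_cong)
        fix u v assume uv: "u @ v = hs"
        have "f (fst x + dl u + len u + 0, g x u) v = 0"
        proof (cases "x \<in> hel X \<and> set u \<subseteq> hel H")
          case True
          then have "\<not> set v \<subseteq> hel H" using that uv \<open>enat (length hs) < l\<close> by auto
          then show ?thesis using hom(2)[OF f] by auto
        next
          case False
          then have "\<not> ?ok X x u" by blast
          then have "g x u = 0" by (rule hom(2)[OF g])
          then show ?thesis using zero[OF Y f] by simp
        qed
        then show "ksgn ((len u + 0) * len v) (f (fst x + dl u + len u + 0, g x u) v) = 0" by simp
      qed
      then show ?thesis by (simp add: amod_comp_eq cut2_zero)
    qed (simp add: amod_comp_eq)
    ultimately show ?thesis by (simp add: amod_cat_def)
  qed
  have id: "amod_id H X \<in> Hom ?C X X" if "X \<in> Obj ?C" for X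
    using amod_id_morphism[OF H obj[OF that]] l by (auto simp: amod_cat_def amod_id_def zero_enat_def)
  have eqI: "p = q" if "p \<in> Hom ?C X Y" "q \<in> Hom ?C X Y" "\<And>x hs. ?ok X x hs \<Longrightarrow> p x hs = q x hs" for X Y p q
  proof (intro ext)
    fix x hs
    show "p x hs = q x hs"
    proof (cases "?ok X x hs")
      case False
      then show ?thesis using hom(2)[OF that(1) False] hom(2)[OF that(2) False] by simp
    qed (rule that(3))
  qed
  have id_right: "amod_comp l g (amod_id H X) = g"
    if X: "X \<in> Obj ?C" and Y: "Y \<in> Obj ?C" and g: "g \<in> Hom ?C X Y" for X Y g
  proof (rule eqI[OF comp[OF X X Y id[OF X] g] g])
    fix x hs assume ok: "?ok X x hs"
    have "pull 0 (amod_id H X) g x hs = cut2 (\<lambda>u v. if u = [] then g x v else 0) hs"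
      unfolding pull_def by (rule cut2_cong) (use ok in \<open>auto simp: amod_id_def zero[OF X g]\<close>)
    then show "amod_comp l g (amod_id H X) x hs = g x hs"
      using ok by (simp add: amod_comp_eq cut2_first)
  qed
  have id_left: "amod_comp l (amod_id H Y) g = g"
    if X: "X \<in> Obj ?C" and Y: "Y \<in> Obj ?C" and g: "g \<in> Hom ?C X Y" for X Y g
  proof (rule eqI[OF comp[OF X Y Y g id[OF Y]] g])
    fix x hs assume ok: "?ok X x hs"
    have "pull 0 g (amod_id H Y) x hs = cut2 (\<lambda>u v. if v = [] then g x u else 0) hs"
      unfolding pull_def
    proof (rule cut2_cong)
      fix u v assume "u @ v = hs"
      then have "(fst x + dl u + len u + 0, g x u) \<in> hel Y"
        using ok amod_morphismD(2)[OF hom(1)[OF g], of x u] enat_le_less[of "length hs" l "length u"]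
        by (auto simp: hel_def)
      then show "ksgn ((len u + 0) * len v) (amod_id H Y (fst x + dl u + len u + 0, g x u) v) =
          (if v = [] then g x u else 0)"
        by (auto simp: amod_id_def)
    qed
    then show "amod_comp l (amod_id H Y) g x hs = g x hs"
      using ok by (simp add: amod_comp_eq cut2_last)
  qed
  have assoc: "amod_comp l f (amod_comp l g h) = amod_comp l (amod_comp l f g) h"
    if W: "W \<in> Obj ?C" and X: "X \<in> Obj ?C" and Y: "Y \<in> Obj ?C" and Z: "Z \<in> Obj ?C"
      and h: "h \<in> Hom ?C W X" and g: "g \<in> Hom ?C X Y" and f: "f \<in> Hom ?C Y Z" for W X Y Z f g h
  proof (rule eqI[OF comp[OF W Y Z comp[OF W X Y h g] f] comp[OF W X Z h comp[OF X Y Z g f]]])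
    fix x hs assume ok: "?ok W x hs"
    note lt = enat_le_less[of "length hs" l]
    have "amod_comp l f (amod_comp l g h) x hs = pull 0 (pull 0 h g) f x hs"
      using ok by (simp add: amod_comp_eq) (rule pull_cong; auto simp: amod_comp_eq intro: lt)
    also have "\<dots> = pull 0 h (pull 0 g f) x hs"
      using ok by (intro pull_pull_morphism[OF hom(1)[OF h] amoduleD(1)[OF obj[OF Y]]
        amod_morphismD(2)[OF hom(1)[OF g]] amod_morphismD(1)[OF hom(1)[OF f]], symmetric]) auto
    also have "\<dots> = amod_comp l (amod_comp l f g) h x hs"
      using ok by (simp add: amod_comp_eq) (rule pull_cong; auto simp: amod_comp_eq intro: lt)
    finally show "amod_comp l f (amod_comp l g h) x hs = amod_comp l (amod_comp l f g) h x hs" .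
  qed
  have C: "Idm ?C = amod_id H" "Cmp ?C = amod_comp l" by (simp_all add: amod_cat_def)
  show ?thesis unfolding is_category_def C
    by (intro conjI ballI) (erule id, erule (2) id_right, erule (2) id_left, erule (4) comp, erule (6) assoc)
qed

section \<open>The category of differential graded modules\<close>

lemma dgm_morphismD:
  assumes "dgm_morphism A M N \<phi>"
  shows "hlin M (smul N) \<phi>"
    "x \<in> hcomp M p \<Longrightarrow> \<phi> (p, x) \<in> hcomp N p"
    "x \<in> hcomp M p \<Longrightarrow> mdif N (p, \<phi> (p, x)) = \<phi> (p - 1, mdif M (p, x))"
    "x \<in> hcomp M p \<Longrightarrow> a \<in> hcomp A q \<Longrightarrow> act N (p, \<phi> (p, x)) (q, a) = \<phi> (p + q, act M (p, x) (q, a))"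
  using assms unfolding dgm_morphism_def by auto

lemma dg_moduleD:
  assumes "dg_module A M"
  shows "gmodule M"
    "x \<in> hcomp M p \<Longrightarrow> mdif M (p, x) \<in> hcomp M (p - 1)"
    "x \<in> hcomp M p \<Longrightarrow> a \<in> hcomp A q \<Longrightarrow> act M (p, x) (q, a) \<in> hcomp M (p + q)"
  using assms unfolding dg_module_def by blast+

lemma is_category_dgm_cat:
  "is_category (dgm_cat A :: (('k::field, 'm::ab_group_add, 'a::ab_group_add) dgm, int \<times> 'm \<Rightarrow> 'm) cat)"
proof -
  let ?C = "dgm_cat A :: (('k, 'm, 'a) dgm, int \<times> 'm \<Rightarrow> 'm) cat"
  let ?c = "\<lambda>\<phi> \<psi> x. \<phi> (fst x, \<psi> x)"
  have obj: "dg_module A X" if "X \<in> Obj ?C" for X using that by (simp add: dgm_cat_def)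
  have hom: "dgm_morphism A X Y g" "x \<notin> hel X \<Longrightarrow> g x = 0" if "g \<in> Hom ?C X Y" for X Y g x
    using that unfolding dgm_cat_def by (auto simp del: split_paired_All)
  have zero: "g (d, 0) = 0" if "X \<in> Obj ?C" "g \<in> Hom ?C X Y" for X Y g d
    by (rule hom_on_zero[OF hom_on_hlin[OF dg_moduleD(1)[OF obj[OF that(1)]] dgm_morphismD(1)[OF hom(1)[OF that(2)]]]])
  have comp: "?c f g \<in> Hom ?C X Z"
    if X: "X \<in> Obj ?C" and Y: "Y \<in> Obj ?C" and Z: "Z \<in> Obj ?C"
      and g: "g \<in> Hom ?C X Y" and f: "f \<in> Hom ?C Y Z" for X Y Z f g
  proof -
    note F = dgm_morphismD[OF hom(1)[OF f]] and G = dgm_morphismD[OF hom(1)[OF g]]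
    have "hlin X (smul Z) (?c f g)"
      by (rule hlin_comp[OF F(1) G(1), where e = "\<lambda>d. d"]) (auto simp: hel_def intro: G(2))
    then have "dgm_morphism A X Z (?c f g)"
      unfolding dgm_morphism_def
      by (auto simp: F G intro: dg_moduleD(2)[OF obj] dg_moduleD(3)[OF obj] X)
    moreover have "?c f g x = 0" if "x \<notin> hel X" for x
      using hom(2)[OF g that] zero[OF Y f] by simp
    ultimately show ?thesis by (simp add: dgm_cat_def del: split_paired_All)
  qed
  have id: "Idm ?C X \<in> Hom ?C X X" if X: "X \<in> Obj ?C" for X
  proof -
    interpret vector_space "smul X" by (rule vector_space_smul[OF dg_moduleD(1)[OF obj[OF X]]])
    have sub: "subspace (hcomp X d)" for d using dg_moduleD(1)[OF obj[OF X]] by (simp add: gmodule_def)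
    have "dgm_morphism A X X (Idm ?C X)" unfolding dgm_morphism_def dgm_cat_def
      by (auto simp: hlin_def hel_def subspace_add[OF sub] subspace_scale[OF sub]
          dg_moduleD(2)[OF obj[OF X]] dg_moduleD(3)[OF obj[OF X]])
    then show ?thesis by (simp add: dgm_cat_def)
  qed
  have C: "Cmp ?C = ?c" by (simp add: dgm_cat_def)
  have id_right: "?c g (Idm ?C X) = g" if "X \<in> Obj ?C" "Y \<in> Obj ?C" "g \<in> Hom ?C X Y" for X Y g
    using zero[OF that(1,3)] hom(2)[OF that(3)] by (auto simp: dgm_cat_def fun_eq_iff)
  have id_left: "?c (Idm ?C Y) g = g" if X: "X \<in> Obj ?C" and Y: "Y \<in> Obj ?C" and g: "g \<in> Hom ?C X Y" for X Y g
  proof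
    fix x
    \<comment> \<open>Off the domain \<open>g x = 0\<close>, which lies in every component, so the
      normalized identity of \<open>Y\<close> returns it.\<close>
    have "(fst x, g x) \<in> hel Y"
    proof (cases "x \<in> hel X")
      case True
      then show ?thesis using dgm_morphismD(2)[OF hom(1)[OF g], of "snd x" "fst x"] by (simp add: hel_def)
    next
      case False
      then show ?thesis using hom(2)[OF g] gmodule_zero[OF dg_moduleD(1)[OF obj[OF Y]]] by (simp add: hel_def)
    qed
    then show "?c (Idm ?C Y) g x = g x" by (simp add: dgm_cat_def)
  qed
  show ?thesis unfolding is_category_def C
    by (intro conjI ballI) (erule id, erule (2) id_right, erule (2) id_left, erule (4) comp, simp)
qed

section \<open>Operations ending in \<open>A\<close> and the total differential\<close>

lemma mA_mem:
  assumes A: "dg_algebra A" and f: "ainf_morphism H (ainf_of A) f"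
    and v: "set v \<subseteq> hel H" and a: "a \<in> hel A"
  shows "mA A f v a \<in> hcomp A (dl v + len v + fst a - 1)"
proof (cases "v = []")
  case True
  then show ?thesis using dg_algebraD(3)[OF A a] by (simp add: mA_def)
next
  case False
  have "(dl v + len v - 1, f v) \<in> hel A"
    using f False v unfolding ainf_morphism_def hel_def ainf_of_def by auto
  note dg_algebraD(9)[OF A this a]
  moreover have "dl v + len v - 1 + fst a = dl v + len v + fst a - 1" by simp
  ultimately have m: "mul A (dl v + len v - 1, f v) a \<in> hcomp A (dl v + len v + fst a - 1)"
    by (simp only: fst_conv)
  show ?thesis
    using False hom_on_closed(3)[OF hom_on_hlin[OF dg_algebraD(1,2)[OF A]] m] by (simp add: mA_def)
qed

lemma hlin_mA:
  assumes A: "dg_algebra A" and f: "ainf_morphism H (ainf_of A) f" and v: "set v \<subseteq> hel H"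
  shows "hlin A (smul A) (mA A f v)"
proof (cases "v = []")
  case True
  then show ?thesis using dg_algebraD(2)[OF A] by (simp add: mA_def hlin_def)
next
  case False
  have "(dl v + len v - 1, f v) \<in> hel A"
    using f False v unfolding ainf_morphism_def hel_def ainf_of_def by auto
  note hlin_ksgn[OF vector_space_smul[OF dg_algebraD(1)[OF A]] dg_algebraD(5)[OF A this], of "\<lambda>_. len v + 1"]
  moreover have "mA A f v = (\<lambda>a. ksgn (len v + 1) (mul A (dl v + len v - 1, f v) a))"
    using False by (simp add: mA_def fun_eq_iff add.commute)
  ultimately show ?thesis by (simp only:)
qed

lemma hlin_mA_word:
  assumes A: "dg_algebra A" and f: "ainf_morphism H (ainf_of A) f"
    and u: "set u \<subseteq> hel H" and v: "set v \<subseteq> hel H" and a: "a \<in> hel A"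
  shows "hlin H (smul A) (\<lambda>h. mA A f (u @ h # v) a)"
proof -
  let ?e = "\<lambda>d. dl u + (d + dl v) + (len u + (1 + len v)) - 1"
  have f_lin: "hlin H (smul A) (\<lambda>h. f (u @ h # v))"
    using f u v unfolding ainf_morphism_def mlin_def ainf_of_def by simp
  have f_mem: "f (u @ h # v) \<in> hcomp A (?e (fst h))" if h: "h \<in> hel H" for h
  proof -
    have "set (u @ h # v) \<subseteq> hel H" using u v h by simp
    then have "f (u @ h # v) \<in> hcomp (ainf_of A) (dl (u @ h # v) + len (u @ h # v) - 1)"
      using f unfolding ainf_morphism_def by blast
    then show ?thesis by (simp add: ainf_of_def add_ac)
  qed
  have "hlin H (smul A) (\<lambda>h. mul A (?e (fst h), f (u @ h # v)) a)"
    by (rule hlin_comp[OF dg_algebraD(6)[OF A a] f_lin f_mem])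
  from hlin_ksgn[OF vector_space_smul[OF dg_algebraD(1)[OF A]] this, of "\<lambda>_. len u + (1 + len v) + 1"]
  show ?thesis by (simp add: mA_def add_ac)
qed

text \<open>A bounded form of \<open>mlin3\<close>: the operations of an
  \<open>A\<^sub>l\<close>-module are multilinear on fewer than \<open>l\<close> letters, so
  \<open>mlin3\<close> itself is reached by restriction to one length.\<close>

definition mlinXA :: "enat \<Rightarrow> ('k::field, 'x::ab_group_add, 'z1) gmod_scheme \<Rightarrow>
    ('k, 'h::ab_group_add, 'z2) gmod_scheme \<Rightarrow> ('k, 'a::ab_group_add, 'z3) gmod_scheme \<Rightarrow>
    ('k \<Rightarrow> 'w \<Rightarrow> 'w) \<Rightarrow> (int \<times> 'x \<Rightarrow> (int \<times> 'h) list \<Rightarrow> int \<times> 'a \<Rightarrow> 'w::ab_group_add) \<Rightarrow> bool" where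
  "mlinXA l X H A s \<phi> \<longleftrightarrow> (\<forall>a\<in>hel A. mlinX l X H s (\<lambda>x hs. \<phi> x hs a)) \<and>
     (\<forall>x\<in>hel X. \<forall>hs. set hs \<subseteq> hel H \<longrightarrow> enat (length hs) < l \<longrightarrow> hlin A s (\<phi> x hs))"

lemma mlinXAD:
  assumes "mlinXA l X H A s \<phi>"
  shows "a \<in> hel A \<Longrightarrow> mlinX l X H s (\<lambda>x hs. \<phi> x hs a)"
    "x \<in> hel X \<Longrightarrow> set hs \<subseteq> hel H \<Longrightarrow> enat (length hs) < l \<Longrightarrow> hlin A s (\<phi> x hs)"
  using assms unfolding mlinXA_def by auto

text \<open>A varying letter of the suffix and the last factor enter through \<open>mA\<close>; the
  module element and the letters of the prefix enter \<open>\<phi>\<close> directly.\<close>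

lemma mlinXA_dA:
  assumes s: "vector_space s" and A: "dg_algebra A" and f: "ainf_morphism H (ainf_of A) f"
    and \<phi>: "mlinXA l X H A s \<phi>"
  shows "mlinXA l X H A s (dA A f \<phi>)"
  unfolding mlinXA_def
proof (intro conjI ballI allI impI)
  fix a assume a: "a \<in> hel A"
  let ?b = "\<lambda>v. (dl v + len v + fst a - 1, mA A f v a)"
  have b: "?b v \<in> hel A" if "set v \<subseteq> hel H" for v using mA_mem[OF A f that a] by (simp add: hel_def)
  show "mlinX l X H s (\<lambda>x hs. dA A f \<phi> x hs a)"
  proof (rule mlinXI)
    fix hs assume hs: "set hs \<subseteq> hel H" "enat (length hs) < l"
    show "hlin X s (\<lambda>x. dA A f \<phi> x hs a)" unfolding dA_def
    proof (intro hlin_cut2[OF s] hlin_ksgn[OF s])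
      fix u v assume "u @ v = hs"
      then show "hlin X s (\<lambda>x. \<phi> x u (?b v))"
        using hs b[of v] by (intro mlinXD(1)[OF mlinXAD(1)[OF \<phi>]]) (auto intro: enat_le_less)
    qed
  next
    fix x us vs assume x: "x \<in> hel X" and us: "set us \<subseteq> hel H" and vs: "set vs \<subseteq> hel H"
      and l: "enat (length (us @ vs) + 1) < l"
    note lt = enat_le_less[OF l]
    show "hlin H s (\<lambda>h. dA A f \<phi> x (us @ h # vs) a)" unfolding dA_def cut2_append_Cons
    proof (intro hlin_add[OF s] hlin_cut2[OF s])
      fix c d assume cd: "c @ d = us"
      let ?e = "\<lambda>k. dl d + (k + dl vs) + (len d + (1 + len vs)) + fst a - 1"
      have *: "hlin H s (\<lambda>h. \<phi> x c (?e (fst h), mA A f (d @ h # vs) a))"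
      proof (rule hlin_comp)
        show "hlin A s (\<phi> x c)" using cd us by (intro mlinXAD(2)[OF \<phi> x]) (auto intro: lt)
        show "hlin H (smul A) (\<lambda>h. mA A f (d @ h # vs) a)"
          using cd us vs by (intro hlin_mA_word[OF A f _ _ a]) auto
        show "mA A f (d @ h # vs) a \<in> hcomp A (?e (fst h))" if "h \<in> hel H" for h
          using mA_mem[OF A f _ a, of "d @ h # vs"] that cd us vs by (auto simp: add_ac)
      qed
      show "hlin H s (\<lambda>h. ksgn ((len (d @ h # vs) + 1) * (fst x + dl c) + len c + len (d @ h # vs))
          (\<phi> x c (dl (d @ h # vs) + len (d @ h # vs) + fst a - 1, mA A f (d @ h # vs) a)))"
        using hlin_ksgn[OF s *, of "\<lambda>_. (len d + (1 + len vs) + 1) * (fst x + dl c) + len c + (len d + (1 + len vs))"]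
        by (simp add: add_ac)
    next
      fix c d assume cd: "c @ d = vs"
      have *: "hlin H s (\<lambda>h. \<phi> x (us @ h # c) (?b d))"
        using cd us vs b[of d] by (intro mlinXD(2)[OF mlinXAD(1)[OF \<phi>]] x) (auto intro: lt)
      show "hlin H s (\<lambda>h. ksgn ((len d + 1) * (fst x + dl (us @ h # c)) + len (us @ h # c) + len d)
          (\<phi> x (us @ h # c) (?b d)))"
        using hlin_ksgn[OF s *, of "\<lambda>k. (len d + 1) * (fst x + (dl us + (k + dl c))) + (len us + (1 + len c)) + len d"]
        by (simp add: add_ac)
    qed
  qed
next
  fix x hs assume x: "x \<in> hel X" and hs: "set hs \<subseteq> hel H" "enat (length hs) < l"
  show "hlin A s (dA A f \<phi> x hs)" unfolding dA_def[abs_def]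
  proof (intro hlin_cut2[OF s])
    fix u v assume uv: "u @ v = hs"
    have "hlin A s (\<lambda>a. \<phi> x u ((\<lambda>d. dl v + len v + d - 1) (fst a), mA A f v a))"
    proof (rule hlin_comp)
      show "hlin A s (\<phi> x u)"
        using uv hs by (intro mlinXAD(2)[OF \<phi> x]) (auto intro: enat_le_less)
      show "hlin A (smul A) (mA A f v)" using uv hs by (intro hlin_mA[OF A f]) auto
      show "mA A f v a \<in> hcomp A (dl v + len v + fst a - 1)" if "a \<in> hel A" for a
        using uv hs that by (intro mA_mem[OF A f]) auto
    qed
    then show "hlin A s (\<lambda>a. ksgn ((len v + 1) * (fst x + dl u) + len u + len v)
        (\<phi> x u (dl v + len v + fst a - 1, mA A f v a)))"
      by (rule hlin_ksgn[OF s, where e = "\<lambda>_. (len v + 1) * (fst x + dl u) + len u + len v"])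
  qed
qed

text \<open>The transpose of the bar differential in the rescaled sign convention.\<close>

definition dT :: "('k, 'h) ainf \<Rightarrow> ('k, 'a::ab_group_add) dga \<Rightarrow> ((int \<times> 'h) list \<Rightarrow> 'a) \<Rightarrow>
    ('k, 'x, 'h) amod \<Rightarrow> (int \<times> 'x \<Rightarrow> (int \<times> 'h) list \<Rightarrow> int \<times> 'a \<Rightarrow> 'w::ab_group_add) \<Rightarrow>
    int \<times> 'x \<Rightarrow> (int \<times> 'h) list \<Rightarrow> int \<times> 'a \<Rightarrow> 'w" where
  "dT H A f X \<phi> x hs a = dX H X (\<lambda>x hs. \<phi> x hs a) x hs + dA A f \<phi> x hs a"

lemma mlinXA_add:
  assumes s: "vector_space s" and "mlinXA l X H A s \<phi>" "mlinXA l X H A s \<psi>"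
  shows "mlinXA l X H A s (\<lambda>x hs a. \<phi> x hs a + \<psi> x hs a)"
  using mlinXAD[OF assms(2)] mlinXAD[OF assms(3)] unfolding mlinXA_def
  by (auto intro!: mlinX_add s hlin_add)

lemma mlinXA_pull:
  assumes s: "vector_space s" and \<phi>: "mlinXA l Y H A s \<phi>" and g: "mlinX l X H (smul Y) g"
    and mem: "\<And>x hs. x \<in> hel X \<Longrightarrow> set hs \<subseteq> hel H \<Longrightarrow> enat (length hs) < l \<Longrightarrow>
      g x hs \<in> hcomp Y (fst x + dl hs + len hs + \<delta>)"
  shows "mlinXA l X H A s (\<lambda>x hs a. pull \<delta> g (\<lambda>y ws. \<phi> y ws a) x hs)"
  unfolding mlinXA_def
proof (intro conjI ballI allI impI)
  fix a assume "a \<in> hel A"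
  from mlinXAD(1)[OF \<phi> this] show "mlinX l X H s (pull \<delta> g (\<lambda>y ws. \<phi> y ws a))"
    by (rule mlinX_pull[OF s g _ mem])
next
  fix x hs assume x: "x \<in> hel X" and hs: "set hs \<subseteq> hel H" "enat (length hs) < l"
  note lt = enat_le_less[OF hs(2)]
  show "hlin A s (\<lambda>a. pull \<delta> g (\<lambda>y ws. \<phi> y ws a) x hs)"
    unfolding pull_def
  proof (intro hlin_cut2[OF s] hlin_ksgn[OF s])
    fix u v assume uv: "u @ v = hs"
    then have l: "enat (length u) < l" "enat (length v) < l" by (auto intro: lt)
    have "(fst x + dl u + len u + \<delta>, g x u) \<in> hel Y"
      using mem[OF x, of u] uv hs l by (auto simp: hel_def)
    then have "hlin A s (\<phi> (fst x + dl u + len u + \<delta>, g x u) v)"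
      using uv hs l by (intro mlinXAD(2)[OF \<phi>]) auto
    then show "hlin A s (\<lambda>a. \<phi> (fst x + dl u + len u + \<delta>, g x u) v a)" by simp
  qed
qed

lemma mlinXA_dH:
  assumes s: "vector_space s" and H: "ainf_algebra H" and \<phi>: "mlinXA l X H A s \<phi>"
  shows "mlinXA l X H A s (\<lambda>x hs a. dH H (\<lambda>x hs. \<phi> x hs a) x hs)"
  unfolding mlinXA_def
proof (intro conjI ballI allI impI)
  fix a assume "a \<in> hel A"
  from mlinXAD(1)[OF \<phi> this] show "mlinX l X H s (dH H (\<lambda>x hs. \<phi> x hs a))"
    by (rule mlinX_dH[OF s H])
next
  fix x hs assume x: "x \<in> hel X" and hs: "set hs \<subseteq> hel H" "enat (length hs) < l"
  show "hlin A s (\<lambda>a. dH H (\<lambda>x hs. \<phi> x hs a) x hs)"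
    unfolding dH_def
  proof (intro hlin_cut3[OF s] hlin_ksgn[OF s])
    fix u m v assume umv: "u @ m @ v = hs" and m: "m \<noteq> []"
    have "hlin A s (\<phi> x (u @ hz H m # v))"
      by (intro mlinXAD(2)[OF \<phi> x] enat_le_less[OF hs(2)] insert_hz[OF H umv m hs(1)])
    then show "hlin A s (\<lambda>a. \<phi> x (u @ hz H m # v) a)" by simp
  qed
qed

lemma mlinXA_dT:
  assumes s: "vector_space s" and A: "dg_algebra A" and H: "ainf_algebra H"
    and f: "ainf_morphism H (ainf_of A) f"
    and X: "amodule l H e X" and \<phi>: "mlinXA l X H A s \<phi>"
  shows "mlinXA l X H A s (dT H A f X \<phi>)"
proof -
  have "mlinXA l X H A s (\<lambda>x hs a. pull (- 1) (mX X) (\<lambda>x hs. \<phi> x hs a) x hs +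
    dH H (\<lambda>x hs. \<phi> x hs a) x hs + dA A f \<phi> x hs a)"
    by (intro mlinXA_add[OF s] mlinXA_pull[OF s \<phi> amoduleD(2)[OF X] amoduleD(4)[OF X]]
        mlinXA_dH[OF s H \<phi>] mlinXA_dA[OF s A f \<phi>])
  moreover have "dT H A f X \<phi> = (\<lambda>x hs a. pull (- 1) (mX X) (\<lambda>x hs. \<phi> x hs a) x hs +
    dH H (\<lambda>x hs. \<phi> x hs a) x hs + dA A f \<phi> x hs a)"
    by (simp add: fun_eq_iff dT_def dX_def)
  ultimately show ?thesis by (simp only:)
qed

lemma dA_add: "dA A f (\<lambda>x hs a. \<phi> x hs a + \<psi> x hs a) x hs a = dA A f \<phi> x hs a + dA A f \<psi> x hs a"
  unfolding dA_def cut2_add[symmetric] by simp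

text \<open>In the expansion of the square, \<open>dX\<close> squared vanishes by itself, and the
  mixed terms cancel against \<open>dA\<close> squared.\<close>

lemma dT_dT:
  assumes A: "dg_algebra A" and H: "ainf_algebra H" and f: "ainf_morphism H (ainf_of A) f"
    and X: "amodule l H e X" and \<phi>: "mlinXA l X H A s \<phi>"
    and x: "x \<in> hel X" and hs: "set hs \<subseteq> hel H" "enat (length hs) < l" and a: "a \<in> hel A"
  shows "dT H A f X (dT H A f X \<phi>) x hs a = 0"
proof -
  have "dX H X (\<lambda>x hs. dA A f \<phi> x hs a) x hs +
    dA A f (\<lambda>x hs a. dX H X (\<lambda>x hs. \<phi> x hs a) x hs) x hs a + dA A f (dA A f \<phi>) x hs a = 0"
  proof (rule dX_dA[OF mA_relation[OF A H f _ a] mA_mem[OF A f] ainf_hz[OF H] hs(1) a])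
    show "hom_on (hcomp A d) (\<lambda>y. \<phi> x u (d, y))" if "u @ v = hs" for u v d
    proof (rule hom_on_hlin[OF dg_algebraD(1)[OF A] mlinXAD(2)[OF \<phi> x]])
      show "enat (length u) < l" using that by (auto intro: enat_le_less[OF hs(2)])
    qed (use that hs in auto)
  qed
  moreover have "dX H X (dX H X (\<lambda>x hs. \<phi> x hs a)) x hs = 0"
    by (rule dX_dX[OF H X mlinXAD(1)[OF \<phi> a] x hs])
  ultimately show ?thesis
    unfolding dT_def[abs_def] dX_add dA_add by (simp add: add.assoc)
qed

text \<open>\<open>g\<close> takes a prefix and \<open>mA\<close> a suffix. In the rescaled
  convention \<open>g\<close> has total degree 0, so exchanging them costs no sign.\<close>

lemma dA_pull:
  fixes g :: "int \<times> 'x \<Rightarrow> (int \<times> 'h) list \<Rightarrow> 'y"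
  shows "dA A f (\<lambda>x hs a. pull 0 g (\<lambda>y ws. \<phi> y ws a) x hs) x hs a = pull 0 g (\<lambda>y ws. dA A f \<phi> y ws a) x hs"
  unfolding dA_def pull_def cut2_ksgn cut2_assoc
proof (intro cut2_cong)
  fix u q v w :: "(int \<times> 'h) list" assume vw: "v @ w = q"
  show "ksgn ((len w + 1) * (fst x + dl (u @ v)) + len (u @ v) + len w)
      (ksgn ((len u + 0) * len v) (\<phi> (fst x + dl u + len u + 0, g x u) v
        (dl w + len w + fst a - 1, mA A f w a))) =
    ksgn ((len u + 0) * len q)
      (ksgn ((len w + 1) * (fst (fst x + dl u + len u + 0, g x u) + dl v) + len v + len w)
        (\<phi> (fst x + dl u + len u + 0, g x u) v (dl w + len w + fst a - 1, mA A f w a)))"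
    unfolding vw[symmetric] ksgn_simps by (intro ksgn_parity) (simp only: parity_simps)
qed

lemma dT_pull:
  assumes H: "ainf_algebra H" and X: "amodule l H e X" and Y: "amodule l H e' Y"
    and g: "amod_morphism l H X Y g" and \<phi>: "mlinXA l Y H A s \<phi>"
    and x: "x \<in> hel X" and hs: "set hs \<subseteq> hel H" "enat (length hs) < l" and a: "a \<in> hel A"
  shows "dT H A f X (\<lambda>x hs a. pull 0 g (\<lambda>y ws. \<phi> y ws a) x hs) x hs a =
    pull 0 g (\<lambda>y ws. dT H A f Y \<phi> y ws a) x hs"
  unfolding dT_def pull_add dA_pull
  using dX_pull_morphism[OF H X Y g mlinXAD(1)[OF \<phi> a] x hs] by simp

text \<open>The degree in the bar construction: the shift \<open>[-l]\<close> adds the number of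
  letters to the degree of the tensor.\<close>

abbreviation total_deg :: "int \<times> 'x \<Rightarrow> (int \<times> 'h) list \<Rightarrow> int \<times> 'a \<Rightarrow> int" where
  "total_deg x hs a \<equiv> fst x + dl hs + len hs + fst a"

text \<open>An additive map on values passes through the transposed operator. The degree condition
  on \<open>\<phi>\<close> keeps all values in one subgroup \<open>S\<close>, in the uses a single
  component of the bar construction.\<close>

lemma pull_apply:
  assumes ad: "hom_on S T"
    and g: "\<And>u. set u \<subseteq> hel H \<Longrightarrow> enat (length u) < l \<Longrightarrow>
      g x u \<in> hcomp Y (fst x + dl u + len u + \<delta>)"
    and \<phi>: "\<And>y ws. y \<in> hel Y \<Longrightarrow> set ws \<subseteq> hel H \<Longrightarrow> length ws \<le> length hs \<Longrightarrow>
      fst y + dl ws + len ws = fst x + dl hs + len hs + \<delta> \<Longrightarrow> \<phi> y ws \<in> S"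
    and hs: "set hs \<subseteq> hel H" "enat (length hs) < l"
  shows "pull \<delta> g \<phi> x hs \<in> S" "T (pull \<delta> g \<phi> x hs) = pull \<delta> g (\<lambda>y ws. T (\<phi> y ws)) x hs"
proof -
  have *: "\<phi> (fst x + dl u + len u + \<delta>, g x u) v \<in> S" if "u @ v = hs" for u v
  proof (rule \<phi>)
    have "enat (length u) < l" using that by (auto intro: enat_le_less[OF hs(2)])
    then show "(fst x + dl u + len u + \<delta>, g x u) \<in> hel Y"
      using g[of u] that hs by (auto simp: hel_def)
  qed (use that hs in auto)
  show "pull \<delta> g \<phi> x hs \<in> S" unfolding pull_def
    by (intro hom_on_cut2_closed[OF ad] hom_on_closed(3)[OF ad] *)
  have "T (pull \<delta> g \<phi> x hs) = cut2 (\<lambda>u v. T (ksgn ((len u + \<delta>) * len v)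
      (\<phi> (fst x + dl u + len u + \<delta>, g x u) v))) hs"
    unfolding pull_def by (intro hom_on_cut2[OF ad] hom_on_closed(3)[OF ad] *)
  also have "\<dots> = pull \<delta> g (\<lambda>y ws. T (\<phi> y ws)) x hs"
    unfolding pull_def by (intro cut2_cong hom_on_ksgn[OF ad] *)
  finally show "T (pull \<delta> g \<phi> x hs) = \<dots>" .
qed

lemma dH_apply:
  assumes ad: "hom_on S T" and H: "ainf_algebra H"
    and \<phi>: "\<And>ws. set ws \<subseteq> hel H \<Longrightarrow> length ws \<le> length hs \<Longrightarrow>
      dl ws + len ws = dl hs + len hs - 1 \<Longrightarrow> \<phi> x ws \<in> S"
    and hs: "set hs \<subseteq> hel H"
  shows "dH H \<phi> x hs \<in> S" "T (dH H \<phi> x hs) = dH H (\<lambda>y ws. T (\<phi> y ws)) x hs"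
proof -
  have *: "\<phi> x (u @ hz H m # v) \<in> S" if umv: "u @ m @ v = hs" and m: "m \<noteq> []" for u m v
  proof (rule \<phi>[OF insert_hz[OF H umv m hs]])
    show "dl (u @ hz H m # v) + len (u @ hz H m # v) = dl hs + len hs - 1"
      using umv by (auto simp: hz_def)
  qed
  show "dH H \<phi> x hs \<in> S" unfolding dH_def
    by (intro hom_on_cut3_closed[OF ad] hom_on_closed(3)[OF ad] *)
  have "T (dH H \<phi> x hs) = cut3 (\<lambda>u m v. T (ksgn (len u + 1 + len m * len v + len m * (fst x + dl u))
      (\<phi> x (u @ hz H m # v)))) hs"
    unfolding dH_def by (intro hom_on_cut3[OF ad] hom_on_closed(3)[OF ad] *)
  also have "\<dots> = dH H (\<lambda>y ws. T (\<phi> y ws)) x hs"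
    unfolding dH_def by (intro cut3_cong hom_on_ksgn[OF ad] *)
  finally show "T (dH H \<phi> x hs) = \<dots>" .
qed

lemma dT_apply:
  assumes A: "dg_algebra A" and H: "ainf_algebra H" and f: "ainf_morphism H (ainf_of A) f"
    and X: "amodule l H e X" and ad: "hom_on S T"
    and \<phi>: "\<And>y ws b. y \<in> hel X \<Longrightarrow> set ws \<subseteq> hel H \<Longrightarrow> b \<in> hel A \<Longrightarrow> length ws \<le> length hs \<Longrightarrow>
      total_deg y ws b = total_deg x hs a - 1 \<Longrightarrow> \<phi> y ws b \<in> S"
    and x: "x \<in> hel X" and hs: "set hs \<subseteq> hel H" "enat (length hs) < l" and a: "a \<in> hel A"
  shows "dT H A f X \<phi> x hs a \<in> S" (is ?closed)
    and "T (dT H A f X \<phi> x hs a) = dT H A f X (\<lambda>x hs a. T (\<phi> x hs a)) x hs a" (is ?apply)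
proof -
  let ?p = "pull (- 1) (mX X) (\<lambda>x hs. \<phi> x hs a) x hs"
  let ?h = "dH H (\<lambda>x hs. \<phi> x hs a) x hs"
  have p: "?p \<in> S" "T ?p = pull (- 1) (mX X) (\<lambda>x hs. T (\<phi> x hs a)) x hs"
    by (rule pull_apply[where H = H and Y = X and l = l, OF ad];
        use amoduleD(4)[OF X x] \<phi> a hs in simp)+
  have h: "?h \<in> S" "T ?h = dH H (\<lambda>x hs. T (\<phi> x hs a)) x hs"
    by (rule dH_apply[OF ad H]; use \<phi> a x hs in simp)+
  have *: "\<phi> x u (dl v + len v + fst a - 1, mA A f v a) \<in> S" if "u @ v = hs" for u v
  proof (rule \<phi>[OF x])
    show "(dl v + len v + fst a - 1, mA A f v a) \<in> hel A"
      using mA_mem[OF A f _ a, of v] that hs by (auto simp: hel_def)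
  qed (use that hs in auto)
  have c: "dA A f \<phi> x hs a \<in> S" unfolding dA_def
    by (intro hom_on_cut2_closed[OF ad] hom_on_closed(3)[OF ad] *)
  have "T (dA A f \<phi> x hs a) = cut2 (\<lambda>u v. T (ksgn ((len v + 1) * (fst x + dl u) + len u + len v)
     (\<phi> x u (dl v + len v + fst a - 1, mA A f v a)))) hs"
    unfolding dA_def by (intro hom_on_cut2[OF ad] hom_on_closed(3)[OF ad] *)
  also have "\<dots> = dA A f (\<lambda>x hs a. T (\<phi> x hs a)) x hs a"
    unfolding dA_def by (intro cut2_cong hom_on_ksgn[OF ad] *)
  finally have c': "T (dA A f \<phi> x hs a) = \<dots>" .
  show ?closed unfolding dT_def dX_def using p h c by (intro hom_on_closed(4)[OF ad])
  show ?apply unfolding dT_def dX_def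
    using p h c c' by (simp add: hom_on_add[OF ad] hom_on_closed(4)[OF ad])
qed

lemma pull_cong_valid:
  assumes g: "\<And>u. set u \<subseteq> hel H \<Longrightarrow> enat (length u) < l \<Longrightarrow>
      g x u \<in> hcomp Y (fst x + dl u + len u + \<delta>)"
    and \<phi>: "\<And>y ws. y \<in> hel Y \<Longrightarrow> set ws \<subseteq> hel H \<Longrightarrow> length ws \<le> length hs \<Longrightarrow> \<phi> y ws = \<psi> y ws"
    and hs: "set hs \<subseteq> hel H" "enat (length hs) < l"
  shows "pull \<delta> g \<phi> x hs = pull \<delta> g \<psi> x hs"
proof (rule pull_cong)
  fix u v assume uv: "u @ v = hs"
  have "enat (length u) < l" using uv by (auto intro: enat_le_less[OF hs(2)])
  then have "(fst x + dl u + len u + \<delta>, g x u) \<in> hel Y"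
    using g[of u] uv hs by (auto simp: hel_def)
  then show "\<phi> (fst x + dl u + len u + \<delta>, g x u) v = \<psi> (fst x + dl u + len u + \<delta>, g x u) v"
    using uv hs by (intro \<phi>) auto
qed simp

text \<open>Used to rewrite the inner function under \<open>dT\<close> by formulas that are
  available only up to a given number of letters; words reached from \<open>hs\<close> stay within
  it.\<close>

lemma dT_cong:
  assumes A: "dg_algebra A" and H: "ainf_algebra H" and f: "ainf_morphism H (ainf_of A) f"
    and X: "amodule l H e X"
    and \<phi>: "\<And>y ws b. y \<in> hel X \<Longrightarrow> set ws \<subseteq> hel H \<Longrightarrow> b \<in> hel A \<Longrightarrow> length ws \<le> length hs \<Longrightarrow>
      \<phi> y ws b = \<psi> y ws b"
    and x: "x \<in> hel X" and hs: "set hs \<subseteq> hel H" "enat (length hs) < l" and a: "a \<in> hel A"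
  shows "dT H A f X \<phi> x hs a = dT H A f X \<psi> x hs a"
proof -
  have "pull (- 1) (mX X) (\<lambda>x hs. \<phi> x hs a) x hs = pull (- 1) (mX X) (\<lambda>x hs. \<psi> x hs a) x hs"
    by (rule pull_cong_valid[where H = H and Y = X and l = l];
        use amoduleD(4)[OF X x] \<phi> a hs in simp)
  moreover have "dH H (\<lambda>x hs. \<phi> x hs a) x hs = dH H (\<lambda>x hs. \<psi> x hs a) x hs"
    unfolding dH_def
    by (intro cut3_cong arg_cong[where f = "ksgn _"] \<phi> x a insert_hz[OF H _ _ hs(1)])
  moreover have "dA A f \<phi> x hs a = dA A f \<psi> x hs a" unfolding dA_def
  proof (intro cut2_cong arg_cong[where f = "ksgn _"] \<phi> x)
    fix u v assume uv: "u @ v = hs"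
    then show "(dl v + len v + fst a - 1, mA A f v a) \<in> hel A"
      using mA_mem[OF A f _ a, of v] hs by (auto simp: hel_def)
  qed (use hs in auto)
  ultimately show ?thesis by (simp add: dT_def dX_def)
qed

section \<open>The bar construction on words\<close>

definition nscale :: "'k::field \<Rightarrow> (nat \<Rightarrow> ('k, 'x, 'h, 'a) tensor) \<Rightarrow> nat \<Rightarrow> ('k, 'x, 'h, 'a) tensor" where
  "nscale c u = (\<lambda>l. tscale c (u l))"

lemma vector_space_nscale: "vector_space nscale"
  by unfold_locales (auto simp: nscale_def tscale_def fun_eq_iff algebra_simps)

text \<open>
  The sign \<open>(-1)\<close> to the power \<open>\<lfloor>(i + 1) / 2\<rfloor>\<close> in front of \<open>R\<^sub>i\<close> turns the signs with floors of the
  bar construction into those of \<open>pull\<close>, \<open>dX\<close> and \<open>dA\<close>: it is compatible because \<open>\<lfloor>(p + t + 1) / 2\<rfloor>\<close>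
  and \<open>\<lfloor>(p + 1) / 2\<rfloor> + \<lfloor>(t + 1) / 2\<rfloor> + p t\<close> have the same parity.
\<close>

definition bar_word :: "('k::field, 'x::ab_group_add, 'z1) gmod_scheme \<Rightarrow>
    ('k, 'h::ab_group_add, 'z2) gmod_scheme \<Rightarrow> ('k, 'a::ab_group_add, 'z3) gmod_scheme \<Rightarrow>
    int \<times> 'x \<Rightarrow> (int \<times> 'h) list \<Rightarrow> int \<times> 'a \<Rightarrow> nat \<Rightarrow> ('k, 'x, 'h, 'a) tensor" where
  "bar_word X H A x hs a = (\<lambda>l. if l = length hs
     then ksgn (int ((length hs + 1) div 2)) (pure_tensor X H A (x, hs, a)) else 0)"

section \<open>Multilinearity and the evaluation of linear extensions on words\<close>

lemma mlinXA_pure_tensor: "mlinXA l X H A tscale (\<lambda>x hs a. pure_tensor X H A (x, hs, a))"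
  using mlin3_pure_tensor[of X H A] unfolding mlin3_def mlinXA_def mlinX_def mlin_def by simp

lemma hlin_single:
  assumes "hlin V tscale F"
  shows "hlin V nscale (\<lambda>x l. if l = i then ksgn e (F x) else 0)"
  using hlin_ksgn[OF vector_space_tscale assms, of "\<lambda>_. e"]
  unfolding hlin_def nscale_def by (auto simp: fun_eq_iff tscale_def)

lemma mlinXA_bar_word: "mlinXA l X H A nscale (bar_word X H A)"
proof -
  note P = mlinXA_pure_tensor[of l X H A]
  have "mlinX l X H nscale (\<lambda>x hs. bar_word X H A x hs a)" if "a \<in> hel A" for a
  proof (rule mlinXI)
    fix hs assume "set hs \<subseteq> hel H" "enat (length hs) < l"
    then show "hlin X nscale (\<lambda>x. bar_word X H A x hs a)"
      unfolding bar_word_def by (intro hlin_single mlinXD(1)[OF mlinXAD(1)[OF P that]])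
  next
    fix x us vs assume "x \<in> hel X" "set us \<subseteq> hel H" "set vs \<subseteq> hel H" "enat (length (us @ vs) + 1) < l"
    then have "hlin H tscale (\<lambda>h. pure_tensor X H A (x, us @ h # vs, a))"
      by (rule mlinXD(2)[OF mlinXAD(1)[OF P that]])
    note hlin_single[OF this, of "Suc (length us + length vs)" "int ((Suc (length us + length vs) + 1) div 2)"]
    then show "hlin H nscale (\<lambda>h. bar_word X H A x (us @ h # vs) a)"
      by (simp add: bar_word_def cong: if_cong)
  qed
  then show ?thesis unfolding mlinXA_def bar_word_def[abs_def]
    by (auto intro!: hlin_single mlinXAD(2)[OF P])
qed

lemma mlinXA_component:
  assumes "mlinXA l X H A nscale \<phi>"
  shows "mlinXA l X H A tscale (\<lambda>x hs a. \<phi> x hs a p)"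
  using assms unfolding mlinXA_def mlinX_def mlin_def hlin_def nscale_def by simp

lemma mlinXA_ksgn:
  assumes s: "vector_space s" and \<phi>: "mlinXA l X H A s \<phi>"
  shows "mlinXA l X H A s (\<lambda>x hs a. ksgn e (\<phi> x hs a))"
proof -
  note * = hlin_ksgn[OF s, where e = "\<lambda>_. e"]
  have "mlinX l X H s (\<lambda>x hs. ksgn e (\<phi> x hs a))" if "a \<in> hel A" for a
    by (rule mlinXI; rule *; rule mlinXD[OF mlinXAD(1)[OF \<phi> that]])
  moreover have "hlin A s (\<lambda>a. ksgn e (\<phi> x hs a))"
    if "x \<in> hel X" "set hs \<subseteq> hel H" "enat (length hs) < l" for x hs
    by (rule *[OF mlinXAD(2)[OF \<phi> that]])
  ultimately show ?thesis unfolding mlinXA_def by simp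
qed

text \<open>Multilinearity constrains each length separately, so a family may be set to 0 off one
  length; this removes the bound \<open>l\<close>.\<close>

lemma mlin3_restrict:
  assumes s: "vector_space s" and \<phi>: "mlinXA l X H A s \<phi>" and i: "enat i < l"
  shows "mlin3 X H A s (\<lambda>w. if wlen w = i then \<phi> (fst w) (fst (snd w)) (snd (snd w)) else 0)"
  unfolding mlin3_def
proof (intro conjI ballI allI impI)
  fix a assume "a \<in> hel A"
  note P = mlinXAD(1)[OF \<phi> this]
  show "mlinX \<infinity> X H s (\<lambda>x hs. if wlen (x, hs, a) = i
      then \<phi> (fst (x, hs, a)) (fst (snd (x, hs, a))) (snd (snd (x, hs, a))) else 0)"
  proof (rule mlinXI)
    fix hs assume "set hs \<subseteq> hel H"
    then show "hlin X s (\<lambda>x. if wlen (x, hs, a) = i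
        then \<phi> (fst (x, hs, a)) (fst (snd (x, hs, a))) (snd (snd (x, hs, a))) else 0)"
      using mlinXD(1)[OF P, of hs] i hlin_zero[OF s, of X]
      by (cases "length hs = i") (simp_all add: wlen_def)
  next
    fix x us vs assume "x \<in> hel X" "set us \<subseteq> hel H" "set vs \<subseteq> hel H"
    then show "hlin H s (\<lambda>h. if wlen (x, us @ h # vs, a) = i
        then \<phi> (fst (x, us @ h # vs, a)) (fst (snd (x, us @ h # vs, a))) (snd (snd (x, us @ h # vs, a))) else 0)"
      using mlinXD(2)[OF P, of x us vs] i hlin_zero[OF s, of H]
      by (cases "Suc (length us + length vs) = i") (simp_all add: wlen_def cong: if_cong)
  qed
next
  fix x hs assume "x \<in> hel X" "set hs \<subseteq> hel H"
  then show "hlin A s (\<lambda>a. if wlen (x, hs, a) = i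
      then \<phi> (fst (x, hs, a)) (fst (snd (x, hs, a))) (snd (snd (x, hs, a))) else 0)"
    using mlinXAD(2)[OF \<phi>, of x hs] i hlin_zero[OF s, of A]
    by (cases "length hs = i") (simp_all add: wlen_def)
qed

text \<open>\<open>tlift\<close> evaluates \<open>F\<close> on words of one length only, so it is
  enough that \<open>F\<close> agrees there with a family known to be multilinear.\<close>

lemma tlift_word:
  assumes \<phi>: "mlinXA l X H A tscale \<phi>" and l: "enat (length hs) < l"
    and F: "\<And>x ws a. length ws = length hs \<Longrightarrow> F (x, ws, a) = \<phi> x ws a"
  shows "tlift (length hs) F (pure_tensor X H A (x, hs, a)) = F (x, hs, a)"
proof (rule tlift_pure)
  have "(\<lambda>w. if wlen w = length hs then F w else 0) =
      (\<lambda>w. if wlen w = length hs then \<phi> (fst w) (fst (snd w)) (snd (snd w)) else 0)"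
    using F by (auto simp: wlen_def fun_eq_iff)
  then show "mlin3 X H A tscale (\<lambda>w. if wlen w = length hs then F w else 0)"
    using mlin3_restrict[OF vector_space_tscale \<phi> l] by simp
qed (simp add: wlen_def)

lemma tlift_zero: "tlift i F 0 = 0"
  by (simp add: tlift_def fun_eq_iff)

lemma tlift_minus: "tlift i F (- t) = - tlift i F t"
  by (simp add: tlift_def fun_eq_iff)

lemma tlift_ksgn: "tlift i F (ksgn e t) = ksgn e (tlift i F t)"
  by (simp add: ksgn_def tlift_minus)

section \<open>Reading off one component of a sum over splittings\<close>

lemma ksgn_apply: "ksgn e u p = ksgn e (u p)"
  by (simp add: ksgn_def)

lemma cut2_apply: "cut2 F w p = cut2 (\<lambda>u v. F u v p) w"
  by (induction w arbitrary: F) auto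

lemma cut3_apply: "cut3 F w p = cut3 (\<lambda>u m v. F u m v p) w"
  unfolding cut3_def cut2_apply by (intro cut2_cong) auto

lemma cut2_length:
  assumes "i \<le> length w"
  shows "cut2 (\<lambda>u v. if length u = i then F u v else 0) w = F (take i w) (drop i w)"
proof -
  have "cut2 (\<lambda>u v. if length u = i then F u v else 0) w =
      (\<Sum>j\<le>length w. if j = i then F (take i w) (drop i w) else 0)"
    unfolding cut2_eq_sum by (intro sum.cong) auto
  then show ?thesis using assms by simp
qed

text \<open>A block of length \<open>t + 1\<close> in a word of length \<open>p + t\<close> can
  start at exactly the positions \<open>r < p\<close>.\<close>

lemma cut3_length:
  assumes "p + t = length w"
  shows "cut3 (\<lambda>u m v. if length m = Suc t then F u m v else 0) w =
    (\<Sum>r<p. F (take r w) (take (Suc t) (drop r w)) (drop (r + Suc t) w))"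
proof -
  have "cut3 (\<lambda>u m v. if length m = Suc t then F u m v else 0) w =
      (\<Sum>r\<le>length w. if r < p then F (take r w) (take (Suc t) (drop r w)) (drop (r + Suc t) w) else 0)"
    unfolding cut3_def cut2_eq_sum[of _ w]
  proof (rule sum.cong)
    fix r assume r: "r \<in> {..length w}"
    have *: "cut2 (\<lambda>m v. if m = [] then 0 else if length m = Suc t then F (take r w) m v else 0) (drop r w) =
      cut2 (\<lambda>m v. if length m = Suc t then F (take r w) m v else 0) (drop r w)"
      by (rule cut2_cong) auto
    show "cut2 (\<lambda>m v. if m = [] then 0 else if length m = Suc t then F (take r w) m v else 0) (drop r w) =
      (if r < p then F (take r w) (take (Suc t) (drop r w)) (drop (r + Suc t) w) else 0)"
    proof (cases "r < p")
      case True
      then have "Suc t \<le> length (drop r w)" using assms by auto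
      from cut2_length[OF this, of "F (take r w)"] show ?thesis
        unfolding * using True by (simp add: add.commute)
    next
      case False
      then have "length w - r < Suc t" using assms by auto
      then have "cut2 (\<lambda>m v. if length m = Suc t then F (take r w) m v else 0) (drop r w) = cut2 (\<lambda>m v. 0) (drop r w)"
        by (intro cut2_cong) (metis length_append length_drop less_irrefl not_add_less1)
      then show ?thesis unfolding * using False by (simp add: cut2_zero)
    qed
  qed simp
  also have "\<dots> = (\<Sum>r<p. F (take r w) (take (Suc t) (drop r w)) (drop (r + Suc t) w))"
    using assms by (intro sum.mono_neutral_cong_right) auto
  finally show ?thesis .
qed

lemma parityD:
  assumes "even e \<longleftrightarrow> even e'"
  shows "(of_int e :: bit) = of_int e'"
proof -
  have "even (of_int e :: bit) \<longleftrightarrow> even (of_int e' :: bit)"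
    using assms by (simp only: even_of_int_iff)
  then show ?thesis by (cases "of_int e :: bit"; cases "of_int e' :: bit"; simp)
qed

text \<open>A check of the four parities of \<open>p\<close> and \<open>t\<close>. The floor of (t +
  1) / 2 appears as \<open>t div 2 + t\<close>, which has the same parity, because the exponent in
  the bar differential is given with \<open>t div 2\<close>.\<close>

lemma eps_parity:
  "(of_int (int ((p + t + 1) div 2)) :: bit) =
   of_int (int ((p + 1) div 2) + int (t div 2) + int t + int p * int t)"
proof (rule parityD)
  obtain i j where "p = 2 * i \<or> p = 2 * i + 1" "t = 2 * j \<or> t = 2 * j + 1"
    by (metis evenE oddE)
  moreover have "(2 * i + 2 * j + 1) div 2 = i + j" "(2 * i + (2 * j + 1) + 1) div 2 = i + j + 1"
    "(2 * i + 1 + 2 * j + 1) div 2 = i + j + 1" "(2 * i + 1 + (2 * j + 1) + 1) div 2 = i + j + 1"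
    "(2 * i + 1) div 2 = i" "(2 * i + 1 + 1) div 2 = i + 1" "(2 * j) div 2 = j" "(2 * j + 1) div 2 = j"
    by presburger+
  ultimately show "even (int ((p + t + 1) div 2)) \<longleftrightarrow>
      even (int ((p + 1) div 2) + int (t div 2) + int t + int p * int t)"
    by (elim disjE; simp only:; simp; blast?)
qed

text \<open>The target length \<open>p\<close> selects the operations with \<open>t + 1\<close>
  inputs. Among them \<open>r = 0\<close> is the one of the module, \<open>1 \<le> r \<le> p\<close>
  are those of \<open>H\<close>, and \<open>r = p + 1\<close> is the one ending in \<open>A\<close>.
  The sign on the right is that of the matrix entry times the rescaling of the source.\<close>

lemma bar_M_word:
  assumes pt: "p + t = length hs"
  shows "(\<Sum>r = 0..length hs + 2 - Suc t. ksgn (int (r * (Suc t - 1))) (bar_term H A f X (Suc t) r (x, hs, a))) =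
    ksgn (int (length hs + t div 2) + int ((length hs + 1) div 2)) (dT H A f X (bar_word X H A) x hs a p)"
proof -
  let ?pull = "pull (- 1) (mX X) (\<lambda>x hs. bar_word X H A x hs a) x hs p"
  let ?dH = "dH H (\<lambda>x hs. bar_word X H A x hs a) x hs p"
  let ?dA = "dA A f (bar_word X H A) x hs a p"
  \<comment> \<open>The floors are named so that parity simplification treats them as atoms; the
    fact \<open>E\<close> below is the relation between them that is used.\<close>
  define E where "E = int ((length hs + 1) div 2)"
  define e where "e = int ((p + 1) div 2)"
  define d where "d = int (t div 2)"
  have E: "(of_int E :: bit) = of_int (e + d + int t + int p * int t)"
    unfolding E_def e_def d_def pt[symmetric] by (rule eps_parity)
  let ?s = "int p + int t + d + E"
  let ?G = "\<lambda>r. ksgn (int (r * t)) (bar_term H A f X (Suc t) r (x, hs, a))"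
  let ?P = "pure_tensor X H A"
  have t: "t \<le> length hs" "p \<le> length hs" using pt by auto
  have "?pull =
      cut2 (\<lambda>u v. if length u = t then ksgn ((int t + - 1) * int p + e)
        (?P ((fst x + dl u + int t + - 1, mX X x u), v, a)) else 0) hs"
    unfolding pull_def cut2_apply[where p = p]
  proof (rule cut2_cong)
    fix u v assume "u @ v = hs"
    then have "length u + length v = p + t" using pt by auto
    then have "length v = p \<longleftrightarrow> length u = t" by auto
    then show "ksgn ((len u + - 1) * len v) (bar_word X H A (fst x + dl u + len u + - 1, mX X x u) v a) p =
       (if length u = t then ksgn ((int t + - 1) * int p + e)
        (?P ((fst x + dl u + int t + - 1, mX X x u), v, a)) else 0)"
      by (auto simp: ksgn_apply bar_word_def e_def)
  qed
  also have "\<dots> = ksgn ((int t + - 1) * int p + e)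
        (?P ((fst x + dl (take t hs) + int t + - 1, mX X x (take t hs)), drop t hs, a))"
    by (rule cut2_length[OF t(1)])
  finally have X0: "?pull = \<dots>" .
  have X: "ksgn ?s ?pull = ?G 0"
  proof -
    have "?G 0 = ksgn 0 (?P ((fst x + dl (take t hs) + int t + - 1, mX X x (take t hs)), drop t hs, a))"
      using t by (simp add: bar_term_def appX_def algebra_simps)
    then show ?thesis unfolding X0 ksgn_simps(4)
      by (simp only:) (intro ksgn_parity, simp only: parity_simps E)
  qed
  let ?F = "\<lambda>u m v. ksgn (len u + 1 + int (Suc t) * (int p - 1 - len u) + int (Suc t) * (fst x + dl u) + e)
    (?P (x, u @ hz H m # v, a))"
  have "?dH = cut3 (\<lambda>u m v. if length m = Suc t then ?F u m v else 0) hs"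
    unfolding dH_def cut3_apply[where p = p]
  proof (rule cut3_cong)
    fix u m v assume "u @ m @ v = hs"
    then have l: "length u + length m + length v = p + t" using pt by auto
    show "ksgn (len u + 1 + len m * len v + len m * (fst x + dl u))
        (bar_word X H A x (u @ hz H m # v) a) p = (if length m = Suc t then ?F u m v else 0)"
    proof (cases "length m = Suc t")
      case True
      then have v: "len v = int p - 1 - len u" and L: "length (u @ hz H m # v) = p" using l by auto
      have "bar_word X H A x (u @ hz H m # v) a p = ksgn e (?P (x, u @ hz H m # v, a))"
        unfolding bar_word_def e_def L by simp
      then show ?thesis by (simp only: ksgn_apply[where p = p] ksgn_simps(4) True simp_thms if_True v)
    next
      case False
      then have "p \<noteq> length (u @ hz H m # v)" using l by auto
      then show ?thesis using False by (simp only: ksgn_apply[where p = p] bar_word_def if_False ksgn_simps)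
    qed
  qed
  also have "\<dots> = (\<Sum>r<p. ?F (take r hs) (take (Suc t) (drop r hs)) (drop (r + Suc t) hs))"
    by (rule cut3_length[OF pt])
  finally have "ksgn ?s ?dH =
    ksgn ?s (\<Sum>r<p. ?F (take r hs) (take (Suc t) (drop r hs)) (drop (r + Suc t) hs))" by simp
  also have "\<dots> = (\<Sum>r<p. ksgn ?s (?F (take r hs) (take (Suc t) (drop r hs)) (drop (r + Suc t) hs)))"
    by (simp add: ksgn_def sum_negf)
  also have "\<dots> = (\<Sum>r<p. ?G (Suc r))"
  proof (rule sum.cong)
    fix r assume "r \<in> {..<p}"
    then have r: "r + Suc t \<le> length hs" using pt by auto
    have "bar_term H A f X (Suc t) (Suc r) (x, hs, a) = ksgn ((int (Suc t) - 2) * (fst x + dl (take r hs)))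
        (?P (x, take r hs @ hz H (take (Suc t) (drop r hs)) # drop (r + Suc t) hs, a))"
      using r by (simp add: bar_term_def appX_def insR_def hz_def min_absorb2)
    moreover have "len (take r hs) = int r" using r by simp
    ultimately show "ksgn ?s (?F (take r hs) (take (Suc t) (drop r hs)) (drop (r + Suc t) hs)) = ?G (Suc r)"
      unfolding ksgn_simps(4) by (simp only: ksgn_simps(4)) (intro ksgn_parity, simp only: parity_simps E of_nat_mult)
  qed simp
  finally have H: "ksgn ?s ?dH = (\<Sum>r<p. ?G (Suc r))" .
  have "?dA = cut2 (\<lambda>u v. if length u = p then
      ksgn ((int t + 1) * (fst x + dl u) + int p + int t + e)
        (?P (x, u, (dl v + int t + fst a - 1, mA A f v a))) else 0) hs"
    unfolding dA_def cut2_apply[where p = p]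
  proof (rule cut2_cong)
    fix u v assume "u @ v = hs"
    then have "length u + length v = p + t" using pt by auto
    then have "length v = t" if "length u = p" using that by auto
    then show "ksgn ((len v + 1) * (fst x + dl u) + len u + len v)
        (bar_word X H A x u (dl v + len v + fst a - 1, mA A f v a)) p =
      (if length u = p then ksgn ((int t + 1) * (fst x + dl u) + int p + int t + e)
        (?P (x, u, (dl v + int t + fst a - 1, mA A f v a))) else 0)"
      by (auto simp: ksgn_apply bar_word_def e_def)
  qed
  also have "\<dots> = ksgn ((int t + 1) * (fst x + dl (take p hs)) + int p + int t + e)
        (?P (x, take p hs, (dl (drop p hs) + int t + fst a - 1, mA A f (drop p hs) a)))"
    by (rule cut2_length[OF t(2)])
  finally have A0: "?dA = \<dots>" .
  have A: "ksgn ?s ?dA = ?G (Suc p)"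
  proof -
    have "bar_term H A f X (Suc t) (Suc p) (x, hs, a) = ksgn ((int (Suc t) - 2) * (fst x + dl (take p hs)))
       (?P (x, take p hs, (dl (drop p hs) + int t + fst a - 1, mA A f (drop p hs) a)))"
      using pt by (simp add: bar_term_def add_ac)
    then show ?thesis unfolding A0
      by (simp only: ksgn_simps(4)) (intro ksgn_parity, simp only: parity_simps E of_nat_mult)
  qed
  have "(\<Sum>r = 0..length hs + 2 - Suc t. ksgn (int (r * (Suc t - 1))) (bar_term H A f X (Suc t) r (x, hs, a))) =
     (\<Sum>r\<le>Suc p. ?G r)"
    using pt by (intro sum.cong) auto
  also have "\<dots> = (\<Sum>r<Suc p. ?G r) + ?G (Suc p)"
    unfolding lessThan_Suc_atMost[symmetric] by (rule sum.lessThan_Suc)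
  also have "\<dots> = ?G 0 + (\<Sum>r<p. ?G (Suc r)) + ?G (Suc p)"
    by (rule arg_cong2[where f = "(+)", OF sum.lessThan_Suc_shift refl])
  also have "\<dots> = ksgn ?s (dT H A f X (bar_word X H A) x hs a p)"
    unfolding X[symmetric] H[symmetric] A[symmetric] dT_def dX_def by simp
  also have "?s = int (length hs + t div 2) + int ((length hs + 1) div 2)"
    unfolding pt[symmetric] d_def E_def by simp
  finally show ?thesis .
qed

section \<open>Upper triangular matrices of maps between tensor products\<close>

definition bar_entry :: "('k::field, 'h::ab_group_add) ainf \<Rightarrow> ('k, 'a::ab_group_add) dga \<Rightarrow>
    ((int \<times> 'h) list \<Rightarrow> 'a) \<Rightarrow> ('k, 'x::ab_group_add, 'h) amod \<Rightarrow> nat \<Rightarrow> nat \<Rightarrow>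
    ('k, 'x, 'h, 'a) tensor \<Rightarrow> ('k, 'x, 'h, 'a) tensor" where
  "bar_entry H A f X l p t = ksgn (int (l + (l - p) div 2)) (bar_M H A f X l (l - p + 1) t)"

text \<open>The sum runs over the support of \<open>u\<close> and not up to \<open>n\<close>, since
  \<open>n\<close> may be infinite; elements of the bar construction have finite support.\<close>

definition upper :: "(nat \<Rightarrow> nat \<Rightarrow> ('k::field, 'x, 'h, 'a) tensor \<Rightarrow> ('k, 'y, 'h, 'a) tensor) \<Rightarrow>
    (nat \<Rightarrow> ('k, 'x, 'h, 'a) tensor) \<Rightarrow> nat \<Rightarrow> ('k, 'y, 'h, 'a) tensor" where
  "upper E u p = (\<Sum>l\<in>{l. p \<le> l \<and> u l \<noteq> 0}. E l p (u l))"

lemma tscale_sum: "tscale c (\<Sum>x\<in>S. g x) = (\<Sum>x\<in>S. tscale c (g x))"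
  by (induction S rule: infinite_finite_induct) (auto simp: tscale_def fun_eq_iff algebra_simps)

lemma tscale_zero: "tscale c 0 = 0"
  by (simp add: tscale_def fun_eq_iff)

lemma ksgn_tscale: "ksgn e (tscale c t) = tscale c (ksgn e t)"
  by (simp add: ksgn_def tscale_def fun_eq_iff)

lemma upper_eq_sum:
  assumes "finite S" "\<And>l. l \<notin> S \<Longrightarrow> u l = 0" "\<And>l. E l p 0 = 0"
  shows "upper E u p = (\<Sum>l\<in>{l \<in> S. p \<le> l}. E l p (u l))"
  unfolding upper_def using assms by (intro sum.mono_neutral_left) auto

lemma upper_add:
  assumes E: "\<And>l p t t'. E l p (t + t') = E l p t + E l p t'"
    and u: "finite {l. u l \<noteq> 0}" and v: "finite {l. v l \<noteq> 0}"
  shows "upper E (u + v) = upper E u + upper E v"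
proof
  fix p
  \<comment> \<open>Entries of \<open>u + v\<close> may cancel, so its support need not be the
    union; all three sums are taken over one common finite set.\<close>
  let ?S = "{l. u l \<noteq> 0} \<union> {l. v l \<noteq> 0}"
  have "finite ?S" using u v by simp
  moreover have E0: "E l p 0 = 0" for l p using E[of l p 0 0] by simp
  ultimately have D: "upper E w p = (\<Sum>l\<in>{l \<in> ?S. p \<le> l}. E l p (w l))"
    if "\<And>l. l \<notin> ?S \<Longrightarrow> w l = 0" for w
    using that by (intro upper_eq_sum)
  have "upper E (u + v) p = (\<Sum>l\<in>{l \<in> ?S. p \<le> l}. E l p ((u + v) l))"
    by (rule D) simp
  also have "\<dots> = (\<Sum>l\<in>{l \<in> ?S. p \<le> l}. E l p (u l)) + (\<Sum>l\<in>{l \<in> ?S. p \<le> l}. E l p (v l))"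
    by (simp only: plus_fun_apply[of u v] E sum.distrib)
  also have "(\<Sum>l\<in>{l \<in> ?S. p \<le> l}. E l p (u l)) = upper E u p"
    by (rule D[symmetric]) simp
  also have "(\<Sum>l\<in>{l \<in> ?S. p \<le> l}. E l p (v l)) = upper E v p"
    by (rule D[symmetric]) simp
  finally show "upper E (u + v) p = (upper E u + upper E v) p"
    unfolding plus_fun_apply[of "upper E u" "upper E v" p] .
qed

lemma upper_nscale:
  assumes E: "\<And>l p c t. E l p (tscale c t) = tscale c (E l p t)"
    and u: "finite {l. u l \<noteq> 0}"
  shows "upper E (nscale c u) = nscale c (upper E u)"
proof
  fix p
  have E0: "E l p 0 = 0" for l
    using E[of l p 0 0] by (simp add: tscale_def zero_fun_def)
  have "upper E (nscale c u) p = (\<Sum>l\<in>{l \<in> {l. u l \<noteq> 0}. p \<le> l}. E l p (nscale c u l))"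
    by (rule upper_eq_sum[where E = E, OF u]) (simp_all add: nscale_def tscale_zero E0)
  also have "\<dots> = tscale c (\<Sum>l\<in>{l \<in> {l. u l \<noteq> 0}. p \<le> l}. E l p (u l))"
    unfolding nscale_def E tscale_sum ..
  also have "(\<Sum>l\<in>{l \<in> {l. u l \<noteq> 0}. p \<le> l}. E l p (u l)) = upper E u p"
    by (rule upper_eq_sum[where E = E, OF u, symmetric]) (simp_all add: E0)
  finally show "upper E (nscale c u) p = nscale c (upper E u) p"
    unfolding nscale_def .
qed

lemma upper_word:
  assumes "\<And>l p. E l p 0 = 0"
  shows "upper E (bar_word X H A x hs a) p = (if p \<le> length hs
    then E (length hs) p (ksgn (int ((length hs + 1) div 2)) (pure_tensor X H A (x, hs, a))) else 0)"
proof -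
  have "upper E (bar_word X H A x hs a) p =
      (\<Sum>l\<in>{l \<in> {length hs}. p \<le> l}. E l p (bar_word X H A x hs a l))"
    by (rule upper_eq_sum[where E = E]) (auto simp: bar_word_def assms)
  moreover have "{l \<in> {length hs}. p \<le> l} = (if p \<le> length hs then {length hs} else {})" by auto
  ultimately show ?thesis by (simp add: bar_word_def)
qed

lemma bar_dif_upper: "bar_dif H A f X = upper (bar_entry H A f X)"
  by (simp add: fun_eq_iff bar_dif_def upper_def bar_entry_def Let_def)

lemma bar_entry_linear:
  "bar_entry H A f X l p (t + t') = bar_entry H A f X l p t + bar_entry H A f X l p t'"
  "bar_entry H A f X l p (tscale c t) = tscale c (bar_entry H A f X l p t)"
  "bar_entry H A f X l p 0 = 0"
  by (simp_all only: bar_entry_def bar_M_def tlift_linear tlift_zero ksgn_simps ksgn_tscale)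

text \<open>The summand inside \<open>bar_M\<close> agrees up to sign with a component of
  \<open>dT\<close>, so its multilinearity is inherited from there, and this is what permits
  evaluating its linear extension on the pure tensor.\<close>

lemma bar_dif_word:
  assumes A: "dg_algebra A" and H: "ainf_algebra H" and f: "ainf_morphism H (ainf_of A) f"
    and X: "amodule l H e X" and l: "enat (length hs) < l"
  shows "bar_dif H A f X (bar_word X H A x hs a) = dT H A f X (bar_word X H A) x hs a"
proof
  fix p
  let ?q = "length hs"
  let ?E = "\<lambda>k. int ((k + 1) div 2)"
  have "bar_dif H A f X (bar_word X H A x hs a) p = (if p \<le> ?q
      then bar_entry H A f X ?q p (ksgn (?E ?q) (pure_tensor X H A (x, hs, a))) else 0)"
    unfolding bar_dif_upper by (rule upper_word) (rule bar_entry_linear)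
  also have "\<dots> = dT H A f X (bar_word X H A) x hs a p"
  proof (cases "p \<le> ?q")
    \<comment> \<open>No operation lengthens a word, so components beyond the length of
      \<open>hs\<close> are 0 on both sides.\<close>
    case False
    have "pull (- 1) (mX X) (\<lambda>x hs. bar_word X H A x hs a) x hs p = cut2 (\<lambda>u v. 0) hs"
      unfolding pull_def cut2_apply[where p = p] using False
      by (intro cut2_cong) (auto simp: ksgn_apply bar_word_def)
    moreover have "dH H (\<lambda>x hs. bar_word X H A x hs a) x hs p = cut3 (\<lambda>u m v. 0) hs"
      unfolding dH_def cut3_apply[where p = p]
    proof (rule cut3_cong)
      fix u m v assume "u @ m @ v = hs" "m \<noteq> []"
      then have "Suc (length u + length v) \<le> ?q" by (cases m) auto
      then have "p \<noteq> length (u @ hz H m # v)" using False by auto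
      then show "ksgn (len u + 1 + len m * len v + len m * (fst x + dl u))
          (bar_word X H A x (u @ hz H m # v) a) p = 0"
        by (simp add: ksgn_apply bar_word_def)
    qed
    moreover have "dA A f (bar_word X H A) x hs a p = cut2 (\<lambda>u v. 0) hs"
      unfolding dA_def cut2_apply[where p = p] using False
      by (intro cut2_cong) (auto simp: ksgn_apply bar_word_def)
    ultimately show ?thesis
      by (simp only: False if_False dT_def dX_def cut2_zero cut3_zero plus_fun_apply add_0_left)
  next
    case True
    define t where "t = ?q - p"
    have pt: "p + t = ?q" using True by (simp add: t_def)
    let ?F = "\<lambda>w. \<Sum>r = 0..?q + 2 - Suc t. ksgn (int (r * (Suc t - 1))) (bar_term H A f X (Suc t) r w)"
    let ?c = "int (?q + t div 2) + ?E ?q"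
    have "mlinXA l X H A tscale (\<lambda>x hs a. ksgn ?c (dT H A f X (bar_word X H A) x hs a p))"
      by (intro mlinXA_ksgn[OF vector_space_tscale] mlinXA_component
          mlinXA_dT[OF vector_space_nscale A H f X mlinXA_bar_word])
    moreover have "?F (x, ws, a) = ksgn ?c (dT H A f X (bar_word X H A) x ws a p)"
      if "length ws = ?q" for x ws a
      using bar_M_word[of p t ws H A f X x a] by (simp only: that pt simp_thms)
    ultimately have "tlift ?q ?F (pure_tensor X H A (x, hs, a)) = ?F (x, hs, a)"
      by (rule tlift_word[OF _ l])
    also have "\<dots> = ksgn ?c (dT H A f X (bar_word X H A) x hs a p)"
      by (rule bar_M_word[OF pt])
    finally have *: "tlift ?q ?F (pure_tensor X H A (x, hs, a)) = \<dots>" .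
    have "(if p \<le> ?q then bar_entry H A f X ?q p (ksgn (?E ?q) (pure_tensor X H A (x, hs, a))) else 0) =
        bar_entry H A f X ?q p (ksgn (?E ?q) (pure_tensor X H A (x, hs, a)))"
      using True by simp
    also have "\<dots> = ksgn (int (?q + t div 2)) (ksgn (?E ?q) (tlift ?q ?F (pure_tensor X H A (x, hs, a))))"
      unfolding bar_entry_def bar_M_def t_def[symmetric] by (simp only: tlift_ksgn Suc_eq_plus1)
    also have "\<dots> = dT H A f X (bar_word X H A) x hs a p"
      unfolding * by (simp only: ksgn_simps) (simp add: ksgn_def)
    finally show ?thesis .
  qed
  finally show "bar_dif H A f X (bar_word X H A x hs a) p = \<dots>" .
qed

section \<open>The bar functor\<close>

lemma mlinXA_mul:
  assumes A: "dg_algebra A" and \<phi>: "mlinXA l X H A s \<phi>" and b: "b \<in> hel A"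
  shows "mlinXA l X H A s (\<lambda>x hs a. \<phi> x hs (fst a + fst b, mul A a b))"
  unfolding mlinXA_def
proof (intro conjI ballI allI impI)
  fix a assume "a \<in> hel A"
  then have "(fst a + fst b, mul A a b) \<in> hel A" using dg_algebraD(9)[OF A _ b] by (simp add: hel_def)
  then show "mlinX l X H s (\<lambda>x hs. \<phi> x hs (fst a + fst b, mul A a b))" by (rule mlinXAD(1)[OF \<phi>])
next
  fix x hs assume "x \<in> hel X" "set hs \<subseteq> hel H" "enat (length hs) < l"
  from mlinXAD(2)[OF \<phi> this] dg_algebraD(6)[OF A b] dg_algebraD(9)[OF A _ b]
  show "hlin A s (\<lambda>a. \<phi> x hs (fst a + fst b, mul A a b))"
    by (rule hlin_comp[where e = "\<lambda>d. d + fst b"])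
qed

lemma bar_act_word:
  assumes A: "dg_algebra A" and b: "b \<in> hel A"
  shows "bar_act H A X (bar_word X H A x hs a) b = bar_word X H A x hs (fst a + fst b, mul A a b)"
proof
  fix p
  show "bar_act H A X (bar_word X H A x hs a) b p = bar_word X H A x hs (fst a + fst b, mul A a b) p"
  proof (cases "p = length hs")
    case True
    have "tlift (length hs) (\<lambda>(x, hs, a). pure_tensor X H A (x, hs, (fst a + fst b, mul A a b)))
        (pure_tensor X H A (x, hs, a)) = pure_tensor X H A (x, hs, (fst a + fst b, mul A a b))"
      by (subst tlift_word[OF mlinXA_mul[OF A mlinXA_pure_tensor b], where l = \<infinity>]) simp_all
    then show ?thesis unfolding bar_act_def bar_word_def by (simp add: True tlift_ksgn)
  qed (simp add: bar_act_def bar_word_def tlift_zero)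
qed

lemma bar_act_add: "bar_act H A X (u + v) b = bar_act H A X u b + bar_act H A X v b"
proof
  fix p
  show "bar_act H A X (u + v) b p = (bar_act H A X u b + bar_act H A X v b) p"
    unfolding bar_act_def plus_fun_apply[of u v] tlift_linear
      plus_fun_apply[of "\<lambda>l. tlift l _ (u l)" "\<lambda>l. tlift l _ (v l)" p] ..
qed

lemma bar_act_nscale: "bar_act H A X (nscale c u) b = nscale c (bar_act H A X u b)"
  unfolding bar_act_def nscale_def tlift_linear ..

text \<open>The matrix of \<open>bar_mor\<close> without the cutoff to 0 outside the domain, which
  is restored only when the functor is assembled.\<close>

definition bar_map :: "('k::field, 'h::ab_group_add) ainf \<Rightarrow> ('k, 'a::ab_group_add) dga \<Rightarrow>
    ('k, 'y::ab_group_add, 'h) amod \<Rightarrow> (int \<times> 'x \<Rightarrow> (int \<times> 'h) list \<Rightarrow> 'y) \<Rightarrow>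
    (nat \<Rightarrow> ('k, 'x, 'h, 'a) tensor) \<Rightarrow> nat \<Rightarrow> ('k, 'y, 'h, 'a) tensor" where
  "bar_map H A Y g = upper (\<lambda>q p t. ksgn (int ((q - p + 1) div 2)) (bar_g H A Y g q (q - p) t))"

lemma bar_mor_eq:
  "bar_mor n H A f X Y g u = (if u \<in> hel (bar n H A f X) then bar_map H A Y g (snd u) else 0)"
  by (simp add: bar_mor_def bar_map_def upper_def fun_eq_iff)

lemma bar_g_linear:
  "ksgn e (bar_g H A Y g q k (t + t')) = ksgn e (bar_g H A Y g q k t) + ksgn e (bar_g H A Y g q k t')"
  "ksgn e (bar_g H A Y g q k (tscale c t)) = tscale c (ksgn e (bar_g H A Y g q k t))"
  "ksgn e (bar_g H A Y g q k 0) = 0"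
  by (simp_all only: bar_g_def tlift_linear tlift_zero ksgn_simps ksgn_tscale)

text \<open>To reach component \<open>p\<close>, exactly \<open>k = length hs - p\<close> letters go
  to \<open>g\<close>. The floor of the matrix entry and the two rescaling signs combine to the
  exponent \<open>k * p\<close> of \<open>pull 0\<close>.\<close>

lemma bar_map_word:
  assumes g: "mlinX l X H (smul Y) g"
    and mem: "\<And>x hs. x \<in> hel X \<Longrightarrow> set hs \<subseteq> hel H \<Longrightarrow> enat (length hs) < l \<Longrightarrow>
      g x hs \<in> hcomp Y (fst x + dl hs + len hs + 0)"
    and l: "enat (length hs) < l"
  shows "bar_map H A Y g (bar_word X H A x hs a) = pull 0 g (\<lambda>y ws. bar_word Y H A y ws a) x hs"
proof
  fix p
  let ?q = "length hs"
  let ?E = "\<lambda>k. int ((k + 1) div 2)"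
  let ?P = "pure_tensor Y H A"
  let ?R = "\<lambda>x hs a. pull 0 g (\<lambda>y ws. bar_word Y H A y ws a) x hs p"
  have "bar_map H A Y g (bar_word X H A x hs a) p = (if p \<le> ?q then
      ksgn (?E (?q - p)) (bar_g H A Y g ?q (?q - p) (ksgn (?E ?q) (pure_tensor X H A (x, hs, a)))) else 0)"
    unfolding bar_map_def by (rule upper_word) (rule bar_g_linear)
  also have "\<dots> = ?R x hs a"
  proof (cases "p \<le> ?q")
    case False
    then have "?R x hs a = cut2 (\<lambda>u v. 0) hs"
      unfolding pull_def cut2_apply[where p = p]
      by (intro cut2_cong) (auto simp: ksgn_apply bar_word_def)
    then show ?thesis using False by (simp only: if_False cut2_zero)
  next
    case True
    define k where "k = ?q - p"
    have pk: "p + k = ?q" using True by (simp add: k_def)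
    let ?F = "\<lambda>(x, hs, a). ?P ((fst x + dl (take k hs) + int k, g x (take k hs)), drop k hs, a)"
    have R: "?R x ws a = ksgn (int k * int p + ?E p) (?F (x, ws, a))" if ws: "length ws = ?q" for x ws a
    proof -
      have "?R x ws a = cut2 (\<lambda>u v. if length u = k then ksgn (int k * int p + ?E p)
          (?P ((fst x + dl u + int k, g x u), v, a)) else 0) ws"
        unfolding pull_def cut2_apply[where p = p]
      proof (rule cut2_cong)
        fix u v assume "u @ v = ws"
        then have "length u + length v = p + k" using ws pk by auto
        then have "length v = p \<longleftrightarrow> length u = k" by auto
        then show "ksgn ((len u + 0) * len v) (bar_word Y H A (fst x + dl u + len u + 0, g x u) v a) p =
           (if length u = k then ksgn (int k * int p + ?E p) (?P ((fst x + dl u + int k, g x u), v, a)) else 0)"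
          by (auto simp: ksgn_apply bar_word_def)
      qed
      also have "\<dots> = ksgn (int k * int p + ?E p) (?F (x, ws, a))"
        using pk ws by (subst cut2_length) auto
      finally show ?thesis .
    qed
    have "mlinXA l X H A tscale (\<lambda>x hs a. ksgn (int k * int p + ?E p) (?R x hs a))"
      by (intro mlinXA_ksgn[OF vector_space_tscale] mlinXA_component
          mlinXA_pull[OF vector_space_nscale mlinXA_bar_word g mem])
    moreover have "?F (x, ws, a) = ksgn (int k * int p + ?E p) (?R x ws a)" if "length ws = ?q" for x ws a
      unfolding R[OF that] by (simp only: ksgn_simps) (simp add: ksgn_def)
    ultimately have F: "tlift ?q ?F (pure_tensor X H A (x, hs, a)) = ?F (x, hs, a)"
      by (rule tlift_word[OF _ l])
    define Eq Ep Ek where "Eq = ?E ?q" "Ep = ?E p" "Ek = int (k div 2)"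
    have Eq: "(of_int Eq :: bit) = of_int (Ep + Ek + int k + int p * int k)"
      unfolding Eq_Ep_Ek_def pk[symmetric] by (rule eps_parity)
    \<comment> \<open>The case \<open>p = 0\<close> of the parity lemma rewrites the floor of (k +
      1) / 2 in terms of \<open>k div 2\<close>.\<close>
    have Ek: "(of_int (?E k) :: bit) = of_int (Ek + int k)"
      using eps_parity[of 0 k] by (simp add: Eq_Ep_Ek_def)
    have "ksgn (?E k) (bar_g H A Y g ?q k (ksgn (?E ?q) (pure_tensor X H A (x, hs, a)))) =
        ksgn (?E k + ?E ?q) (?F (x, hs, a))"
      unfolding bar_g_def tlift_ksgn F by simp
    also have "\<dots> = ?R x hs a"
      unfolding R[OF refl] Eq_Ep_Ek_def(1,2)[symmetric]
    proof (rule ksgn_parity)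
      have "(of_int (?E k + Eq) :: bit) = of_int (?E k) + of_int Eq" by simp
      also have "\<dots> = of_int (int k * int p + Ep)" unfolding Ek Eq by (simp only: parity_simps)
      finally show "(of_int (?E k + Eq) :: bit) = \<dots>" .
    qed
    finally show ?thesis using True by (simp only: if_True k_def[symmetric])
  qed
  finally show "bar_map H A Y g (bar_word X H A x hs a) p = ?R x hs a" .
qed

section \<open>The underlying graded vector space and its spanning words\<close>

lemma bar_simps:
  "smul (bar n H A f X) = nscale" "mdif (bar n H A f X) = (\<lambda>u. bar_dif H A f X (snd u))"
  "act (bar n H A f X) = (\<lambda>u. bar_act H A X (snd u))"
  by (simp_all add: bar_def nscale_def fun_eq_iff)

lemma hcomp_bar_iff:
  "u \<in> hcomp (bar n H A f X) e \<longleftrightarrow> finite {l. u l \<noteq> 0} \<and> (\<forall>l. u l \<noteq> 0 \<longrightarrow> enat l \<le> n) \<and>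
    (\<forall>l. u l \<in> tens X H A l (e - int l))"
  by (simp add: bar_def)

lemma subspace_tens:
  fixes X :: "('k::field, 'x::ab_group_add, 'z1) gmod_scheme" and
    H :: "('k, 'h::ab_group_add, 'z2) gmod_scheme" and A :: "('k, 'a::ab_group_add, 'z3) gmod_scheme"
  shows "module.subspace tscale (tens X H A l e)"
proof -
  interpret vector_space "tscale :: 'k \<Rightarrow> ('k, 'x, 'h, 'a) tensor \<Rightarrow> _" by (rule vector_space_tscale)
  show ?thesis unfolding tens_def by (rule subspace_span)
qed

lemma gmodule_bar:
  fixes X :: "('k::field, 'x::ab_group_add, 'h::ab_group_add) amod" and A :: "('k, 'a::ab_group_add) dga"
  shows "gmodule (bar n H A f X)"
  unfolding gmodule_def bar_simps
proof (intro conjI allI vector_space_nscale)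
  fix e
  interpret T: vector_space "tscale :: 'k \<Rightarrow> ('k, 'x, 'h, 'a) tensor \<Rightarrow> _" by (rule vector_space_tscale)
  interpret N: vector_space "nscale :: 'k \<Rightarrow> (nat \<Rightarrow> ('k, 'x, 'h, 'a) tensor) \<Rightarrow> _" by (rule vector_space_nscale)
  note t = subspace_tens[of X H A]
  show "N.subspace (hcomp (bar n H A f X) e)"
  proof (rule N.subspaceI)
    show "0 \<in> hcomp (bar n H A f X) e"
      unfolding hcomp_bar_iff by (auto intro: T.subspace_0[OF t])
  next
    fix u v assume u: "u \<in> hcomp (bar n H A f X) e" and v: "v \<in> hcomp (bar n H A f X) e"
    have uv: "u l \<noteq> 0 \<or> v l \<noteq> 0" if "(u + v) l \<noteq> 0" for l
      using that unfolding plus_fun_apply[of u v] by auto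
    then have "{l. (u + v) l \<noteq> 0} \<subseteq> {l. u l \<noteq> 0} \<union> {l. v l \<noteq> 0}" by auto
    then have "finite {l. (u + v) l \<noteq> 0}" using u v unfolding hcomp_bar_iff by (auto intro: finite_subset)
    moreover have "(u + v) l \<in> tens X H A l (e - int l)" for l
      using u v unfolding hcomp_bar_iff plus_fun_apply[of u v] by (auto intro: T.subspace_add[OF t])
    ultimately show "u + v \<in> hcomp (bar n H A f X) e"
      using u v uv unfolding hcomp_bar_iff by blast
  next
    fix c u assume u: "u \<in> hcomp (bar n H A f X) e"
    have nz: "u l \<noteq> 0" if "nscale c u l \<noteq> 0" for l using that by (auto simp: nscale_def)
    then have "{l. nscale c u l \<noteq> 0} \<subseteq> {l. u l \<noteq> 0}" by auto
    then have "finite {l. nscale c u l \<noteq> 0}" using u unfolding hcomp_bar_iff by (auto intro: finite_subset)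
    moreover have "nscale c u l \<in> tens X H A l (e - int l)" for l
      using u unfolding hcomp_bar_iff nscale_def by (auto intro: T.subspace_scale[OF t])
    ultimately show "nscale c u \<in> hcomp (bar n H A f X) e"
      using u nz unfolding hcomp_bar_iff by blast
  qed
qed

lemma hom_on_bar:
  assumes "\<And>x y. x \<in> hcomp (bar n H A f X) e \<Longrightarrow> y \<in> hcomp (bar n H A f X) e \<Longrightarrow> T (x + y) = T x + T y"
  shows "hom_on (hcomp (bar n H A f X) e) T"
proof -
  note * = hom_on_hlin[OF gmodule_bar hlin_zero[OF vector_space_nscale], of n H A f X e]
  show ?thesis unfolding hom_on_def using hom_on_closed[OF *] assms by auto
qed

lemma bar_word_mem:
  fixes X :: "('k::field, 'x::ab_group_add, 'h::ab_group_add) amod" and A :: "('k, 'a::ab_group_add) dga"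
  assumes "x \<in> hel X" "set hs \<subseteq> hel H" "a \<in> hel A" "enat (length hs) \<le> n" "total_deg x hs a = e"
  shows "bar_word X H A x hs a \<in> hcomp (bar n H A f X) e"
proof -
  interpret T: vector_space "tscale :: 'k \<Rightarrow> ('k, 'x, 'h, 'a) tensor \<Rightarrow> _" by (rule vector_space_tscale)
  note t = subspace_tens[of X H A]
  have "pure_tensor X H A (x, hs, a) \<in> tens X H A (length hs) (e - len hs)"
    unfolding tens_def using assms by (intro T.span_base imageI) (auto simp: hwords_def wlen_def wdeg_def)
  then have "ksgn k (pure_tensor X H A (x, hs, a)) \<in> tens X H A (length hs) (e - len hs)" for k
    by (simp add: ksgn_def T.subspace_neg[OF t])
  then show ?thesis unfolding hcomp_bar_iff
    using assms T.subspace_0[OF t] by (auto simp: bar_word_def)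
qed

lemma sum_fun_apply: "(\<Sum>l\<in>S. F l) i = (\<Sum>l\<in>S. F l i)"
  by (induction S rule: infinite_finite_induct) auto

text \<open>Each component is spanned by bar words: a finitely supported sequence is the sum of its
  entries placed in one position each, and every entry is a combination of pure tensors, which
  differ from bar words by a sign only.\<close>

lemma bar_induct [consumes 1, case_names zero add scale word]:
  fixes X :: "('k::field, 'x::ab_group_add, 'h::ab_group_add) amod" and A :: "('k, 'a::ab_group_add) dga"
  assumes u: "u \<in> hcomp (bar n H A f X) e"
    and zero: "P 0"
    and add: "\<And>u v. u \<in> hcomp (bar n H A f X) e \<Longrightarrow> v \<in> hcomp (bar n H A f X) e \<Longrightarrow> P u \<Longrightarrow> P v \<Longrightarrow> P (u + v)"
    and scale: "\<And>c u. u \<in> hcomp (bar n H A f X) e \<Longrightarrow> P u \<Longrightarrow> P (nscale c u)"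
    and word: "\<And>x hs a. x \<in> hel X \<Longrightarrow> set hs \<subseteq> hel H \<Longrightarrow> a \<in> hel A \<Longrightarrow> enat (length hs) \<le> n \<Longrightarrow>
      total_deg x hs a = e \<Longrightarrow> P (bar_word X H A x hs a)"
  shows "P u"
proof -
  interpret T: vector_space "tscale :: 'k \<Rightarrow> ('k, 'x, 'h, 'a) tensor \<Rightarrow> _" by (rule vector_space_tscale)
  interpret N: vector_space "nscale :: 'k \<Rightarrow> (nat \<Rightarrow> ('k, 'x, 'h, 'a) tensor) \<Rightarrow> _" by (rule vector_space_nscale)
  let ?M = "hcomp (bar n H A f X) e"
  let ?Q = "{u \<in> ?M. P u}"
  let ?single = "\<lambda>l t i. if i = l then t else (0 :: ('k, 'x, 'h, 'a) tensor)"
  have M: "N.subspace ?M" using gmodule_bar[of n H A f X] by (simp add: gmodule_def bar_simps)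
  have Q: "N.subspace ?Q"
    by (rule N.subspaceI) (auto intro: zero add scale N.subspace_0[OF M] N.subspace_add[OF M] N.subspace_scale[OF M])
  have single: "?single l t \<in> ?Q" if "enat l \<le> n" "t \<in> tens X H A l (e - int l)" for l t
    using that(2) unfolding tens_def
  proof (rule T.span_induct)
    show "T.subspace {t. ?single l t \<in> ?Q}"
    proof (rule T.subspaceI)
      have "?single l 0 = 0" by (simp add: fun_eq_iff)
      then show "0 \<in> {t. ?single l t \<in> ?Q}" using N.subspace_0[OF Q] by (simp only: mem_Collect_eq)
    next
      fix s t assume "s \<in> {t. ?single l t \<in> ?Q}" "t \<in> {t. ?single l t \<in> ?Q}"
      moreover have "?single l (s + t) = ?single l s + ?single l t" by (simp add: fun_eq_iff)
      ultimately show "s + t \<in> {t. ?single l t \<in> ?Q}"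
        using N.subspace_add[OF Q] by (simp only: mem_Collect_eq)
    next
      fix c t assume "t \<in> {t. ?single l t \<in> ?Q}"
      moreover have "?single l (tscale c t) = nscale c (?single l t)"
        by (simp add: fun_eq_iff nscale_def tscale_def)
      ultimately show "tscale c t \<in> {t. ?single l t \<in> ?Q}"
        using N.subspace_scale[OF Q] by (simp only: mem_Collect_eq)
    qed
  next
    fix t assume "t \<in> pure_tensor X H A ` {w \<in> hwords X H A. wlen w = l \<and> wdeg w = e - int l}"
    then obtain x hs a where w: "x \<in> hel X" "set hs \<subseteq> hel H" "a \<in> hel A" "length hs = l"
      "total_deg x hs a = e" and t: "t = pure_tensor X H A (x, hs, a)"
      by (auto simp: hwords_def wlen_def wdeg_def)
    have "bar_word X H A x hs a \<in> ?Q"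
      using w that(1) by (auto intro!: word bar_word_mem)
    \<comment> \<open>The rescaling sign is its own inverse, so applying it again leaves the bare
      pure tensor.\<close>
    then have "ksgn (int ((l + 1) div 2)) (bar_word X H A x hs a) \<in> ?Q"
      unfolding ksgn_def using N.subspace_neg[OF Q] by auto
    moreover have "ksgn (int ((l + 1) div 2)) (bar_word X H A x hs a) = ?single l t"
      unfolding t w(4)[symmetric] bar_word_def by (auto simp: fun_eq_iff ksgn_def)
    ultimately show "?single l t \<in> ?Q" by (simp only:)
  qed
  let ?S = "{l. u l \<noteq> 0}"
  have fin: "finite ?S" using u by (simp add: hcomp_bar_iff)
  have "(\<Sum>l\<in>?S. ?single l (u l)) \<in> ?Q"
    using u by (intro N.subspace_sum[OF Q] single) (auto simp: hcomp_bar_iff)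
  moreover have "(\<Sum>l\<in>?S. ?single l (u l)) = u"
  proof
    fix i
    have "(\<Sum>l\<in>?S. ?single l (u l)) i = (\<Sum>l\<in>?S. ?single l (u l) i)"
      by (rule sum_fun_apply)
    also have "\<dots> = u i" using fin by (simp add: sum.delta')
    finally show "(\<Sum>l\<in>?S. ?single l (u l)) i = u i" .
  qed
  ultimately show ?thesis by simp
qed

text \<open>The module element is the first input of an operation, so words with at most
  \<open>n\<close> letters involve operations up to index \<open>n + 1\<close>. For
  \<open>n = \<infinity>\<close> both sides hold.\<close>

lemma enat_less_plus_one: "enat k < n + 1 \<longleftrightarrow> enat k \<le> n"
  by (simp add: iless_Suc_eq plus_1_eSuc)

lemma hcomp_bar_finite: "u \<in> hcomp (bar n H A f X) e \<Longrightarrow> finite {l. u l \<noteq> 0}"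
  by (simp add: hcomp_bar_iff)

lemma hcomp_bar_closed:
  assumes "u \<in> hcomp (bar n H A f X) e"
  shows "nscale c u \<in> hcomp (bar n H A f X) e"
  using assms gmodule_bar[of n H A f X] module.subspace_def vector_space_nscale
  unfolding gmodule_def bar_simps by (metis module_iff_vector_space)

text \<open>Stated on components, where supports are finite: the matrix adds over the support, and
  its additivity comes from \<open>upper_add\<close>.\<close>

lemma hom_on_bar_dif: "hom_on (hcomp (bar n H A f X) e) (bar_dif H A f X)"
  by (rule hom_on_bar) (auto simp: bar_dif_upper intro!: upper_add bar_entry_linear hcomp_bar_finite)

lemma hom_on_bar_act: "hom_on (hcomp (bar n H A f X) e) (\<lambda>u. bar_act H A X u b)"
  by (rule hom_on_bar) (rule bar_act_add)

lemma hom_on_bar_map: "hom_on (hcomp (bar n H A f X) e) (bar_map H A Y g)"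
  by (rule hom_on_bar) (auto simp: bar_map_def intro!: upper_add bar_g_linear hcomp_bar_finite)

lemma bar_map_nscale:
  assumes "u \<in> hcomp (bar n H A f X) e"
  shows "bar_map H A Y g (nscale c u) = nscale c (bar_map H A Y g u)"
  unfolding bar_map_def using assms by (intro upper_nscale bar_g_linear hcomp_bar_finite)

lemma bar_dif_nscale:
  assumes "u \<in> hcomp (bar n H A f X) e"
  shows "bar_dif H A f X (nscale c u) = nscale c (bar_dif H A f X u)"
  unfolding bar_dif_upper using assms by (intro upper_nscale bar_entry_linear hcomp_bar_finite)

lemma nscale_simps:
  fixes u :: "nat \<Rightarrow> ('k::field, 'x, 'h, 'a) tensor"
  shows "nscale c (u + v) = nscale c u + nscale c v" "nscale c (0 :: nat \<Rightarrow> ('k, 'x, 'h, 'a) tensor) = 0"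
    "nscale c (ksgn e u) = ksgn e (nscale c u)"
proof -
  interpret vector_space "nscale :: 'k \<Rightarrow> (nat \<Rightarrow> ('k, 'x, 'h, 'a) tensor) \<Rightarrow> _"
    by (rule vector_space_nscale)
  show "nscale c (u + v) = nscale c u + nscale c v" by (rule scale_right_distrib)
  show "nscale c (0 :: nat \<Rightarrow> ('k, 'x, 'h, 'a) tensor) = 0" by (rule scale_zero_right)
  show "nscale c (ksgn e u) = ksgn e (nscale c u)" by (simp only: ksgn_def scale_minus_right split: if_split) blast
qed

section \<open>Module axioms and induced maps, extended from words to all elements\<close>

locale bar_data =
  fixes A :: "('k::field, 'a::ab_group_add) dga" and H :: "('k, 'h::ab_group_add) ainf"
    and f :: "(int \<times> 'h) list \<Rightarrow> 'a" and n :: enat and e :: 'h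
  assumes A: "dg_algebra A" and H: "ainf_algebra H" and f: "ainf_morphism H (ainf_of A) f"
begin

abbreviation B :: "('k, 'x::ab_group_add, 'h) amod \<Rightarrow> int \<Rightarrow> (nat \<Rightarrow> ('k, 'x, 'h, 'a) tensor) set" where
  "B X d \<equiv> hcomp (bar n H A f X) d"

abbreviation "is_mod \<equiv> amodule (n + 1) H e"
abbreviation "is_mor \<equiv> amod_morphism (n + 1) H"
abbreviation "D \<equiv> bar_dif H A f"
abbreviation "R \<equiv> bar_act H A"
abbreviation "F \<equiv> bar_map H A"
text \<open>\<open>E\<close> acts on functions of words, \<open>D\<close> on elements of the bar
  construction; the function \<open>W X\<close> is where the two meet.\<close>

abbreviation "E \<equiv> dT H A f"
abbreviation "W X \<equiv> bar_word X H A"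

lemma dif_word:
  assumes "is_mod X" "enat (length hs) \<le> n"
  shows "D X (W X x hs a) = E X (W X) x hs a"
  by (rule bar_dif_word[OF A H f assms(1)]) (simp add: enat_less_plus_one assms(2))

text \<open>Moves an additive map \<open>T\<close> from outside the differential of a word to
  inside, where it meets single bar words again. It is used with the differential, the action and an
  induced map as \<open>T\<close>.\<close>

lemma dT_word:
  assumes X: "is_mod X" and ad: "\<And>d. hom_on (B X d) T"
    and w: "x \<in> hel X" "set hs \<subseteq> hel H" "a \<in> hel A" "enat (length hs) \<le> n"
  shows "E X (W X) x hs a \<in> B X (total_deg x hs a - 1)"
    and "T (E X (W X) x hs a) = E X (\<lambda>x hs a. T (W X x hs a)) x hs a"
proof -
  have l: "enat (length hs) < n + 1" using w by (simp add: enat_less_plus_one)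
  have m: "W X y ws b \<in> B X (total_deg x hs a - 1)"
    if "y \<in> hel X" "set ws \<subseteq> hel H" "b \<in> hel A" "length ws \<le> length hs" "total_deg y ws b = total_deg x hs a - 1"
    for y ws b
    using that w(4) by (intro bar_word_mem) (auto intro: order_trans[of _ "enat (length hs)"])
  show "E X (W X) x hs a \<in> B X (total_deg x hs a - 1)"
    "T (E X (W X) x hs a) = E X (\<lambda>x hs a. T (W X x hs a)) x hs a"
    by (rule dT_apply[OF A H f X ad m w(1,2) l w(3)]; assumption)+
qed

lemma dif_mem:
  assumes X: "is_mod X" and u: "u \<in> B X d"
  shows "D X u \<in> B X (d - 1)"
  using u
proof (induction rule: bar_induct)
  case zero
  show ?case
    using hom_on_zero[OF hom_on_bar_dif] gmodule_zero[OF gmodule_bar] by metis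
next
  case (add u v)
  then show ?case
    using hom_on_add[OF hom_on_bar_dif] hom_on_closed(4)[OF hom_on_bar_dif] by metis
next
  case (scale c u)
  then show ?case by (simp add: bar_dif_nscale hcomp_bar_closed)
next
  case (word x hs a)
  then show ?case using dT_word(1)[OF X hom_on_bar_dif, of x hs a] by (simp add: dif_word[OF X])
qed

lemma dif_dif:
  assumes X: "is_mod X" and u: "u \<in> B X d"
  shows "D X (D X u) = 0"
  using u
proof (induction rule: bar_induct)
  case zero
  show ?case using hom_on_zero[OF hom_on_bar_dif] by metis
next
  case (add u v)
  then show ?case
    using hom_on_add[OF hom_on_bar_dif] dif_mem[OF X] by (metis add.right_neutral)
next
  case (scale c u)
  then show ?case using bar_dif_nscale dif_mem[OF X] nscale_simps(2) by metis
next
  case (word x hs a)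
  have l: "enat (length hs) < n + 1" using word by (simp add: enat_less_plus_one)
  have "D X (D X (W X x hs a)) =
      E X (\<lambda>x hs a. D X (W X x hs a)) x hs a"
    unfolding dif_word[OF X word(4)] by (rule dT_word(2)[OF X hom_on_bar_dif word(1-4)])
  \<comment> \<open>The words that occur are no longer than \<open>hs\<close>, so each has at most
    \<open>n\<close> letters and the formula for its differential applies.\<close>
  also have "\<dots> = E X (E X (W X)) x hs a"
    using word(4)
    by (intro dT_cong[OF A H f X _ word(1,2) l word(3)] dif_word[OF X])
      (auto intro: order_trans[of _ "enat (length hs)"])
  also have "\<dots> = 0"
    by (rule dT_dT[OF A H f X mlinXA_bar_word word(1,2) l word(3)])
  finally show ?case .
qed

lemma act_mem:
  assumes b: "b \<in> hel A" and u: "u \<in> B X d"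
  shows "R X u b \<in> B X (d + fst b)"
  using u
proof (induction rule: bar_induct)
  case zero
  show ?case
    using hom_on_zero[OF hom_on_bar_act] gmodule_zero[OF gmodule_bar] by metis
next
  case (add u v)
  then show ?case
    unfolding bar_act_add using hom_on_closed(4)[OF hom_on_bar_dif] by metis
next
  case (scale c u)
  then show ?case by (simp add: bar_act_nscale hcomp_bar_closed)
next
  case (word x hs a)
  then show ?case unfolding bar_act_word[OF A b]
    using dg_algebraD(9)[OF A word(3) b] by (intro bar_word_mem) (auto simp: hel_def)
qed

lemma act_zero: "R X 0 b = 0"
  by (rule hom_on_zero[OF hom_on_bar_act])

lemma act_hlin:
  assumes u: "u \<in> B X d"
  shows "hlin A nscale (R X u)"
  using u
proof (induction rule: bar_induct)
  case zero
  show ?case using hlin_zero[OF vector_space_nscale, of A] by (simp only: act_zero hlin_def)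
next
  case (add u v)
  show ?case using hlin_add[OF vector_space_nscale add(3,4)] by (simp only: hlin_def bar_act_add)
next
  case (scale c u)
  interpret vector_space "nscale :: 'k \<Rightarrow> (nat \<Rightarrow> ('k, 'b, 'h, 'a) tensor) \<Rightarrow> _" by (rule vector_space_nscale)
  show ?case using scale(2)
    by (auto simp: hlin_def bar_act_nscale nscale_simps scale_left_commute)
next
  case (word x hs a)
  interpret S: vector_space "smul A" by (rule vector_space_smul[OF dg_algebraD(1)[OF A]])
  have sub: "S.subspace (hcomp A d)" for d using dg_algebraD(1)[OF A] by (simp add: gmodule_def)
  have "hlin A nscale (\<lambda>b. W X x hs ((\<lambda>d. fst a + d) (fst b), mul A a b))"
    by (rule hlin_comp[OF mlinXAD(2)[OF mlinXA_bar_word word(1,2), of \<infinity>] dg_algebraD(5)[OF A word(3)]])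
      (auto intro: dg_algebraD(9)[OF A word(3)])
  then show ?case unfolding hlin_def
    by (auto simp: bar_act_word[OF A] hel_def S.subspace_add[OF sub] S.subspace_scale[OF sub])
qed

lemma act_unt:
  assumes u: "u \<in> B X d"
  shows "R X u (0, unt A) = u"
  using u
proof (induction rule: bar_induct)
  case (word x hs a)
  have "(0, unt A) \<in> hel A" using dg_algebraD(7)[OF A] by (simp add: hel_def)
  then show ?case using dg_algebraD(8)[OF A word(3)] by (simp add: bar_act_word[OF A])
qed (simp_all only: act_zero bar_act_add bar_act_nscale)

lemma act_act:
  assumes u: "u \<in> B X d" and b: "b \<in> hel A" and c: "c \<in> hel A"
  shows "R X (R X u b) c = R X u (fst b + fst c, mul A b c)"
  using u
proof (induction rule: bar_induct)
  case (word x hs a)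
  have "(fst b + fst c, mul A b c) \<in> hel A" using dg_algebraD(9)[OF A b c] by (simp add: hel_def)
  then show ?case using dg_algebraD(11)[OF A word(3) b c]
    by (simp add: bar_act_word[OF A] b c add.assoc)
qed (simp_all only: act_zero bar_act_add bar_act_nscale)

text \<open>Right multiplication by \<open>b\<close> passes through every operation, except that
  \<open>dif A\<close> on the last factor obeys the Leibniz rule. The extra term comes from the
  splitting in which the last operation takes \<open>a\<close> alone; the sign of that splitting in
  \<open>dA\<close> and the degree of \<open>a\<close> make up the total degree.\<close>

lemma dT_mul:
  assumes hs: "set hs \<subseteq> hel H" and a: "a \<in> hel A" and b: "b \<in> hel A"
    and \<phi>: "hlin A nscale (\<phi> x hs)"
  shows "E X \<phi> x hs (fst a + fst b, mul A a b) =
    E X (\<lambda>x hs a. \<phi> x hs (fst a + fst b, mul A a b)) x hs a +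
    ksgn (total_deg x hs a) (\<phi> x hs (fst a + (fst b - 1), mul A a (fst b - 1, dif A b)))"
proof -
  let ?ab = "(fst a + fst b, mul A a b)"
  let ?S = "\<lambda>u v. (len v + 1) * (fst x + dl u) + len u + len v"
  let ?L = "\<lambda>u v. \<phi> x u (dl v + len v + fst ?ab - 1, mA A f v ?ab)"
  let ?R = "\<lambda>u v. \<phi> x u (fst (dl v + len v + fst a - 1, mA A f v a) + fst b,
    mul A (dl v + len v + fst a - 1, mA A f v a) b)"
  let ?Q = "\<phi> x hs (fst a + (fst b - 1), mul A a (fst b - 1, dif A b))"
  have ab: "?ab \<in> hel A" using dg_algebraD(9)[OF A a b] by (simp add: hel_def)
  have "ksgn (?S u v) (?L u v) = ksgn (?S u v) (?R u v) + (if v = [] then ksgn (total_deg x u a) (\<phi> x u (fst a + (fst b - 1), mul A a (fst b - 1, dif A b))) else 0)"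
    if uv: "u @ v = hs" for u v
  proof (cases "v = []")
    case True
    let ?d = "fst a + fst b - 1"
    have da: "(fst a - 1, dif A a) \<in> hel A" and db: "(fst b - 1, dif A b) \<in> hel A"
      using dg_algebraD(3)[OF A a] dg_algebraD(3)[OF A b] by (simp_all add: hel_def)
    have ad: "hom_on (hcomp A ?d) (\<lambda>y. \<phi> x hs (?d, y))"
      by (rule hom_on_hlin[OF dg_algebraD(1)[OF A] \<phi>])
    have m1: "mul A (fst a - 1, dif A a) b \<in> hcomp A ?d"
      using dg_algebraD(9)[OF A da b] by (simp add: algebra_simps)
    have m2: "mul A a (fst b - 1, dif A b) \<in> hcomp A ?d"
      using dg_algebraD(9)[OF A a db] by (simp add: algebra_simps)
    have "\<phi> x hs (?d, dif A ?ab) = \<phi> x hs (?d, mul A (fst a - 1, dif A a) b) +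
        ksgn (fst a) (\<phi> x hs (?d, mul A a (fst b - 1, dif A b)))"
      unfolding dg_algebraD(10)[OF A a b] hom_on_add[OF ad m1 hom_on_closed(3)[OF ad m2]]
        hom_on_ksgn[OF ad m2] ..
    moreover have "fst a + (fst b - 1) = ?d" "fst a - 1 + fst b = ?d" by simp_all
    moreover have "u = hs" using uv True by simp
    ultimately show ?thesis
      by (simp only: True mA_def simp_thms if_True dl_simps list.size of_nat_0 fst_conv add_0_left add_0_right
          mult_1_left ksgn_simps)
  next
    \<comment> \<open>Here the last operation multiplies by a value of \<open>f\<close> from the
      left, which commutes with multiplication by \<open>b\<close> from the right by
      associativity.\<close>
    case False
    have fv: "(dl v + len v - 1, f v) \<in> hel A"
      using f False uv hs unfolding ainf_morphism_def hel_def ainf_of_def by auto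
    let ?d = "fst (dl v + len v - 1, f v) + fst a"
    have ad: "hom_on (hcomp A ?d) (\<lambda>y. mul A (?d, y) b)"
      by (rule hom_on_hlin[OF dg_algebraD(1)[OF A] dg_algebraD(6)[OF A b]])
    have "mul A (?d, mA A f v a) b = ksgn (len v + 1) (mul A (?d, mul A (dl v + len v - 1, f v) a) b)"
      using False hom_on_ksgn[OF ad dg_algebraD(9)[OF A fv a]] by (simp add: mA_def add.commute)
    also have "\<dots> = ksgn (len v + 1) (mul A (dl v + len v - 1, f v) ?ab)"
      unfolding dg_algebraD(11)[OF A fv a b] ..
    also have "\<dots> = mA A f v ?ab"
      using False by (simp add: mA_def add.commute)
    finally have "mul A (?d, mA A f v a) b = mA A f v ?ab" .
    moreover have "?d = dl v + len v + fst a - 1" by simp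
    ultimately show ?thesis using False by (simp add: algebra_simps)
  qed
  then have "cut2 (\<lambda>u v. ksgn (?S u v) (?L u v)) hs = cut2 (\<lambda>u v. ksgn (?S u v) (?R u v)) hs +
    ksgn (total_deg x hs a) ?Q"
    using cut2_last[of "\<lambda>u. ksgn (total_deg x u a) (\<phi> x u (fst a + (fst b - 1), mul A a (fst b - 1, dif A b)))" hs]
    unfolding cut2_add[symmetric] by (metis (no_types, lifting) cut2_add cut2_cong)
  then show ?thesis unfolding dT_def dA_def by (simp only: add.assoc)
qed

text \<open>On a word the action changes only the last factor, so \<open>dT_mul\<close> gives the
  differential of the product; the action, being additive, then moves out of
  \<open>E\<close>.\<close>

lemma act_leibniz:
  assumes X: "is_mod X" and u: "u \<in> B X d" and b: "b \<in> hel A"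
  shows "D X (R X u b) =
    R X (D X u) b + ksgn d (R X u (fst b - 1, dif A b))"
  using u
proof (induction rule: bar_induct)
  case zero
  show ?case
    by (simp only: act_zero hom_on_zero[OF hom_on_bar_dif[of n H A f X 0]] ksgn_simps add_0_left)
next
  case (add u v)
  note dif = hom_on_add[OF hom_on_bar_dif]
  have "D X (R X (u + v) b) =
      D X (R X u b) + D X (R X v b)"
    unfolding bar_act_add by (rule dif[OF act_mem[OF b add(1)] act_mem[OF b add(2)]])
  then show ?case
    unfolding add(3,4) dif[OF add(1,2)] bar_act_add ksgn_simps by (simp only: add_ac)
next
  case (scale c u)
  show ?case
    unfolding bar_act_nscale bar_dif_nscale[OF act_mem[OF b scale(1)]] bar_dif_nscale[OF scale(1)]
      scale(2) nscale_simps ..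
next
  case (word x hs a)
  have l: "enat (length hs) < n + 1" using word by (simp add: enat_less_plus_one)
  have db: "(fst b - 1, dif A b) \<in> hel A"
    using dg_algebraD(3)[OF A b] by (simp add: hel_def)
  have "D X (R X (W X x hs a) b) =
      E X (W X) x hs (fst a + fst b, mul A a b)"
    unfolding bar_act_word[OF A b] by (rule dif_word[OF X word(4)])
  also have "\<dots> = E X (\<lambda>x hs a. W X x hs (fst a + fst b, mul A a b)) x hs a +
      ksgn d (W X x hs (fst a + (fst b - 1), mul A a (fst b - 1, dif A b)))"
    unfolding word(5)[symmetric]
    by (rule dT_mul[where \<phi> = "W X", OF word(2,3) b mlinXAD(2)[OF mlinXA_bar_word word(1,2) l]])
  also have "E X (\<lambda>x hs a. W X x hs (fst a + fst b, mul A a b)) x hs a =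
      E X (\<lambda>x hs a. R X (W X x hs a) b) x hs a"
    unfolding bar_act_word[OF A b] ..
  also have "\<dots> = R X (E X (W X) x hs a) b"
    by (rule dT_word(2)[OF X hom_on_bar_act word(1-4), symmetric])
  finally show ?case
    unfolding dif_word[OF X word(4)] bar_act_word[OF A db] fst_conv .
qed

lemma dg_module_bar:
  assumes X: "is_mod X"
  shows "dg_module A (bar n H A f X)"
  unfolding dg_module_def bar_simps
proof (intro conjI allI ballI)
  show "gmodule (bar n H A f X)" by (rule gmodule_bar)
  show "hlin (bar n H A f X) nscale (\<lambda>u. D X (snd u))"
    unfolding hlin_def bar_simps snd_conv
    by (intro allI ballI conjI bar_dif_nscale hom_on_add[OF hom_on_bar_dif])
  show "hlin A nscale (R X (snd u))" if "u \<in> hel (bar n H A f X)" for u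
    using that by (intro act_hlin[of _ _ "fst u"]) (simp add: hel_def)
  show "hlin (bar n H A f X) nscale (\<lambda>u. R X (snd u) a)" for a
    unfolding hlin_def bar_simps snd_conv
    by (intro allI ballI conjI bar_act_nscale bar_act_add)
next
  fix p u assume u: "u \<in> B X p"
  show "D X (snd (p, u)) \<in> B X (p - 1)"
    unfolding snd_conv by (rule dif_mem[OF X u])
  show "D X (snd (p - 1, D X (snd (p, u)))) = 0"
    unfolding snd_conv by (rule dif_dif[OF X u])
  show "R X (snd (p, u)) (0, unt A) = u"
    unfolding snd_conv by (rule act_unt[OF u])
  fix q b assume b: "b \<in> hcomp A q"
  then have b': "(q, b) \<in> hel A" by (simp add: hel_def)
  show "R X (snd (p, u)) (q, b) \<in> B X (p + q)"
    using act_mem[OF b' u] by simp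
  show "D X (snd (p + q, R X (snd (p, u)) (q, b))) =
      R X (snd (p - 1, D X (snd (p, u)))) (q, b) +
      ksgn p (R X (snd (p, u)) (q - 1, dif A (q, b)))"
    using act_leibniz[OF X u b'] unfolding snd_conv fst_conv .
  fix r c assume c: "c \<in> hcomp A r"
  then have c': "(r, c) \<in> hel A" by (simp add: hel_def)
  show "R X (snd (p + q, R X (snd (p, u)) (q, b))) (r, c) =
      R X (snd (p, u)) (q + r, mul A (q, b) (r, c))"
    using act_act[OF u b' c'] unfolding snd_conv fst_conv .
qed

section \<open>The map induced by a morphism\<close>

lemma map_word:
  assumes "is_mor X Y g" "enat (length hs) \<le> n"
  shows "F Y g (W X x hs a) = pull 0 g (\<lambda>y ws. W Y y ws a) x hs"
  by (rule bar_map_word[OF amod_morphismD(1,2)[OF assms(1)]]) (simp_all add: enat_less_plus_one assms(2))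

lemma pull_word:
  assumes g: "is_mor X Y g" and ad: "\<And>d. hom_on (B Y d) T"
    and w: "x \<in> hel X" "set hs \<subseteq> hel H" "a \<in> hel A" "enat (length hs) \<le> n"
  shows "pull 0 g (\<lambda>y ws. W Y y ws a) x hs \<in> B Y (total_deg x hs a)"
    and "T (pull 0 g (\<lambda>y ws. W Y y ws a) x hs) =
      pull 0 g (\<lambda>y ws. T (W Y y ws a)) x hs"
proof -
  have l: "enat (length hs) < n + 1" using w by (simp add: enat_less_plus_one)
  have m: "W Y y ws a \<in> B Y (total_deg x hs a)"
    if "y \<in> hel Y" "set ws \<subseteq> hel H" "length ws \<le> length hs"
      "fst y + dl ws + len ws = fst x + dl hs + len hs + 0" for y ws
    using that w(3,4) by (intro bar_word_mem) (auto intro: order_trans[of _ "enat (length hs)"])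
  show "pull 0 g (\<lambda>y ws. W Y y ws a) x hs \<in> B Y (total_deg x hs a)"
    "T (pull 0 g (\<lambda>y ws. W Y y ws a) x hs) = pull 0 g (\<lambda>y ws. T (W Y y ws a)) x hs"
    by (rule pull_apply[where \<phi> = "\<lambda>y ws. W Y y ws a" and S = "B Y (total_deg x hs a)"
        and g = g and x = x and hs = hs and \<delta> = 0, OF ad amod_morphismD(2)[OF g w(1)] m w(2) l]; assumption)+
qed

lemma pull_word_cong:
  assumes g: "is_mor X Y g"
    and w: "x \<in> hel X" "set hs \<subseteq> hel H" "enat (length hs) \<le> n"
    and eq: "\<And>y ws. y \<in> hel Y \<Longrightarrow> set ws \<subseteq> hel H \<Longrightarrow> enat (length ws) \<le> n \<Longrightarrow> \<phi> y ws = \<psi> y ws"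
  shows "pull 0 g \<phi> x hs = pull 0 g \<psi> x hs"
proof (rule pull_cong_valid[where H = H and Y = Y and l = "n + 1"])
  show "enat (length hs) < n + 1" using w by (simp add: enat_less_plus_one)
  show "\<phi> y ws = \<psi> y ws" if "y \<in> hel Y" "set ws \<subseteq> hel H" "length ws \<le> length hs" for y ws
    using that w(3) by (intro eq) (auto intro: order_trans[of _ "enat (length hs)"])
qed (use w amod_morphismD(2)[OF g] in auto)

lemma map_zero:
  fixes g :: "int \<times> 'x::ab_group_add \<Rightarrow> (int \<times> 'h) list \<Rightarrow> 'y::ab_group_add"
  shows "F Y g 0 = 0"
  by (rule hom_on_zero[OF hom_on_bar_map[of n H A f _ 0]])

lemma map_mem:
  assumes g: "is_mor X Y g" and u: "u \<in> B X d"
  shows "F Y g u \<in> B Y d"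
  using u
proof (induction rule: bar_induct)
  case zero
  show ?case unfolding map_zero by (rule gmodule_zero[OF gmodule_bar])
next
  case (add u v)
  then show ?case
    using hom_on_add[OF hom_on_bar_map] hom_on_closed(4)[OF hom_on_bar_dif] by metis
next
  case (scale c u)
  then show ?case by (simp add: bar_map_nscale hcomp_bar_closed)
next
  case (word x hs a)
  then show ?case using pull_word(1)[OF g hom_on_bar_dif, of x hs a] by (simp add: map_word[OF g])
qed

text \<open>On a word both composites reduce to transposed operators: \<open>D\<close> moves inside
  \<open>pull 0 g\<close>, \<open>dT_pull\<close> exchanges the two operators, and the induced map
  moves out of \<open>E\<close>.\<close>

lemma map_dif:
  assumes X: "is_mod X" and Y: "is_mod Y"
    and g: "is_mor X Y g" and u: "u \<in> B X d"
  shows "D Y (F Y g u) = F Y g (D X u)"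
  using u
proof (induction rule: bar_induct)
  case zero
  show ?case
    by (simp only: map_zero hom_on_zero[OF hom_on_bar_dif[of n H A f X 0]] hom_on_zero[OF hom_on_bar_dif[of n H A f Y 0]])
next
  case (add u v)
  show ?case
    unfolding hom_on_add[OF hom_on_bar_dif add(1,2)] hom_on_add[OF hom_on_bar_map add(1,2)]
      hom_on_add[OF hom_on_bar_map dif_mem[OF X add(1)] dif_mem[OF X add(2)]]
      hom_on_add[OF hom_on_bar_dif map_mem[OF g add(1)] map_mem[OF g add(2)]] add(3,4) ..
next
  case (scale c u)
  show ?case
    unfolding bar_dif_nscale[OF scale(1)] bar_map_nscale[OF scale(1)]
      bar_map_nscale[OF dif_mem[OF X scale(1)]] bar_dif_nscale[OF map_mem[OF g scale(1)]] scale(2) ..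
next
  case (word x hs a)
  have l: "enat (length hs) < n + 1" using word by (simp add: enat_less_plus_one)
  have "D Y (F Y g (W X x hs a)) =
      pull 0 g (\<lambda>y ws. D Y (W Y y ws a)) x hs"
    unfolding map_word[OF g word(4)] by (rule pull_word(2)[OF g hom_on_bar_dif word(1-4)])
  also have "\<dots> = pull 0 g (\<lambda>y ws. E Y (W Y) y ws a) x hs"
    by (rule pull_word_cong[OF g word(1,2,4)]) (rule dif_word[OF Y])
  also have "\<dots> = E X (\<lambda>x hs a. pull 0 g (\<lambda>y ws. W Y y ws a) x hs) x hs a"
    by (rule dT_pull[OF H X Y g mlinXA_bar_word word(1,2) l word(3), symmetric])
  also have "\<dots> = E X (\<lambda>x hs a. F Y g (W X x hs a)) x hs a"
    using word(4)
    by (intro dT_cong[OF A H f X _ word(1,2) l word(3)] map_word[OF g, symmetric])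
      (auto intro: order_trans[of _ "enat (length hs)"])
  also have "\<dots> = F Y g (E X (W X) x hs a)"
    by (rule dT_word(2)[OF X hom_on_bar_map word(1-4), symmetric])
  finally show ?case unfolding dif_word[OF X word(4)] .
qed

lemma map_act:
  assumes g: "is_mor X Y g" and u: "u \<in> B X d" and b: "b \<in> hel A"
  shows "R Y (F Y g u) b = F Y g (R X u b)"
  using u
proof (induction rule: bar_induct)
  case zero
  show ?case by (simp only: map_zero act_zero)
next
  case (add u v)
  show ?case
    unfolding hom_on_add[OF hom_on_bar_map add(1,2)] bar_act_add
      hom_on_add[OF hom_on_bar_map act_mem[OF b add(1)] act_mem[OF b add(2)]] add(3,4) ..
next
  case (scale c u)
  show ?case
    unfolding bar_map_nscale[OF scale(1)] bar_act_nscale bar_map_nscale[OF act_mem[OF b scale(1)]] scale(2) ..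
next
  case (word x hs a)
  have "R Y (F Y g (W X x hs a)) b =
      pull 0 g (\<lambda>y ws. R Y (W Y y ws a) b) x hs"
    unfolding map_word[OF g word(4)] by (rule pull_word(2)[OF g hom_on_bar_act word(1-4)])
  then show ?case unfolding bar_act_word[OF A b] map_word[OF g word(4)] .
qed

text \<open>The identity has no components with letters, so of the splittings in \<open>pull\<close>
  only the one with empty prefix survives.\<close>

lemma map_id:
  assumes X: "is_mod X" and u: "u \<in> B X d"
  shows "F X (amod_id H X) u = u"
  using u
proof (induction rule: bar_induct)
  case zero
  show ?case by (rule map_zero)
next
  case (add u v)
  show ?case unfolding hom_on_add[OF hom_on_bar_map add(1,2)] add(3,4) ..
next
  case (scale c u)
  show ?case unfolding bar_map_nscale[OF scale(1)] scale(2) ..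
next
  case (word x hs a)
  have "pull 0 (amod_id H X) (\<lambda>y ws. W X y ws a) x hs =
      cut2 (\<lambda>u v. if u = [] then W X x v a else 0) hs"
    unfolding pull_def
  proof (rule cut2_cong)
    fix u v assume uv: "u @ v = hs"
    have "hom_on (hcomp X d) (\<lambda>y. W X (d, y) v a)" for d
      using uv word(2)
      by (intro mlinX_hom_on[where l = \<infinity>, OF mlinXAD(1)[OF mlinXA_bar_word word(3)] amoduleD(1)[OF X]]) auto
    note hom_on_zero[OF this]
    then show "ksgn ((len u + 0) * len v) (W X (fst x + dl u + len u + 0, amod_id H X x u) v a) =
        (if u = [] then W X x v a else 0)"
      using word(1) by (cases "u = []") (simp_all only: amod_id_def if_True if_False simp_thms ksgn_simps
        dl_simps list.size of_nat_0 add_0_right mult_zero_left prod.collapse)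
  qed
  then show ?case
    unfolding map_word[OF amod_id_morphism[OF H X] word(4)] cut2_first .
qed

text \<open>On a word the composite of the induced maps is an iterated \<open>pull\<close>, with
  \<open>g\<close> outermost because it acts first; associativity makes it the pull along the
  composite.\<close>

lemma map_comp:
  assumes X: "is_mod X" and Y: "is_mod Y" and Z: "is_mod Z"
    and g: "is_mor X Y g" and h: "is_mor Y Z h" and u: "u \<in> B X d"
  shows "F Z (amod_comp (n + 1) h g) u = F Z h (F Y g u)"
  using u
proof (induction rule: bar_induct)
  case zero
  show ?case by (simp only: map_zero)
next
  case (add u v)
  show ?case
    unfolding hom_on_add[OF hom_on_bar_map add(1,2)]
      hom_on_add[OF hom_on_bar_map map_mem[OF g add(1)] map_mem[OF g add(2)]] add(3,4) ..
next
  case (scale c u)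
  show ?case
    unfolding bar_map_nscale[OF scale(1)] bar_map_nscale[OF map_mem[OF g scale(1)]] scale(2) ..
next
  case (word x hs a)
  have l: "enat (length hs) < n + 1" using word by (simp add: enat_less_plus_one)
  have "F Z h (F Y g (W X x hs a)) =
      pull 0 g (\<lambda>y ws. F Z h (W Y y ws a)) x hs"
    unfolding map_word[OF g word(4)] by (rule pull_word(2)[OF g hom_on_bar_map word(1-4)])
  also have "\<dots> = pull 0 g (\<lambda>y ws. pull 0 h (\<lambda>z ws. W Z z ws a) y ws) x hs"
    by (rule pull_word_cong[OF g word(1,2,4)]) (rule map_word[OF h])
  also have "\<dots> = pull 0 (pull 0 g h) (\<lambda>z ws. W Z z ws a) x hs"
    by (rule pull_pull_morphism[OF g amoduleD(1)[OF Z] amod_morphismD(2)[OF h]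
      mlinXAD(1)[OF mlinXA_bar_word word(3)] word(1,2) l])
  also have "\<dots> = pull 0 (amod_comp (n + 1) h g) (\<lambda>z ws. W Z z ws a) x hs"
    using l by (intro pull_cong) (auto simp: amod_comp_eq intro: enat_le_less)
  also have "\<dots> = F Z (amod_comp (n + 1) h g) (W X x hs a)"
    by (rule map_word[OF amod_morphism_comp[OF H X Y Z g h] word(4), symmetric])
  finally show ?case ..
qed

section \<open>Assembling the functor, with morphisms normalized outside their domain\<close>

lemma bar_mor_morphism:
  assumes X: "is_mod X" and Y: "is_mod Y"
    and g: "is_mor X Y g"
  shows "dgm_morphism A (bar n H A f X) (bar n H A f Y) (bar_mor n H A f X Y g)"
proof -
  have m: "bar_mor n H A f X Y g (p, u) = F Y g u" if "u \<in> B X p" for p u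
    using that by (simp only: bar_mor_eq hel_def mem_Collect_eq fst_conv snd_conv if_True)
  have "hlin (bar n H A f X) nscale (bar_mor n H A f X Y g)"
    unfolding hlin_def bar_simps
    by (auto simp: m hom_on_closed(4)[OF hom_on_bar_dif] hom_on_add[OF hom_on_bar_map]
        hcomp_bar_closed bar_map_nscale)
  moreover have "bar_mor n H A f X Y g (p, u) \<in> B Y p \<and>
      D Y (bar_mor n H A f X Y g (p, u)) = bar_mor n H A f X Y g (p - 1, D X u) \<and>
      (\<forall>q. \<forall>a\<in>hcomp A q. R Y (bar_mor n H A f X Y g (p, u)) (q, a) =
        bar_mor n H A f X Y g (p + q, R X u (q, a)))" if u: "u \<in> B X p" for p u
  proof (intro conjI allI ballI)
    show "bar_mor n H A f X Y g (p, u) \<in> B Y p"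
      unfolding m[OF u] by (rule map_mem[OF g u])
    show "D Y (bar_mor n H A f X Y g (p, u)) = bar_mor n H A f X Y g (p - 1, D X u)"
      unfolding m[OF u] m[OF dif_mem[OF X u]] by (rule map_dif[OF X Y g u])
    fix q a assume "a \<in> hcomp A q"
    then have a: "(q, a) \<in> hel A" by (simp add: hel_def)
    from act_mem[OF this u] have "R X u (q, a) \<in> B X (p + q)" by (simp only: fst_conv)
    then show "R Y (bar_mor n H A f X Y g (p, u)) (q, a) =
        bar_mor n H A f X Y g (p + q, R X u (q, a))"
      unfolding m[OF u] by (simp only: m map_act[OF g u a])
  qed
  ultimately show ?thesis unfolding dgm_morphism_def bar_simps snd_conv by blast
qed

lemma bar_mor_id:
  assumes X: "is_mod X"
  shows "bar_mor n H A f X X (amod_id H X) = (\<lambda>u. if u \<in> hel (bar n H A f X) then snd u else 0)"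
proof
  fix u
  show "bar_mor n H A f X X (amod_id H X) u = (if u \<in> hel (bar n H A f X) then snd u else 0)"
    using map_id[OF X, of "snd u" "fst u"] by (simp only: bar_mor_eq hel_def mem_Collect_eq split: if_split) blast
qed

lemma bar_mor_comp:
  assumes X: "is_mod X" and Y: "is_mod Y" and Z: "is_mod Z"
    and g: "is_mor X Y g" and h: "is_mor Y Z h"
  shows "bar_mor n H A f X Z (amod_comp (n + 1) h g) =
    (\<lambda>u. bar_mor n H A f Y Z h (fst u, bar_mor n H A f X Y g u))"
proof
  fix u
  show "bar_mor n H A f X Z (amod_comp (n + 1) h g) u =
      bar_mor n H A f Y Z h (fst u, bar_mor n H A f X Y g u)"
  proof (cases "u \<in> hel (bar n H A f X)")
    case True
    then have u: "snd u \<in> B X (fst u)" by (simp add: hel_def)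
    have "(fst u, F Y g (snd u)) \<in> hel (bar n H A f Y)"
      using map_mem[OF g u] by (simp add: hel_def)
    then show ?thesis
      using True by (simp only: bar_mor_eq if_True snd_conv map_comp[OF X Y Z g h u])
  next
    \<comment> \<open>Outside the domain the inner value is 0, and the outer map sends 0 to 0
      whether or not its own cutoff applies.\<close>
    case False
    then show ?thesis by (simp only: bar_mor_eq if_False snd_conv map_zero split: if_split) blast
  qed
qed

end

theorem proposition4p5:
  fixes A :: "('k::field, 'a::ab_group_add) dga"
    and H :: "('k, 'h::ab_group_add) ainf"
    and cls :: "int \<times> 'a \<Rightarrow> 'h"
    and f :: "(int \<times> 'h) list \<Rightarrow> 'a"
    and n :: enat
  assumes "dg_algebra A"
    and "homology_ainf A H cls"
    and "ainf_quasi_iso H (ainf_of A) f"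
    and "1 \<le> n"
  shows "is_functor
     (amod_cat (n + 1) H (cls (0, unt A)) ::
        (('k, 'x::ab_group_add, 'h) amod, int \<times> 'x \<Rightarrow> (int \<times> 'h) list \<Rightarrow> 'x) cat)
     (dgm_cat A)
     (bar n H A f)
     (bar_mor n H A f)"
proof -
  have H: "ainf_algebra H" using assms(2) by (simp add: homology_ainf_def)
  interpret bar_data A H f n "cls (0, unt A)"
    using assms(1,3) H by unfold_locales (auto simp: ainf_quasi_iso_def)
  let ?C = "amod_cat (n + 1) H (cls (0, unt A)) ::
    (('k, 'x, 'h) amod, int \<times> 'x \<Rightarrow> (int \<times> 'h) list \<Rightarrow> 'x) cat"
  have obj: "amodule (n + 1) H (cls (0, unt A)) X" if "X \<in> Obj ?C" for X
    using that by (simp add: amod_cat_def)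
  have hom: "amod_morphism (n + 1) H X Y g" if "g \<in> Hom ?C X Y" for X Y g
    using that by (simp add: amod_cat_def)
  have C: "Idm ?C = amod_id H" "Cmp ?C = amod_comp (n + 1)" by (simp_all add: amod_cat_def)
  show ?thesis unfolding is_functor_def C
  proof (intro conjI ballI)
    show "is_category ?C" by (rule is_category_amod_cat[OF H]) (simp add: add_pos_nonneg)
    show "is_category (dgm_cat A)" by (rule is_category_dgm_cat)
  next
    fix X assume X: "X \<in> Obj ?C"
    show "bar n H A f X \<in> Obj (dgm_cat A)"
      using dg_module_bar[OF obj[OF X]] by (simp add: dgm_cat_def)
    show "bar_mor n H A f X X (amod_id H X) = Idm (dgm_cat A) (bar n H A f X)"
      using bar_mor_id[OF obj[OF X]] by (simp only: dgm_cat_def cat.simps)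
    fix Y g assume Y: "Y \<in> Obj ?C" and g: "g \<in> Hom ?C X Y"
    have "\<forall>u. u \<notin> hel (bar n H A f X) \<longrightarrow> bar_mor n H A f X Y g u = 0"
      by (simp add: bar_mor_eq del: split_paired_All)
    then show "bar_mor n H A f X Y g \<in> Hom (dgm_cat A) (bar n H A f X) (bar n H A f Y)"
      using bar_mor_morphism[OF obj[OF X] obj[OF Y] hom[OF g]] by (simp only: dgm_cat_def cat.simps mem_Collect_eq)
    fix Z h assume Z: "Z \<in> Obj ?C" and h: "h \<in> Hom ?C Y Z"
    show "bar_mor n H A f X Z (amod_comp (n + 1) h g) =
        Cmp (dgm_cat A) (bar_mor n H A f Y Z h) (bar_mor n H A f X Y g)"
      using bar_mor_comp[OF obj[OF X] obj[OF Y] obj[OF Z] hom[OF g] hom[OF h]]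
      by (simp only: dgm_cat_def cat.simps)
  qed
qed

end
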